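(* Let $\Gamma$ be a countable group generated by $s_1,\dots,s_r$ ($r\ge1$), let $\mathtt{A}$ be a finite nonempty alphabet, and let $J:\mathtt{A}^2\to\mathbb{R}$ be symmetric and $h:\mathtt{A}\to\mathbb{R}$. If $\Gamma$ has property PA, then a shift-invariant measure $\mu\in\mathrm{Prob}^\Gamma(\mathtt{A}^\Gamma)$ is Gibbs if and only if it is Glauber-invariant, i.e. $\mu S^\Gamma(t)=\mu$ for all $t\ge0$.
   Context: $\Gamma$ acts on $\mathtt{A}^\Gamma$ by $(\beta\mathbf{y})(\gamma)=\mathbf{y}(\gamma\beta)$; $\mathrm{Prob}^\Gamma(\mathtt{A}^\Gamma)$ is the set of Borel probability measures invariant under this action (shift-invariant). A shift-invariant measure is periodic if it has finite support; $\Gamma$ has property PA if, for every finite alphabet $\mathtt{B}$, the set of periodic measures is weakly dense in $\mathrm{Prob}^\Gamma(\mathtt{B}^\Gamma)$. For $\gamma\in\Gamma$, $\mathbf{x}\in\mathtt{A}^\Gamma$, let $\Phi_\gamma(\mathbf{x})=h(\mathbf{x}(\gamma))+\sum_{i=1}^r\big[J(\mathbf{x}(\gamma),\mathbf{x}(s_i\gamma))+J(\mathbf{x}(\gamma),\mathbf{x}(s_i^{-1}\gamma))\big]$. Let $\mathbf{x}^{\gamma\to\mathtt{a}}$ be $\mathbf{x}$ with its value at $\gamma$ replaced by $\mathtt{a}$, and $c_\gamma(\mathbf{x},\mathtt{a})=\exp\{-\Phi_\gamma(\mathbf{x}^{\gamma\to\mathtt{a}})\}/\sum_{\mathtt{b}\in\mathtt{A}}\exp\{-\Phi_\gamma(\mathbf{x}^{\gamma\to\mathtt{b}})\}$.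 Glauber dynamics: $S^\Gamma(t)$, $t\ge0$, is the Markov semigroup on $C(\mathtt{A}^\Gamma)$ whose generator is the closure of $\Omega^\Gamma f(\mathbf{x})=\sum_{\gamma\in\Gamma}\sum_{\mathtt{a}\in\mathtt{A}}c_\gamma(\mathbf{x},\mathtt{a})[f(\mathbf{x}^{\gamma\to\mathtt{a}})-f(\mathbf{x})]$, defined on continuous $f$ with $\sum_{\gamma}\sup\{|f(\eta_1)-f(\eta_2)|:\eta_1=\eta_2\text{ off }\gamma\}<\infty$. $\mu S^\Gamma(t)$ is the measure with $[\mu S^\Gamma(t)]f=\mu[S^\Gamma(t)f]$. $\mu\in\mathrm{Prob}(\mathtt{A}^\Gamma)$ is Gibbs if for each $\gamma\in\Gamma$, $\mathtt{a}\in\mathtt{A}$, the function $\mathbf{y}\mapsto c_\gamma(\mathbf{y},\mathtt{a})$ is a version of $\mu(\mathbf{x}(\gamma)=\mathtt{a}\mid\mathscr{T}_\gamma)(\mathbf{y})$, where $\mathscr{T}_\gamma$ is the $\sigma$-algebra generated by all coordinates other than $\gamma$. *)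

theory Defs
  imports "HOL-Algebra.Generated_Groups" "HOL-Probability.Conditional_Expectation"
begin

section \<open>Borel probability measures on a topological space\<close>

definition borel_on :: "'x topology \<Rightarrow> 'x measure" where
  "borel_on X = sigma (topspace X) {U. openin X U}"

definition Prob :: "'x topology \<Rightarrow> 'x measure set" where
  "Prob X = {\<mu>. prob_space \<mu> \<and> sets \<mu> = sets (borel_on X)}"

text \<open>Only the values of a function on \<open>topspace X\<close> matter: \<open>C X\<close> is closed under changing
  functions outside \<open>topspace X\<close>, and the relations below do not see such changes.\<close>

definition C :: "'x topology \<Rightarrow> ('x \<Rightarrow> real) set" where
  "C X = {f. continuous_map X euclideanreal f}"

definition weak_topology :: "'x topology \<Rightarrow> 'x measure topology" where
  "weak_topology X = topology_generated_by
     {{\<nu> \<in> Prob X. (\<integral>x. f x \<partial>\<nu>) \<in> U} | f U. f \<in> C X \<and> open U}"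

definition measure_support :: "'x topology \<Rightarrow> 'x measure \<Rightarrow> 'x set" where
  "measure_support X \<mu> = {x \<in> topspace X. \<forall>U. openin X U \<and> x \<in> U \<longrightarrow> emeasure \<mu> U > 0}"


section \<open>Markov semigroups on \<open>C X\<close> and their generators\<close>

definition markov_semigroup :: "'x topology \<Rightarrow> (real \<Rightarrow> ('x \<Rightarrow> real) \<Rightarrow> ('x \<Rightarrow> real)) \<Rightarrow> bool" where
  "markov_semigroup X S \<longleftrightarrow>
     (\<forall>t\<ge>0. \<forall>f\<in>C X. S t f \<in> C X) \<and>
     (\<forall>t\<ge>0. \<forall>f\<in>C X. \<forall>g\<in>C X. \<forall>a b. \<forall>x\<in>topspace X.
        S t (\<lambda>y. a * f y + b * g y) x = a * S t f x + b * S t g x) \<and>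
     (\<forall>f\<in>C X. \<forall>x\<in>topspace X. S 0 f x = f x) \<and>
     (\<forall>f\<in>C X. \<forall>t\<ge>0. uniform_limit (topspace X) (\<lambda>u. S u f) (S t f) (at_right t)) \<and>
     (\<forall>f\<in>C X. \<forall>t\<ge>0. \<forall>u\<ge>0. \<forall>x\<in>topspace X. S (t + u) f x = S t (S u f) x) \<and>
     (\<forall>t\<ge>0. \<forall>x\<in>topspace X. S t (\<lambda>_. 1) x = 1) \<and>
     (\<forall>t\<ge>0. \<forall>f\<in>C X. (\<forall>x\<in>topspace X. f x \<ge> 0) \<longrightarrow> (\<forall>x\<in>topspace X. S t f x \<ge> 0))"

text \<open>Unbounded operators on \<open>C X\<close> are represented by their graphs; convergence in \<open>C X\<close> is
  uniform convergence on \<open>topspace X\<close>.\<close>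

definition generator_graph ::
  "'x topology \<Rightarrow> (real \<Rightarrow> ('x \<Rightarrow> real) \<Rightarrow> ('x \<Rightarrow> real)) \<Rightarrow> (('x \<Rightarrow> real) \<times> ('x \<Rightarrow> real)) set" where
  "generator_graph X S = {(f, g). f \<in> C X \<and> g \<in> C X \<and>
     uniform_limit (topspace X) (\<lambda>t x. (S t f x - f x) / t) g (at_right 0)}"

definition graph_closure ::
  "'x topology \<Rightarrow> (('x \<Rightarrow> real) \<times> ('x \<Rightarrow> real)) set \<Rightarrow> (('x \<Rightarrow> real) \<times> ('x \<Rightarrow> real)) set" where
  "graph_closure X R = {(f, g). f \<in> C X \<and> g \<in> C X \<and>
     (\<exists>F H. (\<forall>n::nat. (F n, H n) \<in> R) \<and>
        uniform_limit (topspace X) F f sequentially \<and> uniform_limit (topspace X) H g sequentially)}"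

text \<open>\<open>evolves_to X S t \<mu> \<nu>\<close> says that \<open>\<nu>\<close> is the measure \<open>\<mu> S(t)\<close>; the integrals of continuous
  functions determine it.\<close>

definition evolves_to ::
  "'x topology \<Rightarrow> (real \<Rightarrow> ('x \<Rightarrow> real) \<Rightarrow> ('x \<Rightarrow> real)) \<Rightarrow> real \<Rightarrow> 'x measure \<Rightarrow> 'x measure \<Rightarrow> bool" where
  "evolves_to X S t \<mu> \<nu> \<longleftrightarrow> \<nu> \<in> Prob X \<and> (\<forall>f\<in>C X. (\<integral>x. f x \<partial>\<nu>) = (\<integral>x. S t f x \<partial>\<mu>))"

definition semigroup_invariant ::
  "'x topology \<Rightarrow> (real \<Rightarrow> ('x \<Rightarrow> real) \<Rightarrow> ('x \<Rightarrow> real)) \<Rightarrow> 'x measure \<Rightarrow> bool" where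
  "semigroup_invariant X S \<mu> \<longleftrightarrow> (\<forall>t\<ge>0. evolves_to X S t \<mu> \<mu>)"


section \<open>The full shift and property PA\<close>

definition config_top :: "('g, 'm) monoid_scheme \<Rightarrow> 'a set \<Rightarrow> ('g \<Rightarrow> 'a) topology" where
  "config_top G A = product_topology (\<lambda>_. discrete_topology A) (carrier G)"

definition shift :: "('g, 'm) monoid_scheme \<Rightarrow> 'g \<Rightarrow> ('g \<Rightarrow> 'a) \<Rightarrow> ('g \<Rightarrow> 'a)" where
  "shift G \<beta> y = (\<lambda>\<gamma>\<in>carrier G. y (\<gamma> \<otimes>\<^bsub>G\<^esub> \<beta>))"

definition shift_invariant_Prob :: "('g, 'm) monoid_scheme \<Rightarrow> 'a set \<Rightarrow> ('g \<Rightarrow> 'a) measure set" where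
  "shift_invariant_Prob G A =
     {\<mu> \<in> Prob (config_top G A). \<forall>\<beta>\<in>carrier G. distr \<mu> \<mu> (shift G \<beta>) = \<mu>}"

definition periodic_measures :: "('g, 'm) monoid_scheme \<Rightarrow> 'a set \<Rightarrow> ('g \<Rightarrow> 'a) measure set" where
  "periodic_measures G A =
     {\<mu> \<in> shift_invariant_Prob G A. finite (measure_support (config_top G A) \<mu>)}"

text \<open>Up to relabelling, every finite alphabet is a finite set of natural numbers.\<close>

definition property_PA :: "('g, 'm) monoid_scheme \<Rightarrow> bool" where
  "property_PA G \<longleftrightarrow> (\<forall>B :: nat set. finite B \<longrightarrow>
     shift_invariant_Prob G B \<subseteq> weak_topology (config_top G B) closure_of periodic_measures G B)"


section \<open>Glauber dynamics and Gibbs measures\<close>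

definition \<Phi> :: "('g, 'm) monoid_scheme \<Rightarrow> (nat \<Rightarrow> 'g) \<Rightarrow> nat \<Rightarrow> ('a \<Rightarrow> 'a \<Rightarrow> real) \<Rightarrow> ('a \<Rightarrow> real)
    \<Rightarrow> 'g \<Rightarrow> ('g \<Rightarrow> 'a) \<Rightarrow> real" where
  "\<Phi> G s r J h \<gamma> x = h (x \<gamma>) +
     (\<Sum>i=1..r. J (x \<gamma>) (x (s i \<otimes>\<^bsub>G\<^esub> \<gamma>)) + J (x \<gamma>) (x (inv\<^bsub>G\<^esub> (s i) \<otimes>\<^bsub>G\<^esub> \<gamma>)))"

definition rate :: "('g, 'm) monoid_scheme \<Rightarrow> 'a set \<Rightarrow> (nat \<Rightarrow> 'g) \<Rightarrow> nat \<Rightarrow> ('a \<Rightarrow> 'a \<Rightarrow> real)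
    \<Rightarrow> ('a \<Rightarrow> real) \<Rightarrow> 'g \<Rightarrow> ('g \<Rightarrow> 'a) \<Rightarrow> 'a \<Rightarrow> real" where
  "rate G A s r J h \<gamma> x a =
     exp (- \<Phi> G s r J h \<gamma> (x(\<gamma> := a))) / (\<Sum>b\<in>A. exp (- \<Phi> G s r J h \<gamma> (x(\<gamma> := b))))"

definition oscillation :: "('g, 'm) monoid_scheme \<Rightarrow> 'a set \<Rightarrow> (('g \<Rightarrow> 'a) \<Rightarrow> real) \<Rightarrow> 'g \<Rightarrow> real" where
  "oscillation G A f \<gamma> =
     Sup {\<bar>f \<eta>\<^sub>1 - f \<eta>\<^sub>2\<bar> | \<eta>\<^sub>1 \<eta>\<^sub>2. \<eta>\<^sub>1 \<in> topspace (config_top G A) \<and> \<eta>\<^sub>2 \<in> topspace (config_top G A) \<and>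
       (\<forall>\<delta>\<in>carrier G - {\<gamma>}. \<eta>\<^sub>1 \<delta> = \<eta>\<^sub>2 \<delta>)}"

definition \<Omega> :: "('g, 'm) monoid_scheme \<Rightarrow> 'a set \<Rightarrow> (nat \<Rightarrow> 'g) \<Rightarrow> nat \<Rightarrow> ('a \<Rightarrow> 'a \<Rightarrow> real)
    \<Rightarrow> ('a \<Rightarrow> real) \<Rightarrow> (('g \<Rightarrow> 'a) \<Rightarrow> real) \<Rightarrow> ('g \<Rightarrow> 'a) \<Rightarrow> real" where
  "\<Omega> G A s r J h f x =
     (\<Sum>\<^sub>\<infinity>\<gamma>\<in>carrier G. \<Sum>a\<in>A. rate G A s r J h \<gamma> x a * (f (x(\<gamma> := a)) - f x))"

definition \<Omega>_graph :: "('g, 'm) monoid_scheme \<Rightarrow> 'a set \<Rightarrow> (nat \<Rightarrow> 'g) \<Rightarrow> nat \<Rightarrow> ('a \<Rightarrow> 'a \<Rightarrow> real)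
    \<Rightarrow> ('a \<Rightarrow> real) \<Rightarrow> ((('g \<Rightarrow> 'a) \<Rightarrow> real) \<times> (('g \<Rightarrow> 'a) \<Rightarrow> real)) set" where
  "\<Omega>_graph G A s r J h = {(f, \<Omega> G A s r J h f) | f.
     f \<in> C (config_top G A) \<and> oscillation G A f summable_on carrier G}"

definition glauber_semigroup :: "('g, 'm) monoid_scheme \<Rightarrow> 'a set \<Rightarrow> (nat \<Rightarrow> 'g) \<Rightarrow> nat
    \<Rightarrow> ('a \<Rightarrow> 'a \<Rightarrow> real) \<Rightarrow> ('a \<Rightarrow> real)
    \<Rightarrow> (real \<Rightarrow> (('g \<Rightarrow> 'a) \<Rightarrow> real) \<Rightarrow> (('g \<Rightarrow> 'a) \<Rightarrow> real)) \<Rightarrow> bool" where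
  "glauber_semigroup G A s r J h S \<longleftrightarrow>
     markov_semigroup (config_top G A) S \<and>
     generator_graph (config_top G A) S = graph_closure (config_top G A) (\<Omega>_graph G A s r J h)"

definition off_site :: "('g, 'm) monoid_scheme \<Rightarrow> 'a set \<Rightarrow> 'g \<Rightarrow> ('g \<Rightarrow> 'a) measure" where
  "off_site G A \<gamma> = sigma (topspace (config_top G A))
     {{x \<in> topspace (config_top G A). x \<delta> \<in> B} | \<delta> B. \<delta> \<in> carrier G - {\<gamma>} \<and> B \<subseteq> A}"

definition cond_prob_version ::
  "'x measure \<Rightarrow> 'x measure \<Rightarrow> 'x set \<Rightarrow> ('x \<Rightarrow> real) \<Rightarrow> bool" where
  "cond_prob_version M F E g \<longleftrightarrow>
     g \<in> borel_measurable F \<and> (AE x in M. real_cond_exp M F (indicator E) x = g x)"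

definition gibbs :: "('g, 'm) monoid_scheme \<Rightarrow> 'a set \<Rightarrow> (nat \<Rightarrow> 'g) \<Rightarrow> nat \<Rightarrow> ('a \<Rightarrow> 'a \<Rightarrow> real)
    \<Rightarrow> ('a \<Rightarrow> real) \<Rightarrow> ('g \<Rightarrow> 'a) measure \<Rightarrow> bool" where
  "gibbs G A s r J h \<mu> \<longleftrightarrow> \<mu> \<in> Prob (config_top G A) \<and>
     (\<forall>\<gamma>\<in>carrier G. \<forall>a\<in>A. cond_prob_version \<mu> (off_site G A \<gamma>)
        {x \<in> topspace (config_top G A). x \<gamma> = a} (\<lambda>y. rate G A s r J h \<gamma> y a))"

end

theory Submission
  imports Defs "HOL-Probability.Infinite_Product_Measure"
begin

text \<open>
  A measure is Gibbs iff it is invariant under resampling the spin at any site, and then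
  \<open>\<mu> (\<Omega> f) = 0\<close> for every local \<open>f\<close>; local functions form a core of the generator, so \<open>\<mu>\<close> is
  invariant.

  Conversely let \<open>\<mu>\<close> be invariant, so that \<open>\<mu>\<close> is fixed by the resolvent \<open>(1 - \<kappa> \<Omega>)\<^sup>-\<^sup>1\<close> for all
  \<open>\<kappa> > 0\<close>. Property PA, applied to \<open>\<mu>\<close> with independent random labels, provides finite
  \<open>\<Gamma>\<close>-sets \<open>V\<close>, free at most points, with a spin configuration whose local statistics are close to
  \<open>\<mu>\<close>. On \<open>V\<close> the dynamics has an explicit reversible measure, and the relative entropy with
  respect to it is between \<open>0\<close> and a constant times \<open>card V\<close>. By convexity, passing to the resolvent
  on \<open>V\<close>, an implicit Euler step of length \<open>\<kappa>\<close>, lowers the relative entropy by at least \<open>\<kappa>\<close> times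
  the entropy dissipation of the result. So the dissipation per site is \<open>O(1 / \<kappa>)\<close>, and a typical site is
  within \<open>O(1 / sqrt \<kappa>)\<close> of being invariant under resampling. The local statistics of the finite
  resolvents converge to \<open>(1 - \<kappa> \<Omega>)\<^sup>-\<^sup>1 \<mu> = \<mu>\<close>. Hence \<open>\<mu>\<close> is within \<open>O(1 / sqrt \<kappa>)\<close> of being
  invariant under resampling, for every \<open>\<kappa>\<close>.
\<close>

section \<open>Heat-bath dynamics and entropy on a finite set\<close>

text \<open>The familiar entropy argument cuts a finite box out of \<Gamma> and needs its boundary
  to be small against its volume, which fails for non-amenable groups. A finite \<Gamma>-set has no
  boundary, so its entropy balance is exact. The price is that some points see a wrong
  neighbourhood; the random labels serve to make such points rare. The implicit Euler step replaces
  evolution in time for two reasons. Its dissipation is evaluated at the end point, which is the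
  very law whose local statistics are followed to the limit. And it is characterised by a linear
  equation in \<open>f - \<kappa> * \<L> f\<close>, which can be tested on local functions alone, so
  finite and infinite dynamics need not be compared at positive times. The square root in the final
  rate arises because entropy dissipation controls the squares of total variation distances. The
  limits are taken in a fixed order: first the \<Gamma>-sets improve at constant \<kappa>, then
  \<kappa> grows.\<close>

definition heat_bath :: "('x \<Rightarrow> real) \<Rightarrow> ('x \<Rightarrow> 'x set) \<Rightarrow> ('x \<Rightarrow> real) \<Rightarrow> 'x \<Rightarrow> real" where
  "heat_bath w E \<zeta> x = w x * sum \<zeta> (E x) / sum w (E x)"

text \<open>Conditional expectation under the weights \<open>w\<close>, given the class of a point;
  \<open>heat_bath\<close> is the dual action on densities.\<close>

definition local_mean :: "('x \<Rightarrow> real) \<Rightarrow> ('x \<Rightarrow> 'x set) \<Rightarrow> ('x \<Rightarrow> real) \<Rightarrow> 'x \<Rightarrow> real" where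
  "local_mean w E f x = (\<Sum>y\<in>E x. w y * f y) / sum w (E x)"

text \<open>Intended reading: \<open>X\<close> holds spin configurations, \<open>V\<close> the
  sites, and \<open>E v x\<close> the configurations that agree with \<open>x\<close> off
  \<open>v\<close>. The weights are unnormalised, so no partition function has to be
  handled.\<close>

locale partitioned_weights =
  fixes X :: "'x set" and V :: "'v set" and E :: "'v \<Rightarrow> 'x \<Rightarrow> 'x set" and w :: "'x \<Rightarrow> real"
  assumes finite_X: "finite X" and finite_V: "finite V" and V_nonempty: "V \<noteq> {}"
    and E_refl: "\<And>v x. v \<in> V \<Longrightarrow> x \<in> X \<Longrightarrow> x \<in> E v x"
    and E_subset: "\<And>v x. v \<in> V \<Longrightarrow> x \<in> X \<Longrightarrow> E v x \<subseteq> X"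
    and E_eq: "\<And>v x y. v \<in> V \<Longrightarrow> x \<in> X \<Longrightarrow> y \<in> E v x \<Longrightarrow> E v y = E v x"
    and w_pos: "\<And>x. x \<in> X \<Longrightarrow> w x > 0"
begin

lemma finite_E: "v \<in> V \<Longrightarrow> x \<in> X \<Longrightarrow> finite (E v x)"
  using E_subset finite_X finite_subset by blast

lemma sum_w_E_pos: "v \<in> V \<Longrightarrow> x \<in> X \<Longrightarrow> sum w (E v x) > 0"
  using finite_E E_refl E_subset w_pos by (intro sum_pos) blast+

lemma heat_bath_nonneg:
  assumes "v \<in> V" "x \<in> X" "\<And>y. y \<in> X \<Longrightarrow> \<zeta> y \<ge> 0"
  shows "heat_bath w (E v) \<zeta> x \<ge> 0"
proof -
  have "sum \<zeta> (E v x) \<ge> 0" using assms E_subset by (intro sum_nonneg) blast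
  then show ?thesis
    using sum_w_E_pos[OF assms(1,2)] w_pos[OF assms(2)] by (simp add: heat_bath_def)
qed

lemma heat_bath_pos:
  assumes "v \<in> V" "x \<in> X" "\<And>y. y \<in> X \<Longrightarrow> \<zeta> y > 0"
  shows "heat_bath w (E v) \<zeta> x > 0"
proof -
  have "sum \<zeta> (E v x) > 0"
    using assms E_subset E_refl finite_E by (intro sum_pos) blast+
  then show ?thesis
    using sum_w_E_pos[OF assms(1,2)] w_pos[OF assms(2)] by (simp add: heat_bath_def)
qed

text \<open>Detailed balance: both sides are the same double sum over pairs in a common class, where
  \<open>E v x = E v y\<close> lets the two variables exchange roles.\<close>

lemma heat_bath_adjoint:
  assumes v: "v \<in> V"
  shows "(\<Sum>x\<in>X. heat_bath w (E v) \<zeta> x * f x) = (\<Sum>x\<in>X. \<zeta> x * local_mean w (E v) f x)"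
proof -
  have sym: "x \<in> E v y \<longleftrightarrow> y \<in> E v x" if "x \<in> X" "y \<in> X" for x y
    using that E_eq[OF v] E_refl[OF v] by metis
  have restr: "sum g (E v x) = (\<Sum>y\<in>X. if y \<in> E v x then g y else 0)" if "x \<in> X" for g :: "'x \<Rightarrow> real" and x
    using sum.inter_restrict[OF finite_X, of g "E v x"] E_subset[OF v that] by (simp add: Int_absorb1)
  have "(\<Sum>x\<in>X. heat_bath w (E v) \<zeta> x * f x)
      = (\<Sum>x\<in>X. \<Sum>y\<in>X. if y \<in> E v x then w x * \<zeta> y * f x / sum w (E v x) else 0)"
  proof (intro sum.cong refl)
    fix x assume x: "x \<in> X"
    have "(\<Sum>y\<in>X. if y \<in> E v x then w x * \<zeta> y * f x / sum w (E v x) else 0)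
        = (\<Sum>y\<in>E v x. w x * \<zeta> y * f x / sum w (E v x))"
      by (rule restr[OF x, of "\<lambda>y. w x * \<zeta> y * f x / sum w (E v x)", symmetric])
    also have "\<dots> = heat_bath w (E v) \<zeta> x * f x"
      unfolding heat_bath_def sum_distrib_left sum_divide_distrib sum_distrib_right
      by (simp only: times_divide_eq_left)
    finally show "heat_bath w (E v) \<zeta> x * f x
        = (\<Sum>y\<in>X. if y \<in> E v x then w x * \<zeta> y * f x / sum w (E v x) else 0)" by simp
  qed
  also have "\<dots> = (\<Sum>y\<in>X. \<Sum>x\<in>X. if y \<in> E v x then w x * \<zeta> y * f x / sum w (E v x) else 0)"
    by (rule sum.swap)
  also have "\<dots> = (\<Sum>y\<in>X. \<Sum>x\<in>X. if x \<in> E v y then \<zeta> y * (w x * f x) / sum w (E v y) else 0)"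
  proof (intro sum.cong refl)
    fix x y assume x: "x \<in> X" and y: "y \<in> X"
    show "(if x \<in> E v y then w y * \<zeta> x * f y / sum w (E v y) else 0)
        = (if y \<in> E v x then \<zeta> x * (w y * f y) / sum w (E v x) else 0)"
    proof (cases "x \<in> E v y")
      case True
      have "y \<in> E v x" using True sym[OF x y] by blast
      moreover have "E v x = E v y" using E_eq[OF v y True] .
      ultimately show ?thesis using True by (simp only: if_True mult_ac)
    qed (use sym[OF x y] in simp)
  qed
  also have "\<dots> = (\<Sum>x\<in>X. \<zeta> x * local_mean w (E v) f x)"
  proof (intro sum.cong refl)
    fix y assume y: "y \<in> X"
    have "(\<Sum>x\<in>X. if x \<in> E v y then \<zeta> y * (w x * f x) / sum w (E v y) else 0)
        = (\<Sum>x\<in>E v y. \<zeta> y * (w x * f x) / sum w (E v y))"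
      by (rule restr[OF y, of "\<lambda>x. \<zeta> y * (w x * f x) / sum w (E v y)", symmetric])
    also have "\<dots> = \<zeta> y * local_mean w (E v) f y"
      unfolding local_mean_def sum_distrib_left sum_divide_distrib by (simp only: times_divide_eq_right)
    finally show "(\<Sum>x\<in>X. if x \<in> E v y then \<zeta> y * (w x * f x) / sum w (E v y) else 0)
        = \<zeta> y * local_mean w (E v) f y" .
  qed
  finally show ?thesis .
qed

lemma local_mean_const_on:
  assumes "v \<in> V" "x \<in> X" "\<And>y. y \<in> E v x \<Longrightarrow> f y = f x"
  shows "local_mean w (E v) f x = f x"
proof -
  have "(\<Sum>y\<in>E v x. w y * f y) = sum w (E v x) * f x"
    unfolding sum_distrib_right using assms by (intro sum.cong) auto
  then show ?thesis using sum_w_E_pos[OF assms(1,2)] by (simp add: local_mean_def)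
qed

lemma sum_heat_bath: "v \<in> V \<Longrightarrow> (\<Sum>x\<in>X. heat_bath w (E v) \<zeta> x) = sum \<zeta> X"
  using heat_bath_adjoint[of v \<zeta> "\<lambda>_. 1"] local_mean_const_on[of v _ "\<lambda>_. 1"] by simp

text \<open>Division by \<open>1 + \<kappa> * card V\<close> turns the equation into
  \<open>\<zeta> = (1 - q) * \<zeta>0 + q * T \<zeta>\<close>, where \<open>T\<close> averages the
  heat baths over the sites. Its Neumann series is the law at a geometric time of the chain
  \<open>T\<close> started from \<open>\<zeta>0\<close>. The lower bound later keeps
  \<open>\<zeta>\<close> positive, so that logarithms can be taken.\<close>

lemma resolvent_exists:
  fixes \<kappa> :: real
  assumes \<zeta>0: "\<And>x. x \<in> X \<Longrightarrow> \<zeta>0 x \<ge> 0" and sum1: "sum \<zeta>0 X = 1" and lam: "\<kappa> > 0"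
  obtains \<zeta> where "\<And>x. x \<in> X \<Longrightarrow> \<zeta> x \<ge> \<zeta>0 x / (1 + \<kappa> * card V)"
    "sum \<zeta> X = 1"
    "\<And>x. x \<in> X \<Longrightarrow> \<zeta> x = \<zeta>0 x + \<kappa> * (\<Sum>v\<in>V. heat_bath w (E v) \<zeta> x - \<zeta> x)"
proof -
  define n where "n = real (card V)"
  have n: "n > 0" using finite_V V_nonempty by (simp add: n_def card_gt_0_iff)
  define q where "q = \<kappa> * n / (1 + \<kappa> * n)"
  have ln: "1 + \<kappa> * n > 0" using n lam by (simp add: add_pos_pos)
  have q: "0 < q" "q < 1" using n lam ln by (auto simp: q_def field_simps)
  have q1: "1 - q = 1 / (1 + \<kappa> * n)" using ln by (simp add: q_def field_simps)
  define T where "T \<zeta> x = (\<Sum>v\<in>V. heat_bath w (E v) \<zeta> x) / n" for \<zeta> x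
  define Z where "Z k = (T ^^ k) \<zeta>0" for k
  have Z_Suc: "Z (Suc k) = T (Z k)" for k by (simp add: Z_def)
  have Z: "(\<forall>x\<in>X. Z k x \<ge> 0) \<and> sum (Z k) X = 1" for k
  proof (induction k)
    case 0
    then show ?case using \<zeta>0 sum1 by (simp add: Z_def)
  next
    case (Suc k)
    have "(\<Sum>x\<in>X. \<Sum>v\<in>V. heat_bath w (E v) (Z k) x) = n"
      using Suc by (subst sum.swap) (simp add: sum_heat_bath n_def)
    then have "sum (T (Z k)) X = 1" using n by (simp add: T_def flip: sum_divide_distrib)
    then show ?case using Suc n heat_bath_nonneg
      by (auto simp: Z_Suc T_def intro!: divide_nonneg_pos sum_nonneg)
  qed
  have Z_le: "Z k x \<le> 1" if "x \<in> X" for k x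
    using member_le_sum[of x X "Z k"] Z[of k] finite_X that by auto
  define \<zeta> where "\<zeta> x = (\<Sum>k. (1 - q) * q ^ k * Z k x)" for x
  have summ: "summable (\<lambda>k. (1 - q) * q ^ k * Z k x)" if "x \<in> X" for x
  proof (rule summable_comparison_test')
    show "summable (\<lambda>k. (1 - q) * q ^ k)" using q by (intro summable_mult summable_geometric) auto
    show "norm ((1 - q) * q ^ k * Z k x) \<le> (1 - q) * q ^ k" for k
      using Z[of k] Z_le[OF that] q that by (simp add: abs_mult mult_left_le)
  qed
  then have sums: "(\<lambda>k. (1 - q) * q ^ k * Z k x) sums \<zeta> x" if "x \<in> X" for x
    unfolding \<zeta>_def using that by (simp add: summable_sums)
  have T_sums: "(\<lambda>k. (1 - q) * q ^ k * T (Z k) x) sums T \<zeta> x" if x: "x \<in> X" for x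
  proof -
    have "(\<lambda>k. \<Sum>v\<in>V. w x * (\<Sum>y\<in>E v x. (1 - q) * q ^ k * Z k y) / sum w (E v x))
        sums (\<Sum>v\<in>V. w x * (\<Sum>y\<in>E v x. \<zeta> y) / sum w (E v x))"
      by (intro sums_sum sums_divide sums_mult sums) (use E_subset x in blast)
    then have "(\<lambda>k. (\<Sum>v\<in>V. w x * (\<Sum>y\<in>E v x. (1 - q) * q ^ k * Z k y) / sum w (E v x)) / n)
        sums T \<zeta> x"
      unfolding T_def heat_bath_def by (rule sums_divide)
    also have "(\<lambda>k. (\<Sum>v\<in>V. w x * (\<Sum>y\<in>E v x. (1 - q) * q ^ k * Z k y) / sum w (E v x)) / n)
       = (\<lambda>k. (1 - q) * q ^ k * T (Z k) x)"
      by (rule ext) (simp add: T_def heat_bath_def sum_distrib_left sum_divide_distrib mult_ac)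
    finally show ?thesis .
  qed
  \<comment> \<open>The term of index 0 is split off; the rest of the series is \<open>q\<close>
    times its image under \<open>T\<close>.\<close>
  have fp: "\<zeta> x = (1 - q) * \<zeta>0 x + q * T \<zeta> x" if x: "x \<in> X" for x
  proof -
    have "(\<lambda>k. q * ((1 - q) * q ^ k * T (Z k) x)) sums (q * T \<zeta> x)"
      using T_sums[OF x] by (rule sums_mult)
    then have "(\<lambda>k. (1 - q) * q ^ Suc k * Z (Suc k) x) sums (q * T \<zeta> x)"
      by (simp add: Z_Suc mult_ac)
    then have "(\<lambda>k. (1 - q) * q ^ k * Z k x) sums (q * T \<zeta> x + (1 - q) * q ^ 0 * Z 0 x)"
      by (rule sums_Suc_iff[of "\<lambda>k. (1 - q) * q ^ k * Z k x", THEN iffD1])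
    then show ?thesis using sums_unique2[OF sums[OF x]] by (simp add: Z_def)
  qed
  have nonneg: "\<zeta> x \<ge> 0" if x: "x \<in> X" for x
    unfolding \<zeta>_def using Z q x by (intro suminf_nonneg summ) auto
  have T_nonneg: "T \<zeta> x \<ge> 0" if x: "x \<in> X" for x
    unfolding T_def using n x heat_bath_nonneg nonneg by (auto intro!: divide_nonneg_pos sum_nonneg)
  show thesis
  proof (rule that)
    fix x assume x: "x \<in> X"
    have "\<zeta> x \<ge> (1 - q) * \<zeta>0 x" using fp[OF x] T_nonneg[OF x] q by simp
    then show "\<zeta> x \<ge> \<zeta>0 x / (1 + \<kappa> * card V)" using q1 by (simp add: n_def)
    have "(1 + \<kappa> * n) * \<zeta> x = (1 + \<kappa> * n) * (1 - q) * \<zeta>0 x + (1 + \<kappa> * n) * q * T \<zeta> x"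
      by (subst fp[OF x]) (simp add: algebra_simps)
    also have "\<dots> = \<zeta>0 x + \<kappa> * (n * T \<zeta> x)" using ln q1 by (simp add: q_def)
    also have "n * T \<zeta> x = (\<Sum>v\<in>V. heat_bath w (E v) \<zeta> x)" using n by (simp add: T_def)
    finally show "\<zeta> x = \<zeta>0 x + \<kappa> * (\<Sum>v\<in>V. heat_bath w (E v) \<zeta> x - \<zeta> x)"
      by (simp add: sum_subtractf n_def algebra_simps)
  next
    have "(\<lambda>k. \<Sum>x\<in>X. (1 - q) * q ^ k * Z k x) sums (\<Sum>x\<in>X. \<zeta> x)"
      by (intro sums_sum sums)
    moreover have "(\<Sum>x\<in>X. (1 - q) * q ^ k * Z k x) = (1 - q) * q ^ k" for k
      using Z[of k] by (simp flip: sum_distrib_left)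
    moreover have "(\<lambda>k. (1 - q) * q ^ k) sums 1"
      using sums_mult[OF geometric_sums[of q], of "1 - q"] q by simp
    ultimately show "sum \<zeta> X = 1" using sums_unique2 by simp
  qed
qed

text \<open>A Pinsker-type bound. For the heat bath \<open>P\<close> of \<open>\<zeta>\<close>,
  \<open>ln (P / w)\<close> is constant on classes while \<open>\<zeta> - P\<close> has mass zero on
  each class. Hence \<open>w\<close> may be replaced by \<open>P\<close> under the logarithm, and
  the sum on the right becomes a symmetrised relative entropy. The constant 2 is the total mass of
  \<open>\<zeta> + P\<close>.\<close>

lemma entropy_dissipation:
  assumes z: "\<And>x. x \<in> X \<Longrightarrow> \<zeta> x > 0" and v: "v \<in> V" and sum1: "sum \<zeta> X = 1"
  shows "(\<Sum>x\<in>X. \<bar>\<zeta> x - heat_bath w (E v) \<zeta> x\<bar>)\<^sup>2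
      \<le> 2 * (\<Sum>x\<in>X. (\<zeta> x - heat_bath w (E v) \<zeta> x) * ln (\<zeta> x / w x))"
proof -
  define P where "P = heat_bath w (E v) \<zeta>"
  have P: "P x > 0" if "x \<in> X" for x
    unfolding P_def using heat_bath_pos v that z by blast
  have sumP: "sum P X = 1" using sum_heat_bath[OF v, of \<zeta>] sum1 by (simp add: P_def)
  have const: "local_mean w (E v) (\<lambda>x. ln (P x / w x)) x = ln (P x / w x)" if x: "x \<in> X" for x
  proof (rule local_mean_const_on[OF v x])
    fix y assume y: "y \<in> E v x"
    then have "y \<in> X" using E_subset v x by blast
    then show "ln (P y / w y) = ln (P x / w x)"
      using w_pos[of x] w_pos[of y] x E_eq[OF v x y] by (simp add: P_def heat_bath_def)
  qed
  have zero: "(\<Sum>x\<in>X. (\<zeta> x - P x) * ln (P x / w x)) = 0"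
    using heat_bath_adjoint[OF v, of \<zeta> "\<lambda>x. ln (P x / w x)"] const
    by (simp add: left_diff_distrib sum_subtractf P_def[symmetric])
  \<comment> \<open>The logarithmic mean of \<open>a\<close> and \<open>b\<close> is at most
    \<open>a + b\<close>; this comes from \<open>ln t \<le> t - 1\<close> at
    \<open>t = b / a\<close>.\<close>
  have pt: "(a - b)\<^sup>2 / (a + b) \<le> (a - b) * (ln a - ln b)" if "a > 0" "b > 0" for a b :: real
  proof -
    have *: "(a - b)\<^sup>2 / (a + b) \<le> (a - b) * (ln a - ln b)" if "a > 0" "b > 0" "a \<ge> b" for a b :: real
    proof -
      have "ln (b / a) \<le> b / a - 1" using that by (intro ln_le_minus_one) simp
      then have "(a - b) / a \<le> ln a - ln b" using that by (simp add: ln_div diff_divide_distrib)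
      moreover have "(a - b) / (a + b) \<le> (a - b) / a" using that by (intro divide_left_mono) auto
      ultimately have "(a - b) / (a + b) \<le> ln a - ln b" by linarith
      from mult_left_mono[OF this, of "a - b"] that show ?thesis by (simp add: power2_eq_square)
    qed
    show ?thesis
    proof (cases "a \<ge> b")
      case False
      have "(a - b)\<^sup>2 / (a + b) = (b - a)\<^sup>2 / (b + a)" by (simp add: power2_commute add.commute)
      also have "\<dots> \<le> (b - a) * (ln b - ln a)" using False that by (intro *) auto
      finally show ?thesis by (simp add: algebra_simps)
    qed (use * that in auto)
  qed
  \<comment> \<open>Cauchy-Schwarz with the weight \<open>\<zeta> + P\<close>, which produces
    exactly the left side of \<open>pt\<close>.\<close>
  have "(\<Sum>x\<in>X. \<bar>\<zeta> x - P x\<bar>)\<^sup>2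
      = (\<Sum>x\<in>X. \<bar>\<zeta> x - P x\<bar> / sqrt (\<zeta> x + P x) * sqrt (\<zeta> x + P x))\<^sup>2"
  proof (intro arg_cong[where f="\<lambda>t. t\<^sup>2"] sum.cong refl)
    fix x assume "x \<in> X"
    then have "sqrt (\<zeta> x + P x) > 0" using z[of x] P[of x] by simp
    then show "\<bar>\<zeta> x - P x\<bar> = \<bar>\<zeta> x - P x\<bar> / sqrt (\<zeta> x + P x) * sqrt (\<zeta> x + P x)" by simp
  qed
  also have "\<dots> \<le> (\<Sum>x\<in>X. (\<bar>\<zeta> x - P x\<bar> / sqrt (\<zeta> x + P x))\<^sup>2) * (\<Sum>x\<in>X. (sqrt (\<zeta> x + P x))\<^sup>2)"
    by (rule Cauchy_Schwarz_ineq_sum)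
  also have "(\<Sum>x\<in>X. (sqrt (\<zeta> x + P x))\<^sup>2) = (\<Sum>x\<in>X. \<zeta> x + P x)"
  proof (intro sum.cong refl)
    fix x assume "x \<in> X"
    then show "(sqrt (\<zeta> x + P x))\<^sup>2 = \<zeta> x + P x" using z[of x] P[of x] by simp
  qed
  also have "\<dots> = 2" using sumP sum1 by (simp add: sum.distrib)
  also have "(\<Sum>x\<in>X. (\<bar>\<zeta> x - P x\<bar> / sqrt (\<zeta> x + P x))\<^sup>2) = (\<Sum>x\<in>X. (\<zeta> x - P x)\<^sup>2 / (\<zeta> x + P x))"
  proof (intro sum.cong refl)
    fix x assume "x \<in> X"
    then show "(\<bar>\<zeta> x - P x\<bar> / sqrt (\<zeta> x + P x))\<^sup>2 = (\<zeta> x - P x)\<^sup>2 / (\<zeta> x + P x)"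
      using z[of x] P[of x] by (simp add: power_divide)
  qed
  also have "\<dots> \<le> (\<Sum>x\<in>X. (\<zeta> x - P x) * (ln (\<zeta> x) - ln (P x)))"
    using z P by (intro sum_mono pt)
  also have "\<dots> = (\<Sum>x\<in>X. (\<zeta> x - P x) * ln (\<zeta> x / w x) - (\<zeta> x - P x) * ln (P x / w x))"
  proof (intro sum.cong refl)
    fix x assume "x \<in> X"
    then show "(\<zeta> x - P x) * (ln (\<zeta> x) - ln (P x)) = (\<zeta> x - P x) * ln (\<zeta> x / w x) - (\<zeta> x - P x) * ln (P x / w x)"
      using z[of x] P[of x] w_pos[of x] by (simp add: ln_div algebra_simps)
  qed
  also have "\<dots> = (\<Sum>x\<in>X. (\<zeta> x - P x) * ln (\<zeta> x / w x))"
    using zero by (simp add: sum_subtractf)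
  finally show ?thesis by (simp add: P_def mult.commute)
qed

text \<open>Since \<open>\<Sum> \<zeta> ln (\<zeta> / w)\<close> is convex, one implicit Euler step of size \<open>\<kappa>\<close> lowers it by at
  least \<open>\<kappa>\<close> times the dissipation at the end point; as it ranges over an interval of length
  \<open>2 K + ln (card X)\<close>, the dissipation is small when \<open>\<kappa>\<close> is large.\<close>

lemma resolvent_dissipation_bound:
  fixes \<kappa> :: real
  assumes \<zeta>0: "\<And>x. x \<in> X \<Longrightarrow> \<zeta>0 x > 0" and sum0: "sum \<zeta>0 X = 1" and \<kappa>: "\<kappa> > 0"
    and \<zeta>: "\<And>x. x \<in> X \<Longrightarrow> \<zeta> x > 0" and sum1: "sum \<zeta> X = 1"
    and res: "\<And>x. x \<in> X \<Longrightarrow> \<zeta> x = \<zeta>0 x + \<kappa> * (\<Sum>v\<in>V. heat_bath w (E v) \<zeta> x - \<zeta> x)"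
    and w: "\<And>x. x \<in> X \<Longrightarrow> exp (- K) \<le> w x" "\<And>x. x \<in> X \<Longrightarrow> w x \<le> exp K"
  shows "(\<Sum>v\<in>V. \<Sum>x\<in>X. \<bar>\<zeta> x - heat_bath w (E v) \<zeta> x\<bar>)
      \<le> sqrt (real (card V) * (2 * (2 * K + ln (real (card X))) / \<kappa>))"
proof -
  have X_nonempty: "X \<noteq> {}" using sum0 by auto
  define D where "D v = (\<Sum>x\<in>X. (\<zeta> x - heat_bath w (E v) \<zeta> x) * ln (\<zeta> x / w x))" for v
  define n where "n v = (\<Sum>x\<in>X. \<bar>\<zeta> x - heat_bath w (E v) \<zeta> x\<bar>)" for v
  have nD: "(n v)\<^sup>2 \<le> 2 * D v" if "v \<in> V" for v
    unfolding n_def D_def using entropy_dissipation \<zeta> that sum1 by blast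
  \<comment> \<open>Once summed over the sites, the drift can be replaced by
    \<open>\<zeta>0 - \<zeta>\<close> through the resolvent equation.\<close>
  have "\<kappa> * (\<Sum>v\<in>V. D v) = (\<Sum>x\<in>X. (\<kappa> * (\<Sum>v\<in>V. \<zeta> x - heat_bath w (E v) \<zeta> x)) * ln (\<zeta> x / w x))"
    unfolding D_def by (subst sum.swap) (simp add: sum_distrib_left sum_distrib_right mult_ac)
  also have "\<dots> = (\<Sum>x\<in>X. (\<zeta>0 x - \<zeta> x) * ln (\<zeta> x / w x))"
  proof (intro sum.cong refl)
    fix x assume x: "x \<in> X"
    have "(\<Sum>v\<in>V. \<zeta> x - heat_bath w (E v) \<zeta> x) = - (\<Sum>v\<in>V. heat_bath w (E v) \<zeta> x - \<zeta> x)"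
      by (simp flip: sum_negf)
    then have "\<kappa> * (\<Sum>v\<in>V. \<zeta> x - heat_bath w (E v) \<zeta> x) = \<zeta>0 x - \<zeta> x"
      using res[OF x] by (simp add: algebra_simps)
    then show "(\<kappa> * (\<Sum>v\<in>V. \<zeta> x - heat_bath w (E v) \<zeta> x)) * ln (\<zeta> x / w x) = (\<zeta>0 x - \<zeta> x) * ln (\<zeta> x / w x)"
      by simp
  qed
  \<comment> \<open>Two Gibbs inequalities: \<open>\<zeta>0\<close> against \<open>\<zeta>\<close>,
    with \<open>\<zeta>0 x * ln (\<zeta>0 x) \<le> 0\<close>, and \<open>\<zeta>\<close> against the
    uniform law, which brings in \<open>ln (card X)\<close>. The differences
    \<open>\<zeta> x - \<zeta>0 x\<close> and \<open>1 / card X - \<zeta> x\<close> each sum to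
    zero.\<close>
  also have "\<dots> \<le> (\<Sum>x\<in>X. K * \<zeta>0 x + (\<zeta> x - \<zeta>0 x) + (1 / card X - \<zeta> x) + (ln (card X) + K) * \<zeta> x)"
  proof (intro sum_mono)
    fix x assume x: "x \<in> X"
    note pos = \<zeta>[OF x] \<zeta>0[OF x] w_pos[OF x]
    have N: "real (card X) > 0" using X_nonempty finite_X by (simp add: card_gt_0_iff)
    have "\<zeta>0 x \<le> 1" using member_le_sum[of x X \<zeta>0] \<zeta>0 finite_X x sum0 by (auto simp: less_imp_le)
    then have ln0: "ln (\<zeta>0 x) \<le> 0" using pos by simp
    have lnw: "ln (w x) \<le> K" "- K \<le> ln (w x)"
      using w[OF x] pos ln_ge_iff[of "w x" "- K"] ln_le_cancel_iff[of "w x" "exp K"] by auto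
    have "ln (\<zeta> x / \<zeta>0 x) \<le> \<zeta> x / \<zeta>0 x - 1" using pos by (intro ln_le_minus_one) simp
    from mult_left_mono[OF this, of "\<zeta>0 x"] pos
    have "\<zeta>0 x * ln (\<zeta> x) \<le> \<zeta> x - \<zeta>0 x + \<zeta>0 x * ln (\<zeta>0 x)"
      by (simp add: ln_div algebra_simps)
    moreover have "\<zeta>0 x * ln (\<zeta>0 x) \<le> 0" using ln0 pos by (simp add: mult_nonneg_nonpos less_imp_le)
    moreover have "\<zeta>0 x * (- K) \<le> \<zeta>0 x * ln (w x)" using lnw pos by (intro mult_left_mono) auto
    moreover have "\<zeta>0 x * ln (\<zeta> x / w x) = \<zeta>0 x * ln (\<zeta> x) - \<zeta>0 x * ln (w x)"
      using pos by (simp add: ln_div right_diff_distrib)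
    ultimately have 1: "\<zeta>0 x * ln (\<zeta> x / w x) \<le> K * \<zeta>0 x + (\<zeta> x - \<zeta>0 x)"
      unfolding mult.commute[of K] by linarith
    have "ln (1 / (card X * \<zeta> x)) \<le> 1 / (card X * \<zeta> x) - 1" using pos N by (intro ln_le_minus_one) simp
    from mult_left_mono[OF this, of "\<zeta> x"] pos N
    have "- \<zeta> x * ln (\<zeta> x) \<le> 1 / card X - \<zeta> x + \<zeta> x * ln (card X)"
      by (simp add: ln_div ln_mult algebra_simps)
    moreover have "\<zeta> x * ln (w x) \<le> \<zeta> x * K" using lnw pos by (intro mult_left_mono) auto
    moreover have "\<zeta> x * ln (\<zeta> x / w x) = \<zeta> x * ln (\<zeta> x) - \<zeta> x * ln (w x)"
      using pos by (simp add: ln_div right_diff_distrib)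
    ultimately have "- \<zeta> x * ln (\<zeta> x / w x) \<le> (1 / card X - \<zeta> x) + (ln (card X) + K) * \<zeta> x"
      unfolding mult.commute[of _ "\<zeta> x"] distrib_left mult_minus_right by linarith
    with 1 show "(\<zeta>0 x - \<zeta> x) * ln (\<zeta> x / w x)
        \<le> K * \<zeta>0 x + (\<zeta> x - \<zeta>0 x) + (1 / card X - \<zeta> x) + (ln (card X) + K) * \<zeta> x"
      by (simp add: left_diff_distrib)
  qed
  also have "\<dots> = 2 * K + ln (card X)"
    using sum0 sum1 finite_X X_nonempty
    by (simp add: sum.distrib sum_subtractf flip: sum_distrib_left)
  finally have DK: "(\<Sum>v\<in>V. D v) \<le> (2 * K + ln (card X)) / \<kappa>"
    using \<kappa> by (simp add: field_simps)
  \<comment> \<open>The entropy controls the squares \<open>(n v)\<^sup>2\<close>; Cauchy-Schwarz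
    over the sites passes to the sum at the cost of a factor \<open>card V\<close>.\<close>
  have "(\<Sum>v\<in>V. n v)\<^sup>2 \<le> (\<Sum>v\<in>V. 1\<^sup>2) * (\<Sum>v\<in>V. (n v)\<^sup>2)"
    using Cauchy_Schwarz_ineq_sum[of "\<lambda>_. 1" n V] by simp
  also have "\<dots> \<le> real (card V) * (\<Sum>v\<in>V. 2 * D v)"
    using nD by (auto intro!: mult_left_mono sum_mono)
  also have "\<dots> \<le> real (card V) * (2 * (2 * K + ln (card X)) / \<kappa>)"
  proof (intro mult_left_mono)
    have "2 * (2 * K + ln (card X)) / \<kappa> = 2 * ((2 * K + ln (card X)) / \<kappa>)" by simp
    with DK show "(\<Sum>v\<in>V. 2 * D v) \<le> 2 * (2 * K + ln (card X)) / \<kappa>"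
      unfolding sum_distrib_left[symmetric] by linarith
  qed simp
  finally show ?thesis unfolding n_def by (rule real_le_rsqrt)
qed

end

section \<open>States and Markov semigroups\<close>

lemma C_const [simp]: "(\<lambda>_. c) \<in> C X"
  by (simp add: C_def)

lemma C_lincomb:
  assumes "f \<in> C X" "g \<in> C X"
  shows "(\<lambda>x. a * f x + b * g x) \<in> C X"
  using assms unfolding C_def mem_Collect_eq
  by (intro continuous_map_add continuous_map_real_mult_left)

lemma C_diff: "f \<in> C X \<Longrightarrow> g \<in> C X \<Longrightarrow> (\<lambda>x. f x - g x) \<in> C X"
  using C_lincomb[of f X g 1 "-1"] by simp

lemma C_cmult: "f \<in> C X \<Longrightarrow> (\<lambda>x. a * f x) \<in> C X"
  using C_lincomb[of f X f a 0] by simp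

lemma C_bounded:
  assumes "compact_space X" "f \<in> C X"
  obtains B where "B \<ge> 0" "\<And>x. x \<in> topspace X \<Longrightarrow> \<bar>f x\<bar> \<le> B"
proof -
  have "compactin euclideanreal (f ` topspace X)"
    using assms unfolding C_def compact_space_def by (intro image_compactin) auto
  then have "bounded (f ` topspace X)" by (simp add: compact_imp_bounded)
  then obtain B where "\<forall>y\<in>f ` topspace X. norm y \<le> B" unfolding bounded_iff by blast
  then show thesis using that[of "max B 0"] by fastforce
qed

text \<open>By Riesz, a probability measure when \<open>X\<close> is compact Hausdorff. The
  functional form lets averages over finite \<Gamma>-sets and their limits be handled without
  constructing measures; continuity in the uniform norm follows from positivity
  (\<open>state_bound\<close>).\<close>

definition state :: "'x topology \<Rightarrow> (('x \<Rightarrow> real) \<Rightarrow> real) \<Rightarrow> bool" where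
  "state X L \<longleftrightarrow>
     (\<forall>f\<in>C X. \<forall>g\<in>C X. \<forall>a b. L (\<lambda>x. a * f x + b * g x) = a * L f + b * L g) \<and>
     L (\<lambda>_. 1) = 1 \<and>
     (\<forall>f\<in>C X. (\<forall>x\<in>topspace X. f x \<ge> 0) \<longrightarrow> L f \<ge> 0)"

lemma state_lincomb:
  "state X L \<Longrightarrow> f \<in> C X \<Longrightarrow> g \<in> C X \<Longrightarrow> L (\<lambda>x. a * f x + b * g x) = a * L f + b * L g"
  unfolding state_def by blast

lemma state_diff:
  "state X L \<Longrightarrow> f \<in> C X \<Longrightarrow> g \<in> C X \<Longrightarrow> L (\<lambda>x. f x - g x) = L f - L g"
  using state_lincomb[of X L f g 1 "-1"] by simp

lemma state_cmult: "state X L \<Longrightarrow> f \<in> C X \<Longrightarrow> L (\<lambda>x. a * f x) = a * L f"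
  using state_lincomb[of X L f f a 0] by simp

lemma state_mono:
  assumes "state X L" "f \<in> C X" "g \<in> C X" "\<And>x. x \<in> topspace X \<Longrightarrow> f x \<le> g x"
  shows "L f \<le> L g"
proof -
  have "0 \<le> L (\<lambda>x. g x - f x)"
    using assms(1) C_diff[OF assms(3,2)] assms(4) unfolding state_def by fastforce
  then show ?thesis using assms by (simp add: state_diff)
qed

lemma state_cong:
  assumes "state X L" "f \<in> C X" "g \<in> C X" "\<And>x. x \<in> topspace X \<Longrightarrow> f x = g x"
  shows "L f = L g"
proof (rule antisym)
  show "L f \<le> L g" by (rule state_mono[OF assms(1-3)]) (simp add: assms(4))
  show "L g \<le> L f" by (rule state_mono[OF assms(1,3,2)]) (simp add: assms(4))
qed

lemma state_const: "state X L \<Longrightarrow> L (\<lambda>_. c) = c"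
  using state_cmult[of X L "\<lambda>_. 1" c] by (simp add: state_def)

lemma state_bound:
  assumes "state X L" "f \<in> C X" "\<And>x. x \<in> topspace X \<Longrightarrow> \<bar>f x\<bar> \<le> K"
  shows "\<bar>L f\<bar> \<le> K"
proof -
  have "L f \<le> L (\<lambda>_. K)" using assms(3) by (intro state_mono[OF assms(1,2)]) (auto simp: abs_le_iff)
  moreover have "L (\<lambda>_. - K) \<le> L f"
    using assms(3) by (intro state_mono[OF assms(1) _ assms(2)]) (auto simp: abs_le_iff minus_le_iff)
  ultimately show ?thesis by (simp add: state_const[OF assms(1)] abs_le_iff)
qed

lemma state_diff_bound:
  assumes "state X L" "f \<in> C X" "g \<in> C X" "\<And>x. x \<in> topspace X \<Longrightarrow> \<bar>f x - g x\<bar> \<le> K"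
  shows "\<bar>L f - L g\<bar> \<le> K"
  using state_bound[OF assms(1) C_diff[OF assms(2,3)] assms(4)]
  unfolding state_diff[OF assms(1-3)] .

lemma state_tendsto:
  assumes L: "state X L" and F: "\<forall>\<^sub>F n in A. F n \<in> C X" and f: "f \<in> C X"
    and lim: "uniform_limit (topspace X) F f A"
  shows "((\<lambda>n. L (F n)) \<longlongrightarrow> L f) A"
proof (rule tendstoI)
  fix e :: real assume e: "e > 0"
  have "\<forall>\<^sub>F n in A. \<forall>x\<in>topspace X. dist (F n x) (f x) < e / 2"
    using lim e half_gt_zero unfolding uniform_limit_iff by blast
  with F show "\<forall>\<^sub>F n in A. dist (L (F n)) (L f) < e"
  proof eventually_elim
    case (elim n)
    have "\<bar>L (F n) - L f\<bar> \<le> e / 2"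
      using elim f by (intro state_diff_bound[OF L]) (auto simp: dist_real_def less_imp_le)
    then show ?case using e by (simp add: dist_real_def)
  qed
qed

lemma state_eval: "x \<in> topspace X \<Longrightarrow> state X (\<lambda>f. f x)"
  by (simp add: state_def)

section \<open>Orbits of states under a Markov semigroup\<close>

locale markov =
  fixes X :: "'x topology" and S
  assumes compact: "compact_space X" and markov: "markov_semigroup X S"
begin

lemmas markov_conjs = markov[unfolded markov_semigroup_def]

lemma S_C: "t \<ge> 0 \<Longrightarrow> f \<in> C X \<Longrightarrow> S t f \<in> C X"
  using markov_conjs[THEN conjunct1] by blast

lemma S_lincomb:
  "t \<ge> 0 \<Longrightarrow> f \<in> C X \<Longrightarrow> g \<in> C X \<Longrightarrow> x \<in> topspace X \<Longrightarrow>
    S t (\<lambda>y. a * f y + b * g y) x = a * S t f x + b * S t g x"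
  using markov_conjs[THEN conjunct2, THEN conjunct1] by simp

lemma S_0: "f \<in> C X \<Longrightarrow> x \<in> topspace X \<Longrightarrow> S 0 f x = f x"
  using markov_conjs[THEN conjunct2, THEN conjunct2, THEN conjunct1] by blast

lemma S_cont: "t \<ge> 0 \<Longrightarrow> f \<in> C X \<Longrightarrow> uniform_limit (topspace X) (\<lambda>u. S u f) (S t f) (at_right t)"
  using markov_conjs[THEN conjunct2, THEN conjunct2, THEN conjunct2, THEN conjunct1] by simp

lemma S_add:
  "t \<ge> 0 \<Longrightarrow> u \<ge> 0 \<Longrightarrow> f \<in> C X \<Longrightarrow> x \<in> topspace X \<Longrightarrow> S (t + u) f x = S t (S u f) x"
  using markov_conjs[THEN conjunct2, THEN conjunct2, THEN conjunct2, THEN conjunct2, THEN conjunct1]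
  by blast

lemma S_one: "t \<ge> 0 \<Longrightarrow> x \<in> topspace X \<Longrightarrow> S t (\<lambda>_. 1) x = 1"
  and S_nonneg: "t \<ge> 0 \<Longrightarrow> f \<in> C X \<Longrightarrow> (\<And>y. y \<in> topspace X \<Longrightarrow> f y \<ge> 0) \<Longrightarrow> x \<in> topspace X \<Longrightarrow>
    S t f x \<ge> 0"
  using markov_conjs[THEN conjunct2, THEN conjunct2, THEN conjunct2, THEN conjunct2, THEN conjunct2]
  by simp_all

text \<open>The dual evolution of a state. Applied to evaluation at a point, it makes the
  contraction estimates for \<open>S t\<close> instances of \<open>state_bound\<close> and
  \<open>state_diff_bound\<close>.\<close>

lemma state_S:
  assumes L: "state X L" and t: "t \<ge> 0"
  shows "state X (\<lambda>f. L (S t f))"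
  unfolding state_def
proof (intro conjI ballI allI impI)
  fix f g a b assume f: "f \<in> C X" and g: "g \<in> C X"
  have "L (S t (\<lambda>x. a * f x + b * g x)) = L (\<lambda>x. a * S t f x + b * S t g x)"
    by (rule state_cong[OF L S_C[OF t C_lincomb[OF f g]] C_lincomb[OF S_C[OF t f] S_C[OF t g]]])
      (rule S_lincomb[OF t f g])
  then show "L (S t (\<lambda>x. a * f x + b * g x)) = a * L (S t f) + b * L (S t g)"
    using state_lincomb[OF L S_C[OF t f] S_C[OF t g]] by simp
next
  have "L (S t (\<lambda>_. 1)) = L (\<lambda>_. 1)"
    by (rule state_cong[OF L S_C[OF t C_const] C_const]) (rule S_one[OF t])
  then show "L (S t (\<lambda>_. 1)) = 1" using L by (simp add: state_def)
next
  fix f assume "f \<in> C X" "\<forall>x\<in>topspace X. f x \<ge> 0"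
  then have "\<forall>x\<in>topspace X. S t f x \<ge> 0" using S_nonneg[OF t] by blast
  then show "0 \<le> L (S t f)" using L S_C[OF t \<open>f \<in> C X\<close>] unfolding state_def by blast
qed

lemma state_S_add: "state X L \<Longrightarrow> t \<ge> 0 \<Longrightarrow> u \<ge> 0 \<Longrightarrow> f \<in> C X \<Longrightarrow> L (S (t + u) f) = L (S t (S u f))"
  by (rule state_cong[of X L]) (simp_all add: S_C S_add)

text \<open>By the semigroup law, a difference quotient at time 0, transported to time
  \<open>t\<close>, is the forward quotient of the orbit at \<open>t\<close>. This reduces
  differentiability at all times to the generator limit at 0.\<close>

lemma state_S_quotient:
  assumes "state X L" "t \<ge> 0" "u > 0" "f \<in> C X"
  shows "L (S t (\<lambda>x. (S u f x - f x) / u)) = (L (S (t + u) f) - L (S t f)) / u"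
proof -
  have "(\<lambda>x. (S u f x - f x) / u) = (\<lambda>x. 1 / u * S u f x + (- 1 / u) * f x)"
    by (auto simp: diff_divide_distrib)
  then show ?thesis
    using state_lincomb[OF state_S[OF assms(1,2)], of "S u f" f "1 / u" "- 1 / u"] assms
    by (simp add: S_C state_S_add diff_divide_distrib)
qed

lemma quotient_C: "u \<ge> 0 \<Longrightarrow> f \<in> C X \<Longrightarrow> (\<lambda>x. (S u f x - f x) / u) \<in> C X"
  using C_lincomb[of "S u f" X f "1 / u" "- 1 / u"] S_C by (simp add: diff_divide_distrib)

lemma generatorD:
  assumes "(f, g) \<in> generator_graph X S"
  shows "f \<in> C X" "g \<in> C X"
    "uniform_limit (topspace X) (\<lambda>t x. (S t f x - f x) / t) g (at_right 0)"
  using assms unfolding generator_graph_def by blast+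

text \<open>The second estimate, continuity of \<open>S u g\<close> at 0, is there for derivatives
  from the left.\<close>

lemma generator_estimates:
  assumes fg: "(f, g) \<in> generator_graph X S" and e: "e > 0"
  shows "\<exists>d>0. \<forall>u. 0 < u \<and> u < d \<longrightarrow> (\<forall>x\<in>topspace X.
    \<bar>(S u f x - f x) / u - g x\<bar> \<le> e \<and> \<bar>S u g x - g x\<bar> \<le> e)"
proof -
  have "\<forall>\<^sub>F u in at_right 0. \<forall>x\<in>topspace X. dist ((S u f x - f x) / u) (g x) < e"
    using generatorD(3)[OF fg] e unfolding uniform_limit_iff by blast
  moreover have "\<forall>\<^sub>F u in at_right 0. \<forall>x\<in>topspace X. dist (S u g x) (S 0 g x) < e"
    using S_cont[of 0 g] generatorD(2)[OF fg] e unfolding uniform_limit_iff by blast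
  ultimately have "\<forall>\<^sub>F u in at_right 0. \<forall>x\<in>topspace X.
      \<bar>(S u f x - f x) / u - g x\<bar> \<le> e \<and> \<bar>S u g x - g x\<bar> \<le> e"
    by eventually_elim (use S_0 generatorD(2)[OF fg] in \<open>force simp: dist_real_def\<close>)
  then show ?thesis unfolding eventually_at_right_field by meson
qed

text \<open>The semigroup preserves the domain of its generator, because \<open>S t\<close> commutes
  with difference quotients and is a contraction.\<close>

lemma generator_S:
  assumes fg: "(f, g) \<in> generator_graph X S" and t: "t \<ge> 0"
  shows "(S t f, S t g) \<in> generator_graph X S"
  unfolding generator_graph_def
proof (intro CollectI case_prodI conjI)
  show "S t f \<in> C X" "S t g \<in> C X" using generatorD[OF fg] S_C t by auto
  show "uniform_limit (topspace X) (\<lambda>u x. (S u (S t f) x - S t f x) / u) (S t g) (at_right 0)"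
    unfolding uniform_limit_iff
  proof (intro allI impI)
    fix e :: real assume e: "e > 0"
    obtain d where d: "d > 0"
      "\<And>u x. 0 < u \<Longrightarrow> u < d \<Longrightarrow> x \<in> topspace X \<Longrightarrow> \<bar>(S u f x - f x) / u - g x\<bar> \<le> e / 2"
      using generator_estimates[OF fg half_gt_zero[OF e]] by meson
    have "dist ((S u (S t f) x - S t f x) / u) (S t g x) < e"
      if u: "0 < u" "u < d" and x: "x \<in> topspace X" for u x
    proof -
      have "S u (S t f) x = S (t + u) f x"
        using S_add[of u t f x] u t x generatorD(1)[OF fg] by (simp add: add.commute)
      then have "(S u (S t f) x - S t f x) / u = S t (\<lambda>x. (S u f x - f x) / u) x"
        using state_S_quotient[OF state_eval[OF x] t u(1) generatorD(1)[OF fg]] by simp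
      moreover have "\<bar>S t (\<lambda>x. (S u f x - f x) / u) x - S t g x\<bar> \<le> e / 2"
        by (rule state_diff_bound[OF state_S[OF state_eval[OF x] t]
            quotient_C[OF less_imp_le[OF u(1)] generatorD(1)[OF fg]] generatorD(2)[OF fg] d(2)[OF u]])
      ultimately show ?thesis using e by (simp add: dist_real_def)
    qed
    then show "\<forall>\<^sub>F u in at_right 0. \<forall>x\<in>topspace X. dist ((S u (S t f) x - S t f x) / u) (S t g x) < e"
      using d(1) unfolding eventually_at_right_field by blast
  qed
qed

lemma has_derivative_orbit:
  assumes fg: "(f, g) \<in> generator_graph X S" and L: "state X L" and t: "t \<ge> 0"
  shows "((\<lambda>t. L (S t f)) has_real_derivative L (S t g)) (at t within {0..})"
  unfolding has_field_derivative_iff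
proof (rule tendstoI)
  note f = generatorD(1)[OF fg] and g = generatorD(2)[OF fg]
  fix e :: real assume e: "e > 0"
  then have e3: "e / 3 > 0" by simp
  obtain d where d: "d > 0"
    "\<And>u x. 0 < u \<Longrightarrow> u < d \<Longrightarrow> x \<in> topspace X \<Longrightarrow> \<bar>(S u f x - f x) / u - g x\<bar> \<le> e / 3"
    "\<And>u x. 0 < u \<Longrightarrow> u < d \<Longrightarrow> x \<in> topspace X \<Longrightarrow> \<bar>S u g x - g x\<bar> \<le> e / 3"
    using generator_estimates[OF fg e3] by meson
  have "dist ((L (S y f) - L (S t f)) / (y - t)) (L (S t g)) < e"
    if y: "y \<ge> 0" "y \<noteq> t" "dist y t < d" for y
  proof (cases "y > t")
    case True
    define u where "u = y - t"
    have u: "0 < u" "u < d" "y = t + u" using True y by (auto simp: u_def dist_real_def)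
    have "\<bar>L (S t (\<lambda>x. (S u f x - f x) / u)) - L (S t g)\<bar> \<le> e / 3"
      using d(2)[OF u(1,2)] f g quotient_C u by (intro state_diff_bound[OF state_S[OF L t]]) auto
    then show ?thesis using e u state_S_quotient[OF L t u(1) f] by (simp add: dist_real_def)
  next
    case False
    \<comment> \<open>For the left quotient the base point is \<open>y\<close>, and
      \<open>L (S t g)\<close> equals \<open>L (S y (S u g))\<close>; the quotient must therefore be
      compared with \<open>S u g\<close> instead of \<open>g\<close>.\<close>
    define u where "u = t - y"
    have u: "0 < u" "u < d" "t = y + u" using False y by (auto simp: u_def dist_real_def)
    have "\<bar>(S u f x - f x) / u - S u g x\<bar> \<le> 2 * e / 3" if "x \<in> topspace X" for x
      using d(2)[OF u(1,2) that] d(3)[OF u(1,2) that] by linarith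
    then have "\<bar>L (S y (\<lambda>x. (S u f x - f x) / u)) - L (S y (S u g))\<bar> \<le> 2 * e / 3"
      using f g quotient_C S_C u by (intro state_diff_bound[OF state_S[OF L y(1)]]) auto
    moreover have "(L (S y f) - L (S t f)) / (y - t) = (L (S t f) - L (S y f)) / u"
      using u by (simp add: field_simps)
    ultimately show ?thesis
      using e u y(1) state_S_quotient[OF L y(1) u(1) f] state_S_add[OF L y(1) _ g, of u]
      by (simp add: dist_real_def)
  qed
  then show "\<forall>\<^sub>F y in at t within {0..}. dist ((L (S y f) - L (S t f)) / (y - t)) (L (S t g)) < e"
    using d(1) unfolding eventually_at by (intro exI[of _ d]) auto
qed

text \<open>Invariance gives every difference quotient of \<open>f\<close> the value zero under
  \<open>L\<close>, and these quotients converge uniformly to \<open>g\<close>.\<close>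

lemma invariant_state_generator:
  assumes L: "state X L" and inv: "\<And>t. t \<ge> 0 \<Longrightarrow> L (S t f) = L f"
    and fg: "(f, g) \<in> generator_graph X S"
  shows "L g = 0"
proof -
  note f = generatorD(1)[OF fg]
  have "((\<lambda>u. L (\<lambda>x. (S u f x - f x) / u)) \<longlongrightarrow> L g) (at_right 0)"
  proof (rule state_tendsto[OF L, where F = "\<lambda>u x. (S u f x - f x) / u" and f = g])
    have "(\<lambda>x. (S u f x - f x) / u) \<in> C X" if "0 < u" for u
      using quotient_C[OF less_imp_le[OF that] f] .
    then show "\<forall>\<^sub>F u in at_right 0. (\<lambda>x. (S u f x - f x) / u) \<in> C X"
      by (rule eventually_mono[OF eventually_at_right_less])
  next
    show "g \<in> C X" by (rule generatorD(2)[OF fg])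
    show "uniform_limit (topspace X) (\<lambda>u x. (S u f x - f x) / u) g (at_right 0)"
      by (rule generatorD(3)[OF fg])
  qed
  moreover have "L (\<lambda>x. (S u f x - f x) / u) = 0" if u: "u > 0" for u
  proof -
    have "L (\<lambda>x. (S u f x - f x) / u) = L (S 0 (\<lambda>x. (S u f x - f x) / u))"
      using S_0[OF quotient_C[OF less_imp_le[OF u] f]]
      by (intro state_cong[OF L] quotient_C S_C) (use f u in auto)
    also have "\<dots> = (L (S (0 + u) f) - L (S 0 f)) / u"
      by (rule state_S_quotient[OF L _ u f]) simp
    finally show ?thesis using inv[of u] inv[of 0] u by simp
  qed
  then have "\<forall>\<^sub>F u in at_right 0. L (\<lambda>x. (S u f x - f x) / u) = 0"
    by (rule eventually_mono[OF eventually_at_right_less])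
  then have "((\<lambda>u. L (\<lambda>x. (S u f x - f x) / u)) \<longlongrightarrow> 0) (at_right 0)"
    by (simp add: tendsto_eventually)
  ultimately show ?thesis using tendsto_unique trivial_limit_at_right_real by blast
qed

end

text \<open>Density of the domain extends statements from generator pairs to all continuous
  functions. For the Glauber dynamics it is supplied by the local functions.\<close>

locale markov_dense_domain = markov +
  assumes domain_dense: "\<And>f e. f \<in> C X \<Longrightarrow> e > 0 \<Longrightarrow>
    \<exists>f' g'. (f', g') \<in> generator_graph X S \<and> (\<forall>x\<in>topspace X. \<bar>f x - f' x\<bar> \<le> e)"
begin

text \<open>By \<open>generator_S\<close> the orbit of \<open>f\<close> stays in the domain, so
  \<open>L (S t f)\<close> has derivative \<open>L (S t g) = 0\<close> and is constant; the
  remaining \<open>f\<close> are reached by density.\<close>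

lemma generator_null_imp_invariant:
  assumes L: "state X L" and null: "\<And>f g. (f, g) \<in> generator_graph X S \<Longrightarrow> L g = 0"
    and f: "f \<in> C X" and t: "t \<ge> 0"
  shows "L (S t f) = L f"
proof -
  have dom: "L (S t f) = L f" if fg: "(f, g) \<in> generator_graph X S" for f g
  proof -
    have "((\<lambda>t. L (S t f)) has_real_derivative 0) (at t within {0..})" if "t \<in> {0..}" for t
      using has_derivative_orbit[OF fg L, of t] null[OF generator_S[OF fg, of t]] that by simp
    then obtain c where c: "\<forall>t\<in>{0..}. L (S t f) = c"
      using has_field_derivative_zero_constant[OF convex_real_interval(1)[of 0], of "\<lambda>t. L (S t f)"]
      by blast
    moreover have "L (S 0 f) = L f"
      using generatorD(1)[OF fg] S_0 S_C by (intro state_cong[OF L]) auto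
    ultimately show ?thesis using t by fastforce
  qed
  have "\<bar>L (S t f) - L f\<bar> \<le> 0 + e" if e: "e > 0" for e
  proof -
    obtain f' g' where fg: "(f', g') \<in> generator_graph X S"
      and close: "\<And>x. x \<in> topspace X \<Longrightarrow> \<bar>f x - f' x\<bar> \<le> e / 2"
      using domain_dense[OF f half_gt_zero[OF e]] by blast
    note f' = generatorD(1)[OF fg]
    have "\<bar>L (S t f) - L (S t f')\<bar> \<le> e / 2" using state_diff_bound[OF state_S[OF L t] f f' close] .
    moreover have "\<bar>L f - L f'\<bar> \<le> e / 2" using state_diff_bound[OF L f f' close] .
    ultimately show ?thesis using dom[OF fg] by linarith
  qed
  then have "\<bar>L (S t f) - L f\<bar> \<le> 0" by (rule field_le_epsilon)
  then show ?thesis by simp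
qed

text \<open>The difference \<open>\<phi>\<close> of the two states along an orbit satisfies \<open>\<phi> - \<kappa> \<phi>' \<rightarrow> 0\<close>, and \<open>\<phi>\<close> is
  bounded, so \<open>\<phi> 0\<close> is recovered from \<open>\<phi> - \<kappa> \<phi>'\<close> by integrating against \<open>exp (- t / \<kappa>) / \<kappa>\<close>.\<close>

lemma state_tendsto_if_resolvent_tendsto:
  fixes \<kappa> :: real
  assumes \<kappa>: "\<kappa> > 0" and L: "\<And>n. state X (L n)" and I: "state X I"
    and lim: "\<And>f g. (f, g) \<in> generator_graph X S \<Longrightarrow>
      (\<lambda>n. L n (\<lambda>x. f x - \<kappa> * g x)) \<longlonglongrightarrow> I (\<lambda>x. f x - \<kappa> * g x)"
    and f: "f \<in> C X"
  shows "(\<lambda>n. L n f) \<longlonglongrightarrow> I f"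
proof -
  have dom: "(\<lambda>n. L n f) \<longlonglongrightarrow> I f" if fg: "(f, g) \<in> generator_graph X S" for f g
  proof -
    note f = generatorD(1)[OF fg] and g = generatorD(2)[OF fg]
    define u where "u = (\<lambda>x. f x - \<kappa> * g x)"
    have u: "u \<in> C X" unfolding u_def using C_diff C_cmult f g by blast
    obtain B where B: "B \<ge> 0" "\<And>x. x \<in> topspace X \<Longrightarrow> \<bar>f x\<bar> \<le> B" using C_bounded[OF compact f] by blast
    obtain B' where B': "B' \<ge> 0" "\<And>x. x \<in> topspace X \<Longrightarrow> \<bar>u x\<bar> \<le> B'" using C_bounded[OF compact u] by blast
    define \<phi> where "\<phi> n t = L n (S t f) - I (S t f)" for n t
    define \<psi> where "\<psi> n t = L n (S t u) - I (S t u)" for n t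
    define \<phi>' where "\<phi>' n t = L n (S t g) - I (S t g)" for n t
    have \<psi>_eq: "\<psi> n t = \<phi> n t - \<kappa> * \<phi>' n t" if t: "t \<ge> 0" for n t
    proof -
      have "M (S t u) = M (S t f) - \<kappa> * M (S t g)" if M: "state X M" for M
        unfolding u_def using state_diff[OF state_S[OF M t] f C_cmult[OF g, of \<kappa>]]
          state_cmult[OF state_S[OF M t] g] by simp
      then show ?thesis using L I by (simp add: \<psi>_def \<phi>_def \<phi>'_def algebra_simps)
    qed
    have \<phi>_le: "\<bar>\<phi> n t\<bar> \<le> 2 * B" if "t \<ge> 0" for n t
      using state_bound[OF state_S[OF L that] f B(2), of n] state_bound[OF state_S[OF I that] f B(2)]
      unfolding \<phi>_def by linarith
    have \<psi>_le: "\<bar>\<psi> n t\<bar> \<le> 2 * B'" if "t \<ge> 0" for n t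
      using state_bound[OF state_S[OF L that] u B'(2), of n] state_bound[OF state_S[OF I that] u B'(2)]
      unfolding \<psi>_def by linarith
    \<comment> \<open>Convergence at time \<open>t\<close> is the assumption \<open>lim\<close> for
      the pair \<open>(S t f, S t g)\<close>, which lies in the graph again.\<close>
    have \<psi>_lim: "(\<lambda>n. \<psi> n t) \<longlonglongrightarrow> 0" if t: "t \<ge> 0" for t
    proof -
      have *: "M (\<lambda>x. S t f x - \<kappa> * S t g x) = M (S t u)" if M: "state X M" for M
        using state_diff[OF M S_C[OF t f] C_cmult[OF S_C[OF t g], of \<kappa>]]
          state_cmult[OF M S_C[OF t g]] state_diff[OF state_S[OF M t] f C_cmult[OF g, of \<kappa>]]
          state_cmult[OF state_S[OF M t] g] by (simp add: u_def)
      have "(\<lambda>n. L n (S t u)) \<longlonglongrightarrow> I (S t u)"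
        using lim[OF generator_S[OF fg t]] *[OF L] *[OF I] by simp
      then show ?thesis unfolding \<psi>_def by (simp add: LIM_zero)
    qed
    have deriv: "((\<lambda>t. exp (- t / \<kappa>) * \<phi> n t) has_real_derivative - (exp (- t / \<kappa>) * \<psi> n t / \<kappa>))
        (at t within {0..T})" if t: "t \<in> {0..T}" for n t T
    proof -
      have "((\<lambda>t. exp (- t / \<kappa>) * \<phi> n t) has_real_derivative
          exp (- t / \<kappa>) * (- 1 / \<kappa>) * \<phi> n t + \<phi>' n t * exp (- t / \<kappa>)) (at t within {0..})"
        unfolding \<phi>_def \<phi>'_def using t \<kappa>
        by (auto intro!: derivative_eq_intros has_derivative_orbit[OF fg L] has_derivative_orbit[OF fg I])
      moreover have "exp (- t / \<kappa>) * (- 1 / \<kappa>) * \<phi> n t + \<phi>' n t * exp (- t / \<kappa>)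
          = - (exp (- t / \<kappa>) * \<psi> n t / \<kappa>)"
      proof -
        have "\<phi> n t = \<psi> n t + \<kappa> * \<phi>' n t" using \<psi>_eq[of t n] t by simp
        then show ?thesis using \<kappa> by (simp add: field_simps)
      qed
      ultimately show ?thesis using has_field_derivative_subset[of _ _ t "{0..}" "{0..T}"] by simp
    qed
    have ftc: "((\<lambda>t. exp (- t / \<kappa>) * \<psi> n t / \<kappa>) has_integral (\<phi> n 0 - exp (- T / \<kappa>) * \<phi> n T)) {0..T}"
      if "T \<ge> 0" for n T
      using has_integral_neg[OF fundamental_theorem_of_calculus[OF that
          deriv[of _ T n, unfolded has_real_derivative_iff_has_vector_derivative]]]
      by simp
    have int_lim: "(\<lambda>n. integral {0..T} (\<lambda>t. exp (- t / \<kappa>) * \<psi> n t / \<kappa>)) \<longlonglongrightarrow> 0" if T: "T \<ge> 0" for T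
    proof -
      have "(\<lambda>n. integral {0..T} (\<lambda>t. exp (- t / \<kappa>) * \<psi> n t / \<kappa>)) \<longlonglongrightarrow> integral {0..T} (\<lambda>_. 0)"
      proof (rule dominated_convergence(2))
        show "(\<lambda>t. exp (- t / \<kappa>) * \<psi> n t / \<kappa>) integrable_on {0..T}" for n
          using ftc[OF T] by blast
        show "(\<lambda>_. 2 * B' / \<kappa>) integrable_on {0..T}" by (rule integrable_const_ivl)
        show "norm (exp (- t / \<kappa>) * \<psi> n t / \<kappa>) \<le> 2 * B' / \<kappa>" if "t \<in> {0..T}" for n t
        proof -
          have "exp (- t / \<kappa>) * \<bar>\<psi> n t\<bar> \<le> 1 * (2 * B')"
            using that \<kappa> \<psi>_le by (intro mult_mono) auto
          then show ?thesis using \<kappa> by (simp add: abs_mult divide_right_mono)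
        qed
        show "(\<lambda>n. exp (- t / \<kappa>) * \<psi> n t / \<kappa>) \<longlonglongrightarrow> 0" if "t \<in> {0..T}" for t
          using tendsto_mult_right_zero[OF \<psi>_lim, of t "exp (- t / \<kappa>) / \<kappa>"] that by simp
      qed
      then show ?thesis by simp
    qed
    have "(\<lambda>n. \<phi> n 0) \<longlonglongrightarrow> 0"
    proof (rule tendstoI)
      fix e :: real assume e: "e > 0"
      \<comment> \<open>Then \<open>exp (- T / \<kappa>) = e / (4 * B + e)\<close>, which pushes the
        boundary term at \<open>T\<close> below \<open>e / 2\<close>.\<close>
      define T where "T = \<kappa> * ln (4 * B / e + 1)"
      have Be: "4 * B / e + 1 > 0" using B(1) e by (simp add: add_nonneg_pos)
      have T: "T \<ge> 0" "exp (- T / \<kappa>) * (2 * B) < e / 2"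
        using \<kappa> e B(1) Be by (auto simp: T_def exp_minus field_simps)
      have "\<forall>\<^sub>F n in sequentially. \<bar>integral {0..T} (\<lambda>t. exp (- t / \<kappa>) * \<psi> n t / \<kappa>)\<bar> < e / 2"
        using tendstoD[OF int_lim[OF T(1)], of "e / 2"] e by simp
      then show "\<forall>\<^sub>F n in sequentially. dist (\<phi> n 0) 0 < e"
      proof eventually_elim
        case (elim n)
        have "\<bar>exp (- T / \<kappa>) * \<phi> n T\<bar> \<le> exp (- T / \<kappa>) * (2 * B)"
          using \<phi>_le[OF T(1)] by (simp add: abs_mult)
        then show ?case
          using elim integral_unique[OF ftc[OF T(1)], of n] T(2)
          unfolding dist_real_def diff_0_right by linarith
      qed
    qed
    moreover have "\<phi> n 0 = L n f - I f" for n
      unfolding \<phi>_def using state_cong[OF L S_C[OF order_refl f] f S_0[OF f], of n]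
        state_cong[OF I S_C[OF order_refl f] f S_0[OF f]] by simp
    ultimately show ?thesis by (simp add: LIM_zero_iff)
  qed
  show ?thesis
  proof (rule tendstoI)
    fix e :: real assume e: "e > 0"
    obtain f' g' where fg: "(f', g') \<in> generator_graph X S"
      and close: "\<And>x. x \<in> topspace X \<Longrightarrow> \<bar>f x - f' x\<bar> \<le> e / 3"
      using domain_dense[OF f, of "e / 3"] e by (metis divide_pos_pos zero_less_numeral)
    note f' = generatorD(1)[OF fg]
    have "\<forall>\<^sub>F n in sequentially. dist (L n f') (I f') < e / 3" by (rule tendstoD[OF dom[OF fg]]) (use e in simp)
    then show "\<forall>\<^sub>F n in sequentially. dist (L n f) (I f) < e"
    proof eventually_elim
      case (elim n)
      then show ?case
        using state_diff_bound[OF L f f' close, of n] state_diff_bound[OF I f f' close]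
        unfolding dist_real_def by linarith
    qed
  qed
qed

end

section \<open>Local functions on the configuration space\<close>

lemma topspace_config_top: "topspace (config_top G A) = carrier G \<rightarrow>\<^sub>E A"
  by (simp add: config_top_def)

text \<open>\<open>x\<close> is read only on \<open>W\<close> and need not be a configuration:
  \<open>countable_cyl\<close> inserts a pattern defined on \<open>W\<close> alone.\<close>

definition cyl :: "('g, 'm) monoid_scheme \<Rightarrow> 'a set \<Rightarrow> 'g set \<Rightarrow> ('g \<Rightarrow> 'a) \<Rightarrow> ('g \<Rightarrow> 'a) set" where
  "cyl G A W x = {y \<in> topspace (config_top G A). \<forall>\<delta>\<in>W. y \<delta> = x \<delta>}"

definition local_on :: "('g, 'm) monoid_scheme \<Rightarrow> 'a set \<Rightarrow> 'g set \<Rightarrow> (('g \<Rightarrow> 'a) \<Rightarrow> real) \<Rightarrow> bool" where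
  "local_on G A W f \<longleftrightarrow> (\<forall>x\<in>topspace (config_top G A). \<forall>y\<in>topspace (config_top G A).
     (\<forall>\<delta>\<in>W. x \<delta> = y \<delta>) \<longrightarrow> f x = f y)"

lemma local_onD:
  "local_on G A W f \<Longrightarrow> x \<in> topspace (config_top G A) \<Longrightarrow> y \<in> topspace (config_top G A) \<Longrightarrow>
    (\<And>\<delta>. \<delta> \<in> W \<Longrightarrow> x \<delta> = y \<delta>) \<Longrightarrow> f x = f y"
  unfolding local_on_def by blast

lemma local_onI:
  "(\<And>x y. x \<in> topspace (config_top G A) \<Longrightarrow> y \<in> topspace (config_top G A) \<Longrightarrow>
    (\<And>\<delta>. \<delta> \<in> W \<Longrightarrow> x \<delta> = y \<delta>) \<Longrightarrow> f x = f y) \<Longrightarrow> local_on G A W f"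
  unfolding local_on_def by blast

lemma local_on_mono: "local_on G A W f \<Longrightarrow> W \<subseteq> W' \<Longrightarrow> local_on G A W' f"
  unfolding local_on_def by (meson subsetD)

lemma openin_cyl:
  assumes "finite W" "W \<subseteq> carrier G" "x \<in> topspace (config_top G A)"
  shows "openin (config_top G A) (cyl G A W x)"
proof -
  have eq: "cyl G A W x = (\<Pi>\<^sub>E \<delta>\<in>carrier G. if \<delta> \<in> W then {x \<delta>} else A)"
  proof (intro equalityI subsetI)
    fix y assume y: "y \<in> cyl G A W x"
    show "y \<in> (\<Pi>\<^sub>E \<delta>\<in>carrier G. if \<delta> \<in> W then {x \<delta>} else A)"
      using y by (intro PiE_I) (auto simp: cyl_def topspace_config_top)
  next
    fix y assume y: "y \<in> (\<Pi>\<^sub>E \<delta>\<in>carrier G. if \<delta> \<in> W then {x \<delta>} else A)"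
    have yd: "y \<delta> \<in> (if \<delta> \<in> W then {x \<delta>} else A)" if "\<delta> \<in> carrier G" for \<delta>
      using y that by (rule PiE_mem)
    have "y \<delta> \<in> A" if "\<delta> \<in> carrier G" for \<delta>
      using yd[OF that] assms(3) that by (cases "\<delta> \<in> W") (auto simp: topspace_config_top)
    moreover have "y \<delta> = x \<delta>" if "\<delta> \<in> W" for \<delta> using yd[of \<delta>] that assms(2) by auto
    moreover have "y \<delta> = undefined" if "\<delta> \<notin> carrier G" for \<delta> using y that by (rule PiE_arb)
    ultimately show "y \<in> cyl G A W x" unfolding cyl_def topspace_config_top by (auto intro!: PiE_I)
  qed
  have fin: "finite {\<delta> \<in> carrier G. (if \<delta> \<in> W then {x \<delta>} else A) \<noteq> topspace (discrete_topology A)}"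
    by (rule finite_subset[OF _ assms(1)]) auto
  show ?thesis
  proof -
    have "openin (discrete_topology A) (if \<delta> \<in> W then {x \<delta>} else A)" if "\<delta> \<in> carrier G" for \<delta>
      using assms(3) that by (auto simp: topspace_config_top)
    then show ?thesis using fin unfolding eq config_top_def openin_PiE_gen by blast
  qed
qed

lemma openin_config_top_contains_cyl:
  assumes "openin (config_top G A) U" "x \<in> U"
  obtains W where "finite W" "W \<subseteq> carrier G" "cyl G A W x \<subseteq> U"
proof -
  obtain V where V: "x \<in> (\<Pi>\<^sub>E i\<in>carrier G. V i)" "\<And>i. openin (discrete_topology A) (V i)"
    "finite {i. V i \<noteq> topspace (discrete_topology A)}" "(\<Pi>\<^sub>E i\<in>carrier G. V i) \<subseteq> U"
    using product_topology_open_contains_basis[OF assms[unfolded config_top_def]] by auto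
  let ?W = "{i \<in> carrier G. V i \<noteq> A}"
  have "cyl G A ?W x \<subseteq> (\<Pi>\<^sub>E i\<in>carrier G. V i)"
  proof
    fix y assume y: "y \<in> cyl G A ?W x"
    have "y \<delta> \<in> V \<delta>" if "\<delta> \<in> carrier G" for \<delta>
    proof (cases "V \<delta> = A")
      case True
      then show ?thesis using y that by (auto simp: cyl_def topspace_config_top)
    next
      case False
      then have "y \<delta> = x \<delta>" using y that by (auto simp: cyl_def)
      then show ?thesis using PiE_mem[OF V(1) that] by simp
    qed
    then show "y \<in> (\<Pi>\<^sub>E i\<in>carrier G. V i)"
      using y by (intro PiE_I) (auto simp: cyl_def topspace_config_top)
  qed
  moreover have "finite ?W" using V(3) by (rule rev_finite_subset) auto
  ultimately show thesis using that[of ?W] V(4) by auto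
qed

lemma local_on_imp_C:
  assumes "finite W" "W \<subseteq> carrier G" "local_on G A W f"
  shows "f \<in> C (config_top G A)"
  unfolding C_def continuous_map_def
proof (intro CollectI conjI allI impI)
  fix U :: "real set"
  show "openin (config_top G A) {x \<in> topspace (config_top G A). f x \<in> U}"
  proof (subst openin_subopen, intro ballI)
    fix x assume "x \<in> {x \<in> topspace (config_top G A). f x \<in> U}"
    then have x: "x \<in> topspace (config_top G A)" "f x \<in> U" by auto
    have "f y = f x" if "y \<in> cyl G A W x" for y
      using that x(1) by (intro local_onD[OF assms(3)]) (auto simp: cyl_def)
    then have "cyl G A W x \<subseteq> {x \<in> topspace (config_top G A). f x \<in> U}"
      using x(2) by (auto simp: cyl_def)
    moreover have "x \<in> cyl G A W x" using x(1) by (simp add: cyl_def)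
    ultimately show "\<exists>T. openin (config_top G A) T \<and> x \<in> T \<and> T \<subseteq> {x \<in> topspace (config_top G A). f x \<in> U}"
      using openin_cyl[OF assms(1,2) x(1)] by blast
  qed
qed auto

lemma compact_config_top: "finite A \<Longrightarrow> compact_space (config_top G A)"
  by (simp add: config_top_def compact_space_product_topology compact_space_discrete_topology)

text \<open>Uniform continuity from compactness: finitely many cylinders on which \<open>f\<close>
  varies little cover the space, and the union of their windows serves as \<open>W\<close>.\<close>

lemma C_nearly_local:
  assumes "finite A" "f \<in> C (config_top G A)" "e > 0"
  obtains W where "finite W" "W \<subseteq> carrier G"
    "\<forall>x\<in>topspace (config_top G A). \<forall>y\<in>topspace (config_top G A).
      (\<forall>\<delta>\<in>W. x \<delta> = y \<delta>) \<longrightarrow> \<bar>f x - f y\<bar> < e"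
proof -
  let ?T = "config_top G A"
  have "\<exists>W. finite W \<and> W \<subseteq> carrier G \<and> (\<forall>y\<in>cyl G A W x. \<bar>f y - f x\<bar> < e / 2)" if x: "x \<in> topspace ?T" for x
  proof -
    have "openin ?T {y \<in> topspace ?T. f y \<in> ball (f x) (e / 2)}"
      using assms(2) unfolding C_def by (intro openin_continuous_map_preimage) auto
    moreover have "x \<in> {y \<in> topspace ?T. f y \<in> ball (f x) (e / 2)}" using x assms(3) by simp
    ultimately obtain W where W: "finite W" "W \<subseteq> carrier G"
        "cyl G A W x \<subseteq> {y \<in> topspace ?T. f y \<in> ball (f x) (e / 2)}"
      by (rule openin_config_top_contains_cyl)
    have "\<bar>f y - f x\<bar> < e / 2" if "y \<in> cyl G A W x" for y
      using W(3) that by (auto simp: dist_real_def abs_minus_commute)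
    then show ?thesis using W by blast
  qed
  then obtain N where N: "\<And>x. x \<in> topspace ?T \<Longrightarrow> finite (N x)" "\<And>x. x \<in> topspace ?T \<Longrightarrow> N x \<subseteq> carrier G"
    "\<And>x y. x \<in> topspace ?T \<Longrightarrow> y \<in> cyl G A (N x) x \<Longrightarrow> \<bar>f y - f x\<bar> < e / 2"
    by metis
  have cover: "\<exists>\<F>. finite \<F> \<and> \<F> \<subseteq> (\<lambda>x. cyl G A (N x) x) ` topspace ?T \<and> topspace ?T \<subseteq> \<Union>\<F>"
  proof (rule compactinD)
    show "compactin ?T (topspace ?T)" using compact_config_top[OF assms(1)] by (simp add: compact_space_def)
    show "topspace ?T \<subseteq> \<Union>((\<lambda>x. cyl G A (N x) x) ` topspace ?T)" by (auto simp: cyl_def)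
    show "openin ?T U" if "U \<in> (\<lambda>x. cyl G A (N x) x) ` topspace ?T" for U
      using that N(1,2) by (auto intro: openin_cyl)
  qed
  obtain F where F: "finite F" "F \<subseteq> topspace ?T" "topspace ?T \<subseteq> (\<Union>x\<in>F. cyl G A (N x) x)"
  proof -
    obtain \<F> where \<F>: "finite \<F>" "\<F> \<subseteq> (\<lambda>x. cyl G A (N x) x) ` topspace ?T" "topspace ?T \<subseteq> \<Union>\<F>"
      using cover by blast
    obtain F where "F \<subseteq> topspace ?T" "finite F" "\<F> = (\<lambda>x. cyl G A (N x) x) ` F"
      using finite_subset_image[OF \<F>(1,2)] by blast
    with \<F>(3) show thesis by (intro that) auto
  qed
  define W where "W = (\<Union>x\<in>F. N x)"
  have "\<bar>f x - f y\<bar> < e" if x: "x \<in> topspace ?T" and y: "y \<in> topspace ?T" and xy: "\<And>\<delta>. \<delta> \<in> W \<Longrightarrow> x \<delta> = y \<delta>" for x y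
  proof -
    obtain z where z: "z \<in> F" "x \<in> cyl G A (N z) z" using F(3) x by blast
    have "y \<delta> = z \<delta>" if "\<delta> \<in> N z" for \<delta>
    proof -
      have "x \<delta> = y \<delta>" using xy[of \<delta>] that z(1) by (auto simp: W_def)
      moreover have "x \<delta> = z \<delta>" using z(2) that by (auto simp: cyl_def)
      ultimately show ?thesis by simp
    qed
    then have "y \<in> cyl G A (N z) z" using y by (simp add: cyl_def)
    then have "\<bar>f y - f z\<bar> < e / 2" "\<bar>f x - f z\<bar> < e / 2" using N(3) z F(2) by blast+
    then show ?thesis by linarith
  qed
  then have "\<forall>x\<in>topspace ?T. \<forall>y\<in>topspace ?T. (\<forall>\<delta>\<in>W. x \<delta> = y \<delta>) \<longrightarrow> \<bar>f x - f y\<bar> < e" by simp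
  moreover have "finite W" "W \<subseteq> carrier G" using F(1,2) N(1,2) unfolding W_def by blast+
  ultimately show thesis using that by simp
qed

section \<open>Resampling one site, and the generator on local functions\<close>

definition resample :: "('g, 'm) monoid_scheme \<Rightarrow> 'a set \<Rightarrow> (nat \<Rightarrow> 'g) \<Rightarrow> nat \<Rightarrow> ('a \<Rightarrow> 'a \<Rightarrow> real)
    \<Rightarrow> ('a \<Rightarrow> real) \<Rightarrow> 'g \<Rightarrow> (('g \<Rightarrow> 'a) \<Rightarrow> real) \<Rightarrow> ('g \<Rightarrow> 'a) \<Rightarrow> real" where
  "resample G A s r J h \<gamma> f x = (\<Sum>a\<in>A. rate G A s r J h \<gamma> x a * f (x(\<gamma> := a)))"

locale spin_system = group G for G :: "('g, 'm) monoid_scheme" (structure) +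
  fixes A :: "'a set" and s :: "nat \<Rightarrow> 'g" and r :: nat
    and J :: "'a \<Rightarrow> 'a \<Rightarrow> real" and h :: "'a \<Rightarrow> real"
  assumes s_closed: "\<And>i. i \<in> {1..r} \<Longrightarrow> s i \<in> carrier G"
    and finite_A: "finite A" and A_nonempty: "A \<noteq> {}"
begin

abbreviation "T \<equiv> config_top G A"
abbreviation "X \<equiv> topspace T"
abbreviation "\<rho> \<equiv> rate G A s r J h"
abbreviation "R \<equiv> resample G A s r J h"
abbreviation "\<L> \<equiv> \<Omega> G A s r J h"

text \<open>The sites that the interaction at \<open>\<gamma>\<close> reads. The rates at
  \<open>\<gamma>\<close> ignore the spin at \<open>\<gamma>\<close> itself, since it is overwritten
  (\<open>rate_cong\<close>).\<close>

definition nbhd :: "'g \<Rightarrow> 'g set" where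
  "nbhd \<gamma> = insert \<gamma> ((\<lambda>i. s i \<otimes> \<gamma>) ` {1..r} \<union> (\<lambda>i. inv (s i) \<otimes> \<gamma>) ` {1..r})"

lemma finite_nbhd: "finite (nbhd \<gamma>)"
  by (simp add: nbhd_def)

lemma nbhd_closed: "\<gamma> \<in> carrier G \<Longrightarrow> nbhd \<gamma> \<subseteq> carrier G"
  using s_closed by (auto simp: nbhd_def)

lemma fun_upd_in_X: "x \<in> X \<Longrightarrow> \<gamma> \<in> carrier G \<Longrightarrow> a \<in> A \<Longrightarrow> x(\<gamma> := a) \<in> X"
  by (auto simp: topspace_config_top PiE_iff extensional_def)

lemma \<Phi>_cong:
  assumes "\<And>\<delta>. \<delta> \<in> nbhd \<gamma> \<Longrightarrow> x \<delta> = y \<delta>"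
  shows "\<Phi> G s r J h \<gamma> x = \<Phi> G s r J h \<gamma> y"
proof -
  have "x \<gamma> = y \<gamma>" using assms by (simp add: nbhd_def)
  moreover have "x (s i \<otimes> \<gamma>) = y (s i \<otimes> \<gamma>)" "x (inv (s i) \<otimes> \<gamma>) = y (inv (s i) \<otimes> \<gamma>)" if "i \<in> {1..r}" for i
    using assms that by (auto simp: nbhd_def)
  ultimately show ?thesis unfolding \<Phi>_def by (auto intro!: sum.cong)
qed

lemma rate_cong:
  assumes "\<And>\<delta>. \<delta> \<in> nbhd \<gamma> - {\<gamma>} \<Longrightarrow> x \<delta> = y \<delta>"
  shows "\<rho> \<gamma> x a = \<rho> \<gamma> y a"
proof -
  have "\<Phi> G s r J h \<gamma> (x(\<gamma> := b)) = \<Phi> G s r J h \<gamma> (y(\<gamma> := b))" for b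
    using assms by (intro \<Phi>_cong) auto
  then show ?thesis by (simp add: rate_def)
qed

lemma rate_denom_pos: "(\<Sum>b\<in>A. exp (- \<Phi> G s r J h \<gamma> (x(\<gamma> := b)))) > 0"
  using finite_A A_nonempty by (intro sum_pos) auto

lemma rate_nonneg: "\<rho> \<gamma> x a \<ge> 0"
  using rate_denom_pos[of \<gamma> x] by (simp add: rate_def)

lemma sum_rate: "(\<Sum>a\<in>A. \<rho> \<gamma> x a) = 1"
  using rate_denom_pos[of \<gamma> x] by (simp add: rate_def flip: sum_divide_distrib)

lemma rate_sum_diff_bound:
  assumes "\<And>a. a \<in> A \<Longrightarrow> \<bar>u a\<bar> \<le> K"
  shows "\<bar>\<Sum>a\<in>A. \<rho> \<gamma> x a * u a\<bar> \<le> K"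
proof -
  have "\<bar>\<Sum>a\<in>A. \<rho> \<gamma> x a * u a\<bar> \<le> (\<Sum>a\<in>A. \<rho> \<gamma> x a * K)"
    using assms rate_nonneg by (intro order_trans[OF sum_abs] sum_mono) (simp add: abs_mult mult_left_mono)
  then show ?thesis using sum_rate by (simp flip: sum_distrib_right)
qed

lemma rate_sum_diff: "(\<Sum>a\<in>A. \<rho> \<gamma> x a * (f (x(\<gamma> := a)) - f x)) = R \<gamma> f x - f x"
  using sum_rate[of \<gamma> x] by (simp add: resample_def right_diff_distrib sum_subtractf flip: sum_distrib_right)

lemma local_on_resample:
  assumes f: "local_on G A W f" and \<gamma>: "\<gamma> \<in> carrier G"
  shows "local_on G A (W \<union> nbhd \<gamma>) (R \<gamma> f)"
proof (rule local_onI)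
  fix x y assume xy: "x \<in> X" "y \<in> X" "\<And>\<delta>. \<delta> \<in> W \<union> nbhd \<gamma> \<Longrightarrow> x \<delta> = y \<delta>"
  have "\<rho> \<gamma> x a = \<rho> \<gamma> y a" for a using xy by (intro rate_cong) auto
  moreover have "f (x(\<gamma> := a)) = f (y(\<gamma> := a))" if "a \<in> A" for a
    using xy \<gamma> that by (intro local_onD[OF f] fun_upd_in_X) auto
  ultimately show "R \<gamma> f x = R \<gamma> f y" unfolding resample_def by simp
qed

text \<open>Changing a spin outside \<open>W\<close> leaves \<open>f\<close> unchanged, so such a
  site contributes zero and the infinite sum collapses to \<open>W\<close>.\<close>

lemma generator_local:
  assumes f: "local_on G A W f" and W: "finite W" "W \<subseteq> carrier G" and x: "x \<in> X"
  shows "\<L> f x = (\<Sum>\<gamma>\<in>W. R \<gamma> f x - f x)"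
proof -
  have "R \<gamma> f x - f x = 0" if "\<gamma> \<in> carrier G - W" for \<gamma>
  proof -
    have "f (x(\<gamma> := a)) = f x" if a: "a \<in> A" for a
      using x that \<open>\<gamma> \<in> carrier G - W\<close> by (intro local_onD[OF f] fun_upd_in_X) auto
    then show ?thesis unfolding rate_sum_diff[symmetric] by simp
  qed
  then have "\<L> f x = infsum (\<lambda>\<gamma>. R \<gamma> f x - f x) W"
    unfolding \<Omega>_def rate_sum_diff using W by (intro infsum_cong_neutral) auto
  then show ?thesis using W by simp
qed

lemma local_on_generator:
  assumes f: "local_on G A W f" and W: "finite W" "W \<subseteq> carrier G"
  shows "local_on G A (W \<union> (\<Union>\<gamma>\<in>W. nbhd \<gamma>)) (\<L> f)"
proof (rule local_onI)
  fix x y assume xy: "x \<in> X" "y \<in> X" "\<And>\<delta>. \<delta> \<in> W \<union> (\<Union>\<gamma>\<in>W. nbhd \<gamma>) \<Longrightarrow> x \<delta> = y \<delta>"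
  have "R \<gamma> f x = R \<gamma> f y" if "\<gamma> \<in> W" for \<gamma>
    using that xy W by (intro local_onD[OF local_on_resample[OF f, of \<gamma>]]) auto
  moreover have "f x = f y" using xy by (intro local_onD[OF f]) auto
  ultimately show "\<L> f x = \<L> f y" using generator_local[OF f W] xy by simp
qed

lemma local_generator_C:
  assumes f: "local_on G A W f" and W: "finite W" "W \<subseteq> carrier G"
  shows "\<L> f \<in> C T"
proof (rule local_on_imp_C[OF _ _ local_on_generator[OF f W]])
  show "finite (W \<union> (\<Union>\<gamma>\<in>W. nbhd \<gamma>))" using W finite_nbhd by blast
  show "W \<union> (\<Union>\<gamma>\<in>W. nbhd \<gamma>) \<subseteq> carrier G" using W nbhd_closed by blast
qed

lemma oscillation_bound:
  assumes f: "f \<in> C T" and "x \<in> X" "y \<in> X" "\<And>\<delta>. \<delta> \<in> carrier G - {\<gamma>} \<Longrightarrow> x \<delta> = y \<delta>"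
  shows "\<bar>f x - f y\<bar> \<le> oscillation G A f \<gamma>"
proof -
  obtain B where B: "\<And>x. x \<in> X \<Longrightarrow> \<bar>f x\<bar> \<le> B"
    using C_bounded[OF compact_config_top[OF finite_A] f] by blast
  have "\<bar>f \<eta> - f \<eta>'\<bar> \<le> 2 * B" if "\<eta> \<in> X" "\<eta>' \<in> X" for \<eta> \<eta>' using B[OF that(1)] B[OF that(2)] by linarith
  then have "bdd_above {\<bar>f \<eta>\<^sub>1 - f \<eta>\<^sub>2\<bar> | \<eta>\<^sub>1 \<eta>\<^sub>2. \<eta>\<^sub>1 \<in> X \<and> \<eta>\<^sub>2 \<in> X \<and> (\<forall>\<delta>\<in>carrier G - {\<gamma>}. \<eta>\<^sub>1 \<delta> = \<eta>\<^sub>2 \<delta>)}"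
    by (intro bdd_aboveI[of _ "2 * B"]) blast
  then show ?thesis unfolding oscillation_def using assms by (intro cSup_upper) blast+
qed

lemma X_nonempty: "X \<noteq> {}"
  using A_nonempty by (simp add: topspace_config_top PiE_eq_empty_iff)

lemma oscillation_local_zero:
  assumes f: "local_on G A W f" and \<gamma>: "\<gamma> \<in> carrier G - W" "W \<subseteq> carrier G"
  shows "oscillation G A f \<gamma> = 0"
proof -
  have eq: "\<bar>f \<eta> - f \<eta>'\<bar> = 0" if "\<eta> \<in> X" "\<eta>' \<in> X" "\<forall>\<delta>\<in>carrier G - {\<gamma>}. \<eta> \<delta> = \<eta>' \<delta>" for \<eta> \<eta>'
  proof -
    have "f \<eta> = f \<eta>'" using that \<gamma> by (intro local_onD[OF f]) auto
    then show ?thesis by simp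
  qed
  have seteq: "{\<bar>f \<eta>\<^sub>1 - f \<eta>\<^sub>2\<bar> | \<eta>\<^sub>1 \<eta>\<^sub>2. \<eta>\<^sub>1 \<in> X \<and> \<eta>\<^sub>2 \<in> X \<and> (\<forall>\<delta>\<in>carrier G - {\<gamma>}. \<eta>\<^sub>1 \<delta> = \<eta>\<^sub>2 \<delta>)} = {0}"
  proof (intro equalityI subsetI)
    fix t assume "t \<in> {0::real}"
    obtain x where "x \<in> X" using X_nonempty by blast
    then show "t \<in> {\<bar>f \<eta>\<^sub>1 - f \<eta>\<^sub>2\<bar> | \<eta>\<^sub>1 \<eta>\<^sub>2. \<eta>\<^sub>1 \<in> X \<and> \<eta>\<^sub>2 \<in> X \<and> (\<forall>\<delta>\<in>carrier G - {\<gamma>}. \<eta>\<^sub>1 \<delta> = \<eta>\<^sub>2 \<delta>)}"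
      using \<open>t \<in> {0}\<close> by (intro CollectI exI[of _ x]) simp
  next
    fix t assume "t \<in> {\<bar>f \<eta>\<^sub>1 - f \<eta>\<^sub>2\<bar> | \<eta>\<^sub>1 \<eta>\<^sub>2. \<eta>\<^sub>1 \<in> X \<and> \<eta>\<^sub>2 \<in> X \<and> (\<forall>\<delta>\<in>carrier G - {\<gamma>}. \<eta>\<^sub>1 \<delta> = \<eta>\<^sub>2 \<delta>)}"
    then obtain \<eta> \<eta>' where "t = \<bar>f \<eta> - f \<eta>'\<bar>" "\<eta> \<in> X" "\<eta>' \<in> X" "\<forall>\<delta>\<in>carrier G - {\<gamma>}. \<eta> \<delta> = \<eta>' \<delta>"
      by blast
    then show "t \<in> {0}" using eq[of \<eta> \<eta>'] by simp
  qed
  show ?thesis unfolding oscillation_def seteq by simp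
qed

lemma local_in_\<Omega>_graph:
  assumes f: "local_on G A W f" and W: "finite W" "W \<subseteq> carrier G"
  shows "(f, \<L> f) \<in> \<Omega>_graph G A s r J h"
proof -
  have "oscillation G A f summable_on W" using W by simp
  then have "oscillation G A f summable_on carrier G"
    by (rule summable_on_cong_neutral[THEN iffD1, rotated -1])
      (use W oscillation_local_zero[OF f] in auto)
  then show ?thesis using local_on_imp_C[OF W f] by (auto simp: \<Omega>_graph_def)
qed

text \<open>The local function is \<open>F\<close> with the spins off a large window frozen to a
  fixed configuration. Uniform closeness controls the two generators only on a finite set
  \<open>D\<close> of sites; beyond \<open>D\<close>, both are dominated by the summable oscillation
  of \<open>F\<close>, which freezing does not increase.\<close>

lemma freeze_generator_estimate:
  assumes F: "F \<in> C T" and osc: "oscillation G A F summable_on carrier G" and e: "e > 0"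
  obtains W f where "finite W" "W \<subseteq> carrier G" "local_on G A W f"
    "\<And>x. x \<in> X \<Longrightarrow> \<bar>F x - f x\<bar> \<le> e" "\<And>x. x \<in> X \<Longrightarrow> \<bar>\<L> F x - \<L> f x\<bar> \<le> e"
proof -
  let ?o = "oscillation G A F"
  obtain x0 where x0: "x0 \<in> X" using X_nonempty by blast

  \<comment> \<open>The oscillation beyond \<open>D\<close> is charged twice, once for
    \<open>F\<close> and once for \<open>f\<close>, hence \<open>e / 4\<close>.\<close>
  obtain D where D: "finite D" "D \<subseteq> carrier G" "\<bar>sum ?o D - infsum ?o (carrier G)\<bar> \<le> e / 4"
    using infsum_finite_approximation[OF osc, of "e / 4"] e by (auto simp: dist_real_def)
  have tail: "infsum ?o (carrier G - D) \<le> e / 4"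
  proof -
    have "infsum ?o (carrier G) = infsum ?o (carrier G - D) + infsum ?o D"
    proof -
      have "carrier G = (carrier G - D) \<union> D" using D(2) by blast
      then show ?thesis
        using infsum_Un_disjoint[of ?o "carrier G - D" D] D(1) summable_on_subset[OF osc, of "carrier G - D"]
        by (metis Diff_disjoint Diff_subset Int_commute summable_on_finite)
    qed
    then show ?thesis using D by simp
  qed
  \<comment> \<open>Each of the \<open>card D\<close> sites costs \<open>2 * \<delta>\<close>, in
    total at most \<open>e / 2\<close>; the summand 1 covers an empty \<open>D\<close>.\<close>
  define \<delta> where "\<delta> = min e (e / (4 * (card D + 1)))"
  have \<delta>: "\<delta> > 0" "\<delta> \<le> e" using e by (auto simp: \<delta>_def)
  have \<delta>D: "2 * \<delta> * card D \<le> e / 2"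
  proof -
    have "\<delta> * (4 * (card D + 1)) \<le> e"
      using mult_right_mono[of \<delta> "e / (4 * (card D + 1))" "4 * (card D + 1)"] by (auto simp: \<delta>_def)
    then show ?thesis using \<delta> by (simp add: algebra_simps)
  qed
  obtain W where W: "finite W" "W \<subseteq> carrier G"
    "\<forall>x\<in>X. \<forall>y\<in>X. (\<forall>\<delta>\<in>W. x \<delta> = y \<delta>) \<longrightarrow> \<bar>F x - F y\<bar> < \<delta>"
    by (rule C_nearly_local[OF finite_A F \<delta>(1)]) (rule that)
  define z where "z x = (\<lambda>\<gamma>. if \<gamma> \<in> W then x \<gamma> else x0 \<gamma>)" for x
  define f where "f x = F (z x)" for x
  have z: "z x \<in> X" if "x \<in> X" for x
    using that x0 W(2) by (auto simp: z_def topspace_config_top PiE_iff extensional_def)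
  have f: "local_on G A W f"
    unfolding f_def by (rule local_onI, rule arg_cong[where f=F]) (auto simp: z_def)
  have close: "\<bar>F x - f x\<bar> \<le> \<delta>" if "x \<in> X" for x
  proof -
    have "\<forall>\<gamma>\<in>W. x \<gamma> = z x \<gamma>" by (simp add: z_def)
    then show ?thesis unfolding f_def using W(3) that z[OF that] by (blast intro: less_imp_le)
  qed
  have gen: "\<bar>\<L> F x - \<L> f x\<bar> \<le> e" if x: "x \<in> X" for x
  proof -
    let ?u = "\<lambda>\<gamma>. R \<gamma> F x - F x" and ?v = "\<lambda>\<gamma>. R \<gamma> f x - f x"
    have u: "\<bar>?u \<gamma>\<bar> \<le> ?o \<gamma>" if \<gamma>: "\<gamma> \<in> carrier G" for \<gamma>
      unfolding rate_sum_diff[symmetric] using x \<gamma>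
      by (intro rate_sum_diff_bound oscillation_bound F fun_upd_in_X) auto
    \<comment> \<open>Two configurations that agree off \<open>\<gamma>\<close> still agree off
      \<open>\<gamma>\<close> after freezing.\<close>
    have v: "\<bar>?v \<gamma>\<bar> \<le> ?o \<gamma>" if \<gamma>: "\<gamma> \<in> carrier G" for \<gamma>
      unfolding rate_sum_diff[of \<gamma> x f, symmetric] unfolding f_def using x \<gamma>
      by (intro rate_sum_diff_bound oscillation_bound F z fun_upd_in_X) (auto simp: z_def)
    have uv: "\<bar>?u \<gamma> - ?v \<gamma>\<bar> \<le> 2 * \<delta>" if \<gamma>: "\<gamma> \<in> carrier G" for \<gamma>
    proof -
      have "?u \<gamma> - ?v \<gamma> = (\<Sum>a\<in>A. \<rho> \<gamma> x a * ((F (x(\<gamma> := a)) - f (x(\<gamma> := a))) - (F x - f x)))"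
        unfolding rate_sum_diff[of \<gamma> x F, symmetric] rate_sum_diff[of \<gamma> x f, symmetric] sum_subtractf[symmetric]
        by (intro sum.cong refl) (simp add: algebra_simps)
      moreover have "\<bar>\<dots>\<bar> \<le> 2 * \<delta>"
      proof (rule rate_sum_diff_bound)
        fix a assume "a \<in> A"
        show "\<bar>(F (x(\<gamma> := a)) - f (x(\<gamma> := a))) - (F x - f x)\<bar> \<le> 2 * \<delta>"
          using close[OF x] close[OF fun_upd_in_X[OF x \<gamma> \<open>a \<in> A\<close>]] by linarith
      qed
      ultimately show ?thesis by simp
    qed
    have su: "?u summable_on carrier G" and sv: "?v summable_on carrier G"
      by (rule abs_summable_summable, rule summable_on_comparison_test[OF osc]; use u v in simp)+
    let ?w = "\<lambda>\<gamma>. ?u \<gamma> - ?v \<gamma>"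
    have w: "\<bar>?w \<gamma>\<bar> \<le> 2 * ?o \<gamma>" if "\<gamma> \<in> carrier G" for \<gamma> using u[OF that] v[OF that] by linarith
    have o2: "(\<lambda>\<gamma>. 2 * ?o \<gamma>) summable_on carrier G" using osc by (rule summable_on_cmult_right)
    have sw: "(\<lambda>\<gamma>. norm (?w \<gamma>)) summable_on carrier G"
      using w by (intro summable_on_comparison_test[OF o2]) auto
    have diff: "\<L> F x - \<L> f x = infsum ?w (carrier G)"
      unfolding \<Omega>_def rate_sum_diff
      using infsum_add[OF su summable_on_uminus[THEN iffD2, OF sv]]
      by (simp only: infsum_uminus add_uminus_conv_diff)
    have "\<bar>\<L> F x - \<L> f x\<bar> \<le> infsum (\<lambda>\<gamma>. \<bar>?w \<gamma>\<bar>) (carrier G)"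
      unfolding diff using norm_infsum_bound[OF sw] by simp
    also have "\<dots> = infsum (\<lambda>\<gamma>. \<bar>?w \<gamma>\<bar>) (carrier G - D) + infsum (\<lambda>\<gamma>. \<bar>?w \<gamma>\<bar>) D"
    proof -
      have cUn: "(carrier G - D) \<union> D = carrier G" using D(2) by blast
      have "(\<lambda>\<gamma>. \<bar>?w \<gamma>\<bar>) summable_on (carrier G - D)"
        using summable_on_subset[OF sw, of "carrier G - D"] by simp
      then have "infsum (\<lambda>\<gamma>. \<bar>?w \<gamma>\<bar>) ((carrier G - D) \<union> D)
          = infsum (\<lambda>\<gamma>. \<bar>?w \<gamma>\<bar>) (carrier G - D) + infsum (\<lambda>\<gamma>. \<bar>?w \<gamma>\<bar>) D"
        using D(1) by (intro infsum_Un_disjoint) auto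
      then show ?thesis unfolding cUn .
    qed
    also have "infsum (\<lambda>\<gamma>. \<bar>?w \<gamma>\<bar>) D \<le> e / 2"
    proof -
      have "(\<Sum>\<gamma>\<in>D. \<bar>?w \<gamma>\<bar>) \<le> (\<Sum>\<gamma>\<in>D. 2 * \<delta>)" using uv D by (intro sum_mono) blast
      then show ?thesis using D \<delta>D by (simp add: mult_ac)
    qed
    also have "infsum (\<lambda>\<gamma>. \<bar>?w \<gamma>\<bar>) (carrier G - D) \<le> infsum (\<lambda>\<gamma>. 2 * ?o \<gamma>) (carrier G - D)"
      using w sw o2 by (intro infsum_mono) (auto intro: summable_on_subset)
    also have "\<dots> \<le> e / 2" using tail by (simp add: infsum_cmult_right')
    finally show ?thesis by simp
  qed
  show thesis
  proof (rule that[OF W(1,2) f _ gen])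
    show "\<bar>F x - f x\<bar> \<le> e" if "x \<in> X" for x using close[OF that] \<delta>(2) by linarith
  qed
qed

end

section \<open>Local functions as a core of the Glauber generator\<close>

locale glauber = spin_system +
  fixes S
  assumes glauber: "glauber_semigroup G A s r J h S"
begin

lemma generator_eq: "generator_graph T S = graph_closure T (\<Omega>_graph G A s r J h)"
  using glauber by (simp add: glauber_semigroup_def)

lemma local_in_generator:
  assumes f: "local_on G A W f" and W: "finite W" "W \<subseteq> carrier G"
  shows "(f, \<L> f) \<in> generator_graph T S"
proof -
  have "uniform_limit X (\<lambda>_. f) f sequentially" "uniform_limit X (\<lambda>_. \<L> f) (\<L> f) sequentially"
    by (simp_all add: uniform_limit_const)
  then show ?thesis
    unfolding generator_eq graph_closure_def
    using local_in_\<Omega>_graph[OF f W] local_on_imp_C[OF W f] local_generator_C[OF f W]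
    by (intro CollectI case_prodI conjI exI[of _ "\<lambda>_. f"] exI[of _ "\<lambda>_. \<L> f"]) auto
qed

text \<open>Approximation in the graph norm, in two stages: an element of
  \<open>\<Omega>_graph\<close>, by definition of the closure, and then its frozen version. This is
  what allows generator identities to be tested on local functions only.\<close>

lemma local_core:
  assumes fg: "(f, g) \<in> generator_graph T S" and e: "e > 0"
  obtains W f' where "finite W" "W \<subseteq> carrier G" "local_on G A W f'"
    "\<And>x. x \<in> X \<Longrightarrow> \<bar>f x - f' x\<bar> \<le> e" "\<And>x. x \<in> X \<Longrightarrow> \<bar>g x - \<L> f' x\<bar> \<le> e"
proof -
  obtain F H where FH: "\<And>n::nat. (F n, H n) \<in> \<Omega>_graph G A s r J h"
    "uniform_limit X F f sequentially" "uniform_limit X H g sequentially"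
    using fg unfolding generator_eq graph_closure_def by auto
  have "\<forall>\<^sub>F n in sequentially. \<forall>x\<in>X. dist (F n x) (f x) < e / 2"
    using FH(2) half_gt_zero[OF e] unfolding uniform_limit_iff by blast
  moreover have "\<forall>\<^sub>F n in sequentially. \<forall>x\<in>X. dist (H n x) (g x) < e / 2"
    using FH(3) half_gt_zero[OF e] unfolding uniform_limit_iff by blast
  ultimately have "\<forall>\<^sub>F n in sequentially. (\<forall>x\<in>X. dist (F n x) (f x) < e / 2) \<and> (\<forall>x\<in>X. dist (H n x) (g x) < e / 2)"
    by (rule eventually_conj)
  then obtain n where n: "\<And>x. x \<in> X \<Longrightarrow> dist (F n x) (f x) < e / 2" "\<And>x. x \<in> X \<Longrightarrow> dist (H n x) (g x) < e / 2"
    unfolding eventually_sequentially by blast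
  have Fn: "F n \<in> C T" "oscillation G A (F n) summable_on carrier G" "H n = \<L> (F n)"
    using FH(1)[of n] by (auto simp: \<Omega>_graph_def)
  obtain W f' where W: "finite W" "W \<subseteq> carrier G" "local_on G A W f'"
    "\<And>x. x \<in> X \<Longrightarrow> \<bar>F n x - f' x\<bar> \<le> e / 2" "\<And>x. x \<in> X \<Longrightarrow> \<bar>\<L> (F n) x - \<L> f' x\<bar> \<le> e / 2"
    by (rule freeze_generator_estimate[OF Fn(1,2) half_gt_zero[OF e]]) (rule that)
  show thesis
  proof (rule that[OF W(1-3)])
    fix x assume x: "x \<in> X"
    show "\<bar>f x - f' x\<bar> \<le> e" using n(1)[OF x] W(4)[OF x] unfolding dist_real_def by linarith
    show "\<bar>g x - \<L> f' x\<bar> \<le> e" using n(2)[OF x] W(5)[OF x] unfolding dist_real_def Fn(3) by linarith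
  qed
qed

lemma local_dense:
  assumes f: "f \<in> C T" and e: "e > 0"
  obtains W f' where "finite W" "W \<subseteq> carrier G" "local_on G A W f'" "\<And>x. x \<in> X \<Longrightarrow> \<bar>f x - f' x\<bar> \<le> e"
proof -
  obtain x0 where x0: "x0 \<in> X" using X_nonempty by blast
  obtain W where W: "finite W" "W \<subseteq> carrier G"
    "\<forall>x\<in>X. \<forall>y\<in>X. (\<forall>\<delta>\<in>W. x \<delta> = y \<delta>) \<longrightarrow> \<bar>f x - f y\<bar> < e"
    by (rule C_nearly_local[OF finite_A f e]) (rule that)
  define z where "z x = (\<lambda>\<gamma>. if \<gamma> \<in> W then x \<gamma> else x0 \<gamma>)" for x
  have z: "z x \<in> X" if "x \<in> X" for x
    using that x0 W(2) by (auto simp: z_def topspace_config_top PiE_iff extensional_def)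
  show thesis
  proof (rule that[OF W(1,2), of "\<lambda>x. f (z x)"])
    show "local_on G A W (\<lambda>x. f (z x))"
      by (rule local_onI, rule arg_cong[where f=f]) (auto simp: z_def)
    show "\<bar>f x - f (z x)\<bar> \<le> e" if "x \<in> X" for x
    proof -
      have "\<forall>\<gamma>\<in>W. x \<gamma> = z x \<gamma>" by (simp add: z_def)
      then show ?thesis using W(3) that z[OF that] by (blast intro: less_imp_le)
    qed
  qed
qed

end

sublocale glauber \<subseteq> markov_dense_domain T S
proof
  show "compact_space T" by (rule compact_config_top[OF finite_A])
  show "markov_semigroup T S" using glauber by (simp add: glauber_semigroup_def)
  fix f and e :: real assume f: "f \<in> C T" and e: "e > 0"
  obtain W f' where W: "finite W" "W \<subseteq> carrier G" "local_on G A W f'" "\<And>x. x \<in> X \<Longrightarrow> \<bar>f x - f' x\<bar> \<le> e"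
    by (rule local_dense[OF f e]) (rule that)
  show "\<exists>f' g'. (f', g') \<in> generator_graph T S \<and> (\<forall>x\<in>X. \<bar>f x - f' x\<bar> \<le> e)"
    using local_in_generator[OF W(3,1,2)] W(4) by blast
qed

context glauber begin

lemma state_null_on_local_generator:
  assumes I: "state T I"
    and null: "\<And>W f. finite W \<Longrightarrow> W \<subseteq> carrier G \<Longrightarrow> local_on G A W f \<Longrightarrow> I (\<L> f) = 0"
    and fg: "(f, g) \<in> generator_graph T S"
  shows "I g = 0"
proof -
  have "\<bar>I g\<bar> \<le> 0 + e" if e: "e > 0" for e
  proof -
    obtain W f' where W: "finite W" "W \<subseteq> carrier G" "local_on G A W f'" "\<And>x. x \<in> X \<Longrightarrow> \<bar>g x - \<L> f' x\<bar> \<le> e"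
      by (rule local_core[OF fg e]) (rule that)
    have "\<bar>I g - I (\<L> f')\<bar> \<le> e"
      using W local_generator_C generatorD(2)[OF fg] by (intro state_diff_bound[OF I]) auto
    then show ?thesis using null[OF W(1-3)] by simp
  qed
  then have "\<bar>I g\<bar> \<le> 0" by (rule field_le_epsilon)
  then show ?thesis by simp
qed

lemma state_tendsto_if_local_resolvent_tendsto:
  fixes \<kappa> :: real
  assumes \<kappa>: "\<kappa> > 0" and L: "\<And>n. state T (L n)" and I: "state T I"
    and lim: "\<And>W f. finite W \<Longrightarrow> W \<subseteq> carrier G \<Longrightarrow> local_on G A W f \<Longrightarrow>
      (\<lambda>n. L n (\<lambda>x. f x - \<kappa> * \<L> f x)) \<longlonglongrightarrow> I (\<lambda>x. f x - \<kappa> * \<L> f x)"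
    and f: "f \<in> C T"
  shows "(\<lambda>n. L n f) \<longlonglongrightarrow> I f"
proof (rule state_tendsto_if_resolvent_tendsto[OF \<kappa> L I _ f])
  fix f g assume fg: "(f, g) \<in> generator_graph T S"
  let ?u = "\<lambda>f g x. f x - \<kappa> * g x"
  show "(\<lambda>n. L n (?u f g)) \<longlonglongrightarrow> I (?u f g)"
  proof (rule tendstoI)
    fix e :: real assume e: "e > 0"
    \<comment> \<open>Replacing \<open>(f, g)\<close> by its local approximation changes
      \<open>f - \<kappa> * g\<close> by at most \<open>(1 + \<kappa>) * d = e / 3\<close>.\<close>
    define d where "d = e / (3 * (1 + \<kappa>))"
    have d: "d > 0" "(1 + \<kappa>) * d = e / 3" using e \<kappa> by (auto simp: d_def field_simps)
    obtain W f' where W: "finite W" "W \<subseteq> carrier G" "local_on G A W f'"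
      "\<And>x. x \<in> X \<Longrightarrow> \<bar>f x - f' x\<bar> \<le> d" "\<And>x. x \<in> X \<Longrightarrow> \<bar>g x - \<L> f' x\<bar> \<le> d"
      by (rule local_core[OF fg d(1)]) (rule that)
    have close: "\<bar>?u f g x - ?u f' (\<L> f') x\<bar> \<le> e / 3" if x: "x \<in> X" for x
    proof -
      have "\<bar>?u f g x - ?u f' (\<L> f') x\<bar> \<le> \<bar>f x - f' x\<bar> + \<kappa> * \<bar>g x - \<L> f' x\<bar>"
      proof -
        have "?u f g x - ?u f' (\<L> f') x = (f x - f' x) - \<kappa> * (g x - \<L> f' x)" by (simp add: algebra_simps)
        then show ?thesis using \<kappa> abs_triangle_ineq4[of "f x - f' x" "\<kappa> * (g x - \<L> f' x)"] by (simp add: abs_mult)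
      qed
      also have "\<dots> \<le> d + \<kappa> * d" using W(4,5)[OF x] \<kappa> by (intro add_mono mult_left_mono) auto
      also have "\<dots> = e / 3" using d(2) by (simp add: algebra_simps)
      finally show ?thesis .
    qed
    have C1: "?u f g \<in> C T" and C2: "?u f' (\<L> f') \<in> C T"
      using generatorD[OF fg] local_on_imp_C[OF W(1-3)] local_generator_C[OF W(3,1,2)]
      by (auto intro!: C_diff C_cmult)
    have "\<forall>\<^sub>F n in sequentially. dist (L n (?u f' (\<L> f'))) (I (?u f' (\<L> f'))) < e / 3"
      by (rule tendstoD[OF lim[OF W(1-3)]]) (use e in simp)
    then show "\<forall>\<^sub>F n in sequentially. dist (L n (?u f g)) (I (?u f g)) < e"
    proof eventually_elim
      case (elim n)
      then show ?case
        using state_diff_bound[OF L C1 C2 close, of n] state_diff_bound[OF I C1 C2 close]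
        unfolding dist_real_def by linarith
    qed
  qed
qed

end

section \<open>Glauber dynamics on a finite \<open>\<Gamma>\<close>-set\<close>

context spin_system begin

text \<open>A bound for the energy per site of a finite \<Gamma>-set; the factor 2 allows for
  loops.\<close>

definition "energy_bound = (\<Sum>a\<in>A. \<bar>h a\<bar>) + 2 * real r * (\<Sum>a\<in>A. \<Sum>b\<in>A. \<bar>J a b\<bar>)"

text \<open>The range per site of the relative entropy: the energies account for
  \<open>2 * energy_bound\<close>, the number of configurations for
  \<open>ln (card A)\<close>.\<close>

definition "dissipation_bound = 2 * energy_bound + ln (card A)"

end

text \<open>Several orbits and nontrivial stabilisers are allowed. Symmetry of \<open>J\<close> is
  what makes the dynamics on \<open>V\<close> reversible, see \<open>energy_fun_upd\<close>.\<close>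

locale finite_action = spin_system G A s r J h
  for G :: "('g, 'm) monoid_scheme" (structure) and A :: "'a set" and s r J h +
  fixes V :: "'z set" and act :: "'g \<Rightarrow> 'z \<Rightarrow> 'z"
  assumes J_sym: "\<And>a b. a \<in> A \<Longrightarrow> b \<in> A \<Longrightarrow> J a b = J b a"
    and finite_V: "finite V" and V_nonempty: "V \<noteq> {}"
    and act_closed: "\<And>\<gamma> z. \<gamma> \<in> carrier G \<Longrightarrow> z \<in> V \<Longrightarrow> act \<gamma> z \<in> V"
    and act_one: "\<And>z. z \<in> V \<Longrightarrow> act \<one> z = z"
    and act_mult: "\<And>\<gamma> \<delta> z. \<gamma> \<in> carrier G \<Longrightarrow> \<delta> \<in> carrier G \<Longrightarrow> z \<in> V \<Longrightarrow>
      act (\<gamma> \<otimes> \<delta>) z = act \<gamma> (act \<delta> z)"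
begin

definition "confs = (V \<rightarrow>\<^sub>E A)"

text \<open>The pull-back of a configuration on \<open>V\<close> to \<Gamma> along the orbit map of
  \<open>z\<close>. For \<open>z\<close> uniform in \<open>V\<close>, the law of
  \<open>lift z y\<close> records the local statistics of \<open>y\<close>.\<close>

definition lift where
  "lift z y = (\<lambda>\<gamma>\<in>carrier G. y (act \<gamma> z))"

text \<open>A site fixed by \<open>s i\<close> feels its own spin through both \<open>s i\<close> and its inverse, so loops count
  twice.\<close>

definition energy where
  "energy y = (\<Sum>v\<in>V. h (y v) +
     (\<Sum>i=1..r. (if act (s i) v = v then 2 else 1) * J (y v) (y (act (s i) v))))"

definition site_energy where
  "site_energy v y = h (y v) +
     (\<Sum>i=1..r. J (y v) (y (act (s i) v)) + J (y v) (y (act (inv (s i)) v)))"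

definition "weight y = exp (- energy y)"

definition "flips v y = (\<lambda>a. y(v := a)) ` A"

lemma finite_confs: "finite confs"
  unfolding confs_def using finite_V finite_A by (intro finite_PiE) auto

lemma card_confs: "card confs = card A ^ card V"
  unfolding confs_def using finite_V by (simp add: card_PiE)

lemma confs_mem: "y \<in> confs \<Longrightarrow> v \<in> V \<Longrightarrow> y v \<in> A"
  by (auto simp: confs_def)

lemma fun_upd_confs: "y \<in> confs \<Longrightarrow> v \<in> V \<Longrightarrow> a \<in> A \<Longrightarrow> y(v := a) \<in> confs"
  by (auto simp: confs_def PiE_iff extensional_def)

lemma act_inv: "\<gamma> \<in> carrier G \<Longrightarrow> z \<in> V \<Longrightarrow> act (inv \<gamma>) (act \<gamma> z) = z"
  and act_inv': "\<gamma> \<in> carrier G \<Longrightarrow> z \<in> V \<Longrightarrow> act \<gamma> (act (inv \<gamma>) z) = z"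
  using act_mult[of "inv \<gamma>" \<gamma> z] act_mult[of \<gamma> "inv \<gamma>" z] by (simp_all add: act_one)

lemma bij_betw_act:
  assumes "\<gamma> \<in> carrier G"
  shows "bij_betw (act \<gamma>) V V"
  by (rule bij_betw_byWitness[where f' = "act (inv \<gamma>)"])
    (use assms act_inv act_inv' act_closed in auto)

lemma lift_in_X: "y \<in> confs \<Longrightarrow> z \<in> V \<Longrightarrow> lift z y \<in> X"
  unfolding lift_def topspace_config_top using act_closed confs_mem by (intro restrict_PiE_iff[THEN iffD2]) auto

text \<open>The spin at \<open>v\<close> enters the energy through the edge that leaves
  \<open>v\<close> and the edge that starts at \<open>act (inv (s i)) v\<close>; symmetry of
  \<open>J\<close> lets the second be read from \<open>v\<close>. At a loop the two edges coincide,
  which explains the coefficient 2.\<close>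

lemma energy_fun_upd:
  assumes y: "y \<in> confs" and v: "v \<in> V"
  obtains c where "\<And>a. a \<in> A \<Longrightarrow> energy (y(v := a)) = site_energy v (y(v := a)) + c"
proof -
  let ?k = "\<lambda>i u. if act (s i) u = u then 2 else 1 :: real"
  let ?t = "\<lambda>i y u. ?k i u * J (y u) (y (act (s i) u))"
  \<comment> \<open>The terms without the spin at \<open>v\<close>, hence independent of
    \<open>a\<close>.\<close>
  define c where "c = (\<Sum>u\<in>V - {v}. h (y u))
    + (\<Sum>i=1..r. \<Sum>u\<in>V - {v, act (inv (s i)) v}. ?t i y u)"
  have "energy (y(v := a)) = site_energy v (y(v := a)) + c" if a: "a \<in> A" for a
  proof -
    let ?x = "y(v := a)"
    have edge: "(\<Sum>u\<in>V. ?t i ?x u) = J a (?x (act (s i) v)) + J a (?x (act (inv (s i)) v))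
        + (\<Sum>u\<in>V - {v, act (inv (s i)) v}. ?t i y u)" if i: "i \<in> {1..r}" for i
    proof -
      let ?v' = "act (inv (s i)) v"
      have si: "s i \<in> carrier G" using s_closed i .
      have v': "?v' \<in> V" using act_closed si v by simp
      have rest: "(\<Sum>u\<in>V - {v, ?v'}. ?t i ?x u) = (\<Sum>u\<in>V - {v, ?v'}. ?t i y u)"
      proof (intro sum.cong refl)
        fix u assume u: "u \<in> V - {v, ?v'}"
        then have "act (s i) u \<noteq> v" using act_inv[OF si, of u] by auto
        then show "?t i ?x u = ?t i y u" using u by auto
      qed
      show ?thesis
      proof (cases "act (s i) v = v")
        case True
        then have "?v' = v" using act_inv[OF si v] by simp
        then show ?thesis using True rest sum.remove[OF finite_V v, of "?t i ?x"] by simp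
      next
        case False
        then have ne: "?v' \<noteq> v" using act_inv'[OF si v] by metis
        have "(\<Sum>u\<in>V. ?t i ?x u) = ?t i ?x v + (?t i ?x ?v' + (\<Sum>u\<in>V - {v} - {?v'}. ?t i ?x u))"
          using finite_V v v' ne sum.remove[of V v "?t i ?x"] sum.remove[of "V - {v}" ?v' "?t i ?x"] by simp
        moreover have "V - {v} - {?v'} = V - {v, ?v'}" by auto
        moreover have "?t i ?x ?v' = J a (y ?v')"
          using ne act_inv'[OF si v] J_sym[OF confs_mem[OF y v'] a] by simp
        ultimately show ?thesis using rest False ne by simp
      qed
    qed
    have "energy ?x = (\<Sum>u\<in>V. h (?x u)) + (\<Sum>i=1..r. \<Sum>u\<in>V. ?t i ?x u)"
      unfolding energy_def sum.distrib by (subst sum.swap) simp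
    also have "(\<Sum>u\<in>V. h (?x u)) = h a + (\<Sum>u\<in>V - {v}. h (y u))"
      using finite_V v by (simp add: sum.remove)
    also have "(\<Sum>i=1..r. \<Sum>u\<in>V. ?t i ?x u) = (\<Sum>i=1..r. J a (?x (act (s i) v)) + J a (?x (act (inv (s i)) v))
        + (\<Sum>u\<in>V - {v, act (inv (s i)) v}. ?t i y u))"
      using edge by (intro sum.cong refl)
    finally show ?thesis
      unfolding site_energy_def c_def by (simp only: fun_upd_same sum.distrib add_ac)
  qed
  then show thesis by (rule that)
qed

lemma abs_energy_le:
  assumes y: "y \<in> confs"
  shows "\<bar>energy y\<bar> \<le> card V * energy_bound"
proof -
  define j where "j = (\<Sum>a\<in>A. \<Sum>b\<in>A. \<bar>J a b\<bar>)"
  have j0: "j \<ge> 0" unfolding j_def by (intro sum_nonneg) auto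
  have hb: "\<bar>h a\<bar> \<le> (\<Sum>a\<in>A. \<bar>h a\<bar>)" if "a \<in> A" for a
    using that finite_A by (intro member_le_sum) auto
  have jb: "\<bar>J a b\<bar> \<le> j" if "a \<in> A" "b \<in> A" for a b
  proof -
    have "\<bar>J a b\<bar> \<le> (\<Sum>b\<in>A. \<bar>J a b\<bar>)" using that finite_A by (intro member_le_sum) auto
    also have "\<dots> \<le> j" unfolding j_def
      using that finite_A by (intro member_le_sum[of a A "\<lambda>a. \<Sum>b\<in>A. \<bar>J a b\<bar>"]) (auto intro: sum_nonneg)
    finally show ?thesis .
  qed
  have "\<bar>energy y\<bar> \<le> (\<Sum>v\<in>V. energy_bound)"
    unfolding energy_def
  proof (intro order_trans[OF sum_abs] sum_mono)
    fix v assume v: "v \<in> V"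
    have "\<bar>\<Sum>i=1..r. (if act (s i) v = v then 2 else 1) * J (y v) (y (act (s i) v))\<bar> \<le> (\<Sum>i=1..r. 2 * j)"
    proof (intro order_trans[OF sum_abs] sum_mono)
      fix i assume i: "i \<in> {1..r}"
      have "\<bar>J (y v) (y (act (s i) v))\<bar> \<le> j" using jb confs_mem[OF y] v act_closed s_closed[OF i] by blast
      then show "\<bar>(if act (s i) v = v then 2 else 1) * J (y v) (y (act (s i) v))\<bar> \<le> 2 * j"
        using j0 by (auto simp: abs_mult)
    qed
    then show "\<bar>h (y v) + (\<Sum>i=1..r. (if act (s i) v = v then 2 else 1) * J (y v) (y (act (s i) v)))\<bar> \<le> energy_bound"
      using hb[OF confs_mem[OF y v]] unfolding energy_bound_def j_def[symmetric] by simp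
  qed
  then show ?thesis by simp
qed

sublocale hb: partitioned_weights confs V flips weight
proof
  fix v x y assume v: "v \<in> V" and x: "x \<in> confs"
  show "x \<in> flips v x" unfolding flips_def using confs_mem[OF x v] by (intro image_eqI[of _ _ "x v"]) auto
  show "flips v x \<subseteq> confs" unfolding flips_def using fun_upd_confs[OF x v] by auto
  assume "y \<in> flips v x"
  then obtain a where "y = x(v := a)" by (auto simp: flips_def)
  then show "flips v y = flips v x" by (simp add: flips_def)
qed (simp_all add: finite_confs finite_V V_nonempty weight_def)

text \<open>The additive constant from \<open>energy_fun_upd\<close> cancels in the quotient. So the
  conditional law of the spin at \<open>v\<close> under \<open>weight\<close> is the Glauber rate
  for the action on \<open>V\<close>.\<close>

lemma local_mean_flips:
  assumes y: "y \<in> confs" and v: "v \<in> V"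
  shows "local_mean weight (flips v) f y =
    (\<Sum>a\<in>A. exp (- site_energy v (y(v := a))) / (\<Sum>b\<in>A. exp (- site_energy v (y(v := b)))) * f (y(v := a)))"
proof -
  obtain c where c: "\<And>a. a \<in> A \<Longrightarrow> energy (y(v := a)) = site_energy v (y(v := a)) + c"
    by (rule energy_fun_upd[OF y v]) (rule that)
  have inj: "inj_on (\<lambda>a. y(v := a)) A" by (auto simp: inj_on_def fun_eq_iff split: if_splits)
  have w: "weight (y(v := a)) = exp (- c) * exp (- site_energy v (y(v := a)))" if "a \<in> A" for a
    using c[OF that] by (simp add: weight_def flip: exp_add)
  have "sum weight (flips v y) = exp (- c) * (\<Sum>b\<in>A. exp (- site_energy v (y(v := b))))"
    unfolding flips_def sum.reindex[OF inj] sum_distrib_left using w by (intro sum.cong) auto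
  moreover have "(\<Sum>x\<in>flips v y. weight x * f x) = exp (- c) * (\<Sum>a\<in>A. exp (- site_energy v (y(v := a))) * f (y(v := a)))"
    unfolding flips_def sum.reindex[OF inj] sum_distrib_left using w by (intro sum.cong) auto
  ultimately show ?thesis unfolding local_mean_def by (simp add: sum_divide_distrib)
qed

text \<open>Local freeness of the action at \<open>z\<close>. The neighbourhoods are included
  because resampling a site of \<open>W\<close> reads them.\<close>

definition good where
  "good W z \<longleftrightarrow> inj_on (\<lambda>\<gamma>. act \<gamma> z) (W \<union> (\<Union>\<gamma>\<in>W. nbhd \<gamma>))"

text \<open>By injectivity, changing the spin at \<open>act \<gamma> z\<close> alters the lift at
  \<open>\<gamma>\<close> and nowhere else on \<open>W \<union> nbhd \<gamma>\<close>. Farther away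
  the two lifts may differ, but neither \<open>f\<close> nor the rate at \<open>\<gamma>\<close>
  reads those sites.\<close>

lemma resample_lift:
  assumes W: "W \<subseteq> carrier G" and f: "local_on G A W f" and good: "good W z" and z: "z \<in> V"
    and \<gamma>: "\<gamma> \<in> W" and y: "y \<in> confs"
  shows "R \<gamma> f (lift z y) = local_mean weight (flips (act \<gamma> z)) (\<lambda>y. f (lift z y)) y"
proof -
  let ?v = "act \<gamma> z"
  have \<gamma>G: "\<gamma> \<in> carrier G" using W \<gamma> by blast
  have v: "?v \<in> V" using act_closed[OF \<gamma>G z] .
  have neq: "act \<delta> z \<noteq> ?v" if "\<delta> \<in> W \<union> nbhd \<gamma>" "\<delta> \<noteq> \<gamma>" for \<delta>
    using good that \<gamma> unfolding good_def inj_on_def by blast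
  have eq: "((lift z y)(\<gamma> := a)) \<delta> = (y(?v := a)) (act \<delta> z)" if "\<delta> \<in> W \<union> nbhd \<gamma>" for a \<delta>
  proof -
    have "\<delta> \<in> carrier G" using that W nbhd_closed[OF \<gamma>G] by blast
    then show ?thesis using neq[OF that] by (simp add: lift_def)
  qed
  have energy: "\<Phi> G s r J h \<gamma> ((lift z y)(\<gamma> := a)) = site_energy ?v (y(?v := a))" for a
  proof -
    have "((lift z y)(\<gamma> := a)) (s i \<otimes> \<gamma>) = (y(?v := a)) (act (s i) ?v)"
      "((lift z y)(\<gamma> := a)) (inv (s i) \<otimes> \<gamma>) = (y(?v := a)) (act (inv (s i)) ?v)" if i: "i \<in> {1..r}" for i
    proof -
      have si: "s i \<in> carrier G" using s_closed i .
      have "s i \<otimes> \<gamma> \<in> nbhd \<gamma>" "inv (s i) \<otimes> \<gamma> \<in> nbhd \<gamma>" using i by (auto simp: nbhd_def)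
      then show "((lift z y)(\<gamma> := a)) (s i \<otimes> \<gamma>) = (y(?v := a)) (act (s i) ?v)"
        "((lift z y)(\<gamma> := a)) (inv (s i) \<otimes> \<gamma>) = (y(?v := a)) (act (inv (s i)) ?v)"
        using eq[of "s i \<otimes> \<gamma>" a] eq[of "inv (s i) \<otimes> \<gamma>" a]
          act_mult[OF si \<gamma>G z] act_mult[OF inv_closed[OF si] \<gamma>G z] by (simp_all only: UnI2)
    qed
    then show ?thesis unfolding \<Phi>_def site_energy_def by (auto intro!: sum.cong arg_cong2[where f="(+)"])
  qed
  have "f ((lift z y)(\<gamma> := a)) = f (lift z (y(?v := a)))" if a: "a \<in> A" for a
  proof (rule local_onD[OF f])
    show "(lift z y)(\<gamma> := a) \<in> X" using fun_upd_in_X[OF lift_in_X[OF y z] \<gamma>G a] .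
    show "lift z (y(?v := a)) \<in> X" using lift_in_X[OF fun_upd_confs[OF y v a] z] .
    show "((lift z y)(\<gamma> := a)) \<delta> = lift z (y(?v := a)) \<delta>" if "\<delta> \<in> W" for \<delta>
      using eq[of \<delta> a] that W by (auto simp: lift_def)
  qed
  then show ?thesis
    unfolding local_mean_flips[OF y v] resample_def rate_def energy by (intro sum.cong) auto
qed

lemma flips_irrelevant:
  assumes W: "W \<subseteq> carrier G" and f: "local_on G A W f" and z: "z \<in> V" and v: "v \<in> V - (\<lambda>\<gamma>. act \<gamma> z) ` W"
    and y: "y \<in> confs"
  shows "local_mean weight (flips v) (\<lambda>y. f (lift z y)) y = f (lift z y)"
proof (rule hb.local_mean_const_on)
  show "v \<in> V" "y \<in> confs" using v y by auto
  fix x assume "x \<in> flips v y"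
  then obtain a where a: "a \<in> A" "x = y(v := a)" by (auto simp: flips_def)
  show "f (lift z x) = f (lift z y)"
  proof (rule local_onD[OF f])
    show "lift z x \<in> X" "lift z y \<in> X" using a v y z fun_upd_confs by (auto intro!: lift_in_X)
    show "lift z x \<delta> = lift z y \<delta>" if "\<delta> \<in> W" for \<delta>
      using that v a by (auto simp: lift_def)
  qed
qed

definition bad_fraction where
  "bad_fraction W = card {z \<in> V. \<not> good W z} / card V"

lemma sum_le_good_bad:
  assumes "\<And>z. z \<in> V \<Longrightarrow> good W z \<Longrightarrow> u z \<le> g z" "\<And>z. z \<in> V \<Longrightarrow> \<not> good W z \<Longrightarrow> u z \<le> b"
    "\<And>z. z \<in> V \<Longrightarrow> g z \<ge> 0"
  shows "(\<Sum>z\<in>V. u z) / card V \<le> (\<Sum>z\<in>V. g z) / card V + b * bad_fraction W"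
proof -
  have "(\<Sum>z\<in>V. u z) \<le> (\<Sum>z\<in>V. g z + (if \<not> good W z then b else 0))"
    using assms by (intro sum_mono) (auto intro: add_increasing)
  also have "\<dots> = (\<Sum>z\<in>V. g z) + b * card {z \<in> V. \<not> good W z}"
    using finite_V by (simp add: sum.distrib sum.If_cases Int_def mult.commute)
  finally show ?thesis
    unfolding bad_fraction_def by (simp add: divide_right_mono flip: add_divide_distrib)
qed

text \<open>\<open>L\<close> averages over \<open>z\<close> the law of \<open>lift z y\<close>,
  where \<open>y\<close> is drawn from the resolvent of nearly the point mass at \<open>x0\<close>.
  The first estimate tests the resolvent equation with \<open>f\<close>, the second is the
  dissipation bound averaged over the sites. Bad points are charged by crude bounds. One
  \<open>L\<close> serves all windows and local functions.\<close>

lemma resolvent_state: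
  fixes \<kappa> \<epsilon> :: real
  assumes \<kappa>: "\<kappa> > 0" and \<epsilon>: "0 < \<epsilon>" "\<epsilon> \<le> 1" and x0: "x0 \<in> confs"
  obtains L where "state T L"
    "\<And>W f K. finite W \<Longrightarrow> W \<subseteq> carrier G \<Longrightarrow> local_on G A W f \<Longrightarrow> (\<And>x. x \<in> X \<Longrightarrow> \<bar>f x\<bar> \<le> K) \<Longrightarrow>
      \<bar>L f - \<kappa> * L (\<L> f) - (\<Sum>z\<in>V. f (lift z x0)) / card V\<bar>
      \<le> K * (2 * \<epsilon> + (2 + 2 * \<kappa> * card W) * bad_fraction W)"
    "\<And>W f K \<gamma>. finite W \<Longrightarrow> W \<subseteq> carrier G \<Longrightarrow> local_on G A W f \<Longrightarrow> (\<And>x. x \<in> X \<Longrightarrow> \<bar>f x\<bar> \<le> K) \<Longrightarrow> \<gamma> \<in> W \<Longrightarrow>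
      \<bar>L f - L (R \<gamma> f)\<bar> \<le> K * (sqrt (2 * dissipation_bound / \<kappa>) + 2 * bad_fraction W)"
proof -
  define N where "N = real (card V)"
  have N: "N > 0" using finite_V V_nonempty by (simp add: N_def card_gt_0_iff)
  have M: "real (card confs) > 0" using finite_confs x0 by (auto simp: card_gt_0_iff)
  \<comment> \<open>The admixture of the uniform law makes the initial density positive, as the
    entropy bound requires; it accounts for the error \<open>2 * \<epsilon> * K\<close>.\<close>
  define \<zeta>0 where "\<zeta>0 y = (1 - \<epsilon>) * (if y = x0 then 1 else 0) + \<epsilon> / card confs" for y
  have \<zeta>0_pos: "\<zeta>0 y > 0" for y using \<epsilon> M by (simp add: \<zeta>0_def add_nonneg_pos)
  have \<zeta>0_int: "(\<Sum>y\<in>confs. \<zeta>0 y * F y) = (1 - \<epsilon>) * F x0 + \<epsilon> * ((\<Sum>y\<in>confs. F y) / card confs)" for F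
  proof -
    have "(\<Sum>y\<in>confs. \<zeta>0 y * F y) = (\<Sum>y\<in>confs. (if y = x0 then (1 - \<epsilon>) * F x0 else 0) + \<epsilon> / card confs * F y)"
      by (intro sum.cong refl) (simp add: \<zeta>0_def algebra_simps)
    then show ?thesis
      using finite_confs x0 by (simp add: sum.distrib sum_distrib_left sum_divide_distrib)
  qed
  have \<zeta>0_sum: "sum \<zeta>0 confs = 1" using \<zeta>0_int[of "\<lambda>_. 1"] M by simp
  obtain \<zeta> where \<zeta>: "\<And>y. y \<in> confs \<Longrightarrow> \<zeta> y \<ge> \<zeta>0 y / (1 + \<kappa> * card V)" "sum \<zeta> confs = 1"
    "\<And>y. y \<in> confs \<Longrightarrow> \<zeta> y = \<zeta>0 y + \<kappa> * (\<Sum>v\<in>V. heat_bath weight (flips v) \<zeta> y - \<zeta> y)"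
    by (rule hb.resolvent_exists[OF less_imp_le[OF \<zeta>0_pos] \<zeta>0_sum \<kappa>]) (rule that)
  have \<zeta>_pos: "\<zeta> y > 0" if "y \<in> confs" for y
  proof -
    have "1 + \<kappa> * card V > 0" using \<kappa> by (simp add: add_pos_nonneg)
    then have "\<zeta>0 y / (1 + \<kappa> * card V) > 0" using \<zeta>0_pos by simp
    then show ?thesis using \<zeta>(1)[OF that] by linarith
  qed
  define P where "P v = heat_bath weight (flips v) \<zeta>" for v
  define n where "n v = (\<Sum>y\<in>confs. \<bar>\<zeta> y - P v y\<bar>)" for v
  have n_nonneg: "n v \<ge> 0" for v by (simp add: n_def sum_nonneg)
  have n_sum: "(\<Sum>v\<in>V. n v) \<le> N * sqrt (2 * dissipation_bound / \<kappa>)"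
  proof -
    have w: "exp (- (card V * energy_bound)) \<le> weight y" "weight y \<le> exp (card V * energy_bound)"
      if "y \<in> confs" for y using abs_energy_le[OF that] by (auto simp: weight_def abs_le_iff)
    \<comment> \<open>One factor \<open>N\<close> stems from Cauchy-Schwarz over the sites, the
      other from the entropy being extensive; after the square root, the bound per site no longer
      depends on \<open>V\<close>.\<close>
    have "real (card V) * (2 * (2 * (card V * energy_bound) + ln (card confs)) / \<kappa>)
        = N\<^sup>2 * (2 * dissipation_bound / \<kappa>)"
    proof -
      have "ln (card confs) = N * ln (card A)"
        unfolding card_confs N_def using finite_A A_nonempty by (simp add: ln_realpow card_gt_0_iff)
      then show ?thesis
        by (simp add: dissipation_bound_def N_def power2_eq_square algebra_simps)
    qed
    moreover have "sqrt (N\<^sup>2 * c) = N * sqrt c" for c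
      using N by (simp add: real_sqrt_mult)
    ultimately have "sqrt (real (card V) * (2 * (2 * (card V * energy_bound) + ln (card confs)) / \<kappa>))
        = N * sqrt (2 * dissipation_bound / \<kappa>)"
      by (simp only:)
    then show ?thesis
      using hb.resolvent_dissipation_bound[OF \<zeta>0_pos \<zeta>0_sum \<kappa> \<zeta>_pos \<zeta>(2,3) w]
      unfolding n_def P_def by simp
  qed
  define m where "m F = (\<Sum>y\<in>confs. \<zeta> y * F y)" for F
  have m_bound: "\<bar>m F\<bar> \<le> K" if "\<And>y. y \<in> confs \<Longrightarrow> \<bar>F y\<bar> \<le> K" for F K
  proof -
    have "\<bar>m F\<bar> \<le> (\<Sum>y\<in>confs. \<zeta> y * K)"
      unfolding m_def using that \<zeta>_pos
      by (intro order_trans[OF sum_abs] sum_mono) (simp add: abs_mult less_imp_le)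
    then show ?thesis using \<zeta>(2) by (simp flip: sum_distrib_right)
  qed
  have m_P: "m (local_mean weight (flips v) F) = (\<Sum>y\<in>confs. P v y * F y)" if "v \<in> V" for v F
    using hb.heat_bath_adjoint[OF that, of \<zeta> F] by (simp add: m_def P_def)
  define L where "L f = (\<Sum>z\<in>V. m (\<lambda>y. f (lift z y))) / N" for f
  have L: "state T L"
    unfolding state_def
  proof (intro conjI ballI allI impI)
    fix f g and a b :: real
    show "L (\<lambda>x. a * f x + b * g x) = a * L f + b * L g"
      by (simp add: L_def m_def sum.distrib sum_distrib_left algebra_simps add_divide_distrib)
  next
    show "L (\<lambda>_. 1) = 1" using N \<zeta>(2) by (simp add: L_def m_def N_def)
  next
    fix f assume "\<forall>x\<in>X. f x \<ge> (0::real)"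
    then show "L f \<ge> 0" unfolding L_def m_def using \<zeta>_pos lift_in_X N
      by (intro divide_nonneg_pos sum_nonneg mult_nonneg_nonneg) (auto intro: less_imp_le)
  qed
  show thesis
  proof (rule that[OF L])
    fix W f K assume W: "finite W" "W \<subseteq> carrier G" and f: "local_on G A W f"
      and K: "\<And>x. x \<in> X \<Longrightarrow> \<bar>f x\<bar> \<le> K"
    have K0: "K \<ge> 0" using K X_nonempty by (metis abs_ge_zero all_not_in_conv order_trans)
    have fK: "\<bar>f (lift z y)\<bar> \<le> K" if "z \<in> V" "y \<in> confs" for z y using K lift_in_X that by blast
    have RK: "\<bar>R \<gamma> f (lift z y)\<bar> \<le> K" if "z \<in> V" "y \<in> confs" "\<gamma> \<in> W" for z y \<gamma>
      unfolding resample_def using K lift_in_X fun_upd_in_X that W by (intro rate_sum_diff_bound) blast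
    define D where "D z = m (\<lambda>y. f (lift z y)) - \<kappa> * m (\<lambda>y. \<L> f (lift z y)) - f (lift z x0)" for z
    have good_D: "\<bar>D z\<bar> \<le> 2 * \<epsilon> * K" if z: "z \<in> V" and good: "good W z" for z
    proof -
      let ?F = "\<lambda>y. f (lift z y)"
      let ?d = "\<lambda>v. \<Sum>y\<in>confs. (P v y - \<zeta> y) * ?F y"
      have d: "?d v = m (local_mean weight (flips v) ?F) - m ?F" if "v \<in> V" for v
        using m_P[OF that] by (simp add: m_def left_diff_distrib sum_subtractf)
      have "m (\<lambda>y. \<L> f (lift z y)) = m (\<lambda>y. \<Sum>\<gamma>\<in>W. R \<gamma> f (lift z y) - f (lift z y))"
        unfolding m_def using generator_local[OF f W lift_in_X[OF _ z]] by (intro sum.cong) auto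
      also have "\<dots> = (\<Sum>\<gamma>\<in>W. m (\<lambda>y. R \<gamma> f (lift z y)) - m ?F)"
        unfolding m_def sum_distrib_left sum_subtractf[symmetric]
        by (subst sum.swap) (simp add: right_diff_distrib)
      also have "\<dots> = (\<Sum>\<gamma>\<in>W. ?d (act \<gamma> z))"
      proof (intro sum.cong refl)
        fix \<gamma> assume \<gamma>: "\<gamma> \<in> W"
        have "m (\<lambda>y. R \<gamma> f (lift z y)) = m (local_mean weight (flips (act \<gamma> z)) ?F)"
          unfolding m_def using resample_lift[OF W(2) f good z \<gamma>] by (intro sum.cong) auto
        then show "m (\<lambda>y. R \<gamma> f (lift z y)) - m ?F = ?d (act \<gamma> z)"
          using d[OF act_closed[OF _ z, of \<gamma>]] W(2) \<gamma> by auto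
      qed
      \<comment> \<open>At a good point, distinct sites of \<open>W\<close> sit at distinct points
        of \<open>V\<close>. As the other points do not affect the lift on \<open>W\<close>, the
        local generator becomes the full drift on \<open>V\<close>, to which the resolvent equation
        applies.\<close>
      also have "\<dots> = (\<Sum>v\<in>(\<lambda>\<gamma>. act \<gamma> z) ` W. ?d v)"
        by (subst sum.reindex) (use good in \<open>auto simp: good_def inj_on_Un\<close>)
      also have "\<dots> = (\<Sum>v\<in>V. ?d v)"
      proof (rule sum.mono_neutral_left[OF finite_V])
        show "(\<lambda>\<gamma>. act \<gamma> z) ` W \<subseteq> V" using act_closed[OF _ z] W(2) by blast
        show "\<forall>v\<in>V - (\<lambda>\<gamma>. act \<gamma> z) ` W. ?d v = 0"
        proof
          fix v assume v: "v \<in> V - (\<lambda>\<gamma>. act \<gamma> z) ` W"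
          have "m (local_mean weight (flips v) ?F) = m ?F"
            unfolding m_def using flips_irrelevant[OF W(2) f z v] by (intro sum.cong) auto
          then show "?d v = 0" using d v by simp
        qed
      qed
      finally have "\<kappa> * m (\<lambda>y. \<L> f (lift z y)) = (\<Sum>y\<in>confs. \<kappa> * (\<Sum>v\<in>V. P v y - \<zeta> y) * ?F y)"
        by (subst (asm) sum.swap) (simp add: sum_distrib_left sum_distrib_right mult_ac)
      also have "\<dots> = (\<Sum>y\<in>confs. (\<zeta> y - \<zeta>0 y) * ?F y)"
      proof (intro sum.cong refl)
        fix y assume "y \<in> confs"
        then have "\<kappa> * (\<Sum>v\<in>V. P v y - \<zeta> y) = \<zeta> y - \<zeta>0 y" using \<zeta>(3)[of y] unfolding P_def by linarith
        then show "\<kappa> * (\<Sum>v\<in>V. P v y - \<zeta> y) * ?F y = (\<zeta> y - \<zeta>0 y) * ?F y" by simp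
      qed
      finally have "D z = (\<Sum>y\<in>confs. \<zeta>0 y * ?F y) - ?F x0"
        by (simp add: D_def m_def left_diff_distrib sum_subtractf)
      also have "\<dots> = \<epsilon> * ((\<Sum>y\<in>confs. ?F y) / card confs - ?F x0)"
        unfolding \<zeta>0_int by (simp add: algebra_simps)
      finally have D_eq: "D z = \<epsilon> * ((\<Sum>y\<in>confs. ?F y) / card confs - ?F x0)" .
      have "\<bar>D z\<bar> \<le> \<epsilon> * (2 * K)"
      proof -
        have "\<bar>\<Sum>y\<in>confs. ?F y\<bar> \<le> (\<Sum>y\<in>confs. K)" using fK z by (intro order_trans[OF sum_abs] sum_mono) auto
        then have "\<bar>(\<Sum>y\<in>confs. ?F y) / card confs\<bar> \<le> K" using M by (simp add: field_simps)
        then have "\<bar>(\<Sum>y\<in>confs. ?F y) / card confs - ?F x0\<bar> \<le> 2 * K" using fK[OF z x0] by linarith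
        then show ?thesis unfolding D_eq using \<epsilon> by (simp add: abs_mult)
      qed
      then show ?thesis by simp
    qed
    \<comment> \<open>At a bad point nothing cancels: two terms of size \<open>K\<close>, and
      \<open>\<kappa>\<close> times \<open>card W\<close> differences of size
      \<open>2 * K\<close>.\<close>
    have bad_D: "\<bar>D z\<bar> \<le> K * (2 + 2 * \<kappa> * card W)" if z: "z \<in> V" for z
    proof -
      have "\<bar>\<L> f (lift z y)\<bar> \<le> (\<Sum>\<gamma>\<in>W. 2 * K)" if y: "y \<in> confs" for y
        unfolding generator_local[OF f W lift_in_X[OF y z]]
      proof (intro order_trans[OF sum_abs] sum_mono)
        fix \<gamma> assume "\<gamma> \<in> W"
        then show "\<bar>R \<gamma> f (lift z y) - f (lift z y)\<bar> \<le> 2 * K" using RK[OF z y] fK[OF z y] by fastforce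
      qed
      then have "\<bar>m (\<lambda>y. \<L> f (lift z y))\<bar> \<le> (\<Sum>\<gamma>\<in>W. 2 * K)" by (rule m_bound)
      then have "\<kappa> * \<bar>m (\<lambda>y. \<L> f (lift z y))\<bar> \<le> \<kappa> * (card W * (2 * K))" using \<kappa> by simp
      moreover have "\<bar>\<kappa> * m (\<lambda>y. \<L> f (lift z y))\<bar> = \<kappa> * \<bar>m (\<lambda>y. \<L> f (lift z y))\<bar>" using \<kappa> by (simp add: abs_mult)
      moreover have "\<bar>m (\<lambda>y. f (lift z y))\<bar> \<le> K" using fK[OF z] by (rule m_bound)
      ultimately have "\<bar>D z\<bar> \<le> K + \<kappa> * (card W * (2 * K)) + K"
        using fK[OF z x0] unfolding D_def by linarith
      then show ?thesis by (simp add: algebra_simps)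
    qed
    have "L f - \<kappa> * L (\<L> f) - (\<Sum>z\<in>V. f (lift z x0)) / card V = (\<Sum>z\<in>V. D z) / card V"
      unfolding L_def D_def N_def
      by (simp add: sum_subtractf sum_distrib_left diff_divide_distrib)
    moreover have "\<bar>(\<Sum>z\<in>V. D z) / card V\<bar> \<le> (\<Sum>z\<in>V. \<bar>D z\<bar>) / card V"
      by (simp add: divide_right_mono)
    moreover have "(\<Sum>z\<in>V. \<bar>D z\<bar>) / card V
        \<le> (\<Sum>z\<in>V. 2 * \<epsilon> * K) / card V + K * (2 + 2 * \<kappa> * card W) * bad_fraction W"
      using good_D bad_D \<epsilon> K0 by (intro sum_le_good_bad) auto
    moreover have "(\<Sum>z\<in>V. 2 * \<epsilon> * K) / card V = 2 * \<epsilon> * K" using N by (simp add: N_def)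
    ultimately show "\<bar>L f - \<kappa> * L (\<L> f) - (\<Sum>z\<in>V. f (lift z x0)) / card V\<bar>
      \<le> K * (2 * \<epsilon> + (2 + 2 * \<kappa> * card W) * bad_fraction W)"
      by (simp add: algebra_simps)

    fix \<gamma> assume \<gamma>: "\<gamma> \<in> W"
    then have \<gamma>G: "\<gamma> \<in> carrier G" using W by blast
    define D' where "D' z = m (\<lambda>y. f (lift z y)) - m (\<lambda>y. R \<gamma> f (lift z y))" for z
    have good_D': "\<bar>D' z\<bar> \<le> K * n (act \<gamma> z)" if z: "z \<in> V" and good: "good W z" for z
    proof -
      let ?F = "\<lambda>y. f (lift z y)"
      have "m (\<lambda>y. R \<gamma> f (lift z y)) = m (local_mean weight (flips (act \<gamma> z)) ?F)"
        unfolding m_def using resample_lift[OF W(2) f good z \<gamma>] by (intro sum.cong) auto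
      then have D'_eq: "D' z = (\<Sum>y\<in>confs. (\<zeta> y - P (act \<gamma> z) y) * ?F y)"
        using m_P[OF act_closed[OF \<gamma>G z]] by (simp add: D'_def m_def left_diff_distrib sum_subtractf)
      have "\<bar>D' z\<bar> \<le> (\<Sum>y\<in>confs. \<bar>\<zeta> y - P (act \<gamma> z) y\<bar> * K)"
        unfolding D'_eq using fK[OF z]
        by (intro order_trans[OF sum_abs] sum_mono) (simp add: abs_mult mult_left_mono)
      then show ?thesis unfolding n_def sum_distrib_left by (simp only: mult.commute)
    qed
    have bad_D': "\<bar>D' z\<bar> \<le> 2 * K" if z: "z \<in> V" for z
    proof -
      have "\<bar>m (\<lambda>y. f (lift z y))\<bar> \<le> K" "\<bar>m (\<lambda>y. R \<gamma> f (lift z y))\<bar> \<le> K"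
        using fK[OF z] RK[OF z _ \<gamma>] by (auto intro!: m_bound)
      then show ?thesis unfolding D'_def by linarith
    qed
    have "L f - L (R \<gamma> f) = (\<Sum>z\<in>V. D' z) / card V"
      unfolding L_def D'_def N_def by (simp add: sum_subtractf diff_divide_distrib)
    moreover have "\<bar>(\<Sum>z\<in>V. D' z) / card V\<bar> \<le> (\<Sum>z\<in>V. \<bar>D' z\<bar>) / card V"
      by (simp add: divide_right_mono)
    moreover have "(\<Sum>z\<in>V. \<bar>D' z\<bar>) / card V \<le> (\<Sum>z\<in>V. K * n (act \<gamma> z)) / card V + 2 * K * bad_fraction W"
      using good_D' bad_D' K0 n_nonneg by (intro sum_le_good_bad) auto
    moreover have "(\<Sum>z\<in>V. K * n (act \<gamma> z)) / card V \<le> K * sqrt (2 * dissipation_bound / \<kappa>)"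
    proof -
      \<comment> \<open>Since \<open>act \<gamma>\<close> permutes \<open>V\<close>, uniform
        averaging over \<open>z\<close> turns the bound for the sum over all sites into one at the
        single site \<open>\<gamma>\<close>.\<close>
      have "(\<Sum>z\<in>V. n (act \<gamma> z)) = (\<Sum>v\<in>V. n v)"
        by (rule sum.reindex_bij_betw[OF bij_betw_act[OF \<gamma>G]])
      then have "(\<Sum>z\<in>V. K * n (act \<gamma> z)) \<le> K * (N * sqrt (2 * dissipation_bound / \<kappa>))"
        using n_sum K0 by (simp add: mult_left_mono flip: sum_distrib_left)
      then show ?thesis using N by (simp add: N_def field_simps)
    qed
    ultimately show "\<bar>L f - L (R \<gamma> f)\<bar> \<le> K * (sqrt (2 * dissipation_bound / \<kappa>) + 2 * bad_fraction W)"
      by (simp add: algebra_simps)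
  qed
qed

end

section \<open>Measures on the configuration space\<close>

lemma space_borel_on: "space (borel_on X) = topspace X"
  unfolding borel_on_def by (rule space_measure_of) (auto dest: openin_subset)

lemma sets_borel_on: "sets (borel_on X) = sigma_sets (topspace X) {U. openin X U}"
  unfolding borel_on_def by (rule sets_measure_of) (auto dest: openin_subset)

lemma space_Prob: "\<mu> \<in> Prob X \<Longrightarrow> space \<mu> = topspace X"
  using sets_eq_imp_space_eq[of \<mu> "borel_on X"] by (simp add: Prob_def space_borel_on)

lemma prob_space_Prob: "\<mu> \<in> Prob X \<Longrightarrow> prob_space \<mu>"
  by (simp add: Prob_def)

lemma sets_Prob: "\<mu> \<in> Prob X \<Longrightarrow> sets \<mu> = sets (borel_on X)"
  by (simp add: Prob_def)

lemma openin_sets_Prob: "\<mu> \<in> Prob X \<Longrightarrow> openin X U \<Longrightarrow> U \<in> sets \<mu>"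
  using sets_Prob[of \<mu> X] sigma_sets.Basic[of U "{U. openin X U}" "topspace X"]
  unfolding sets_borel_on by blast

lemma C_measurable:
  assumes \<mu>: "\<mu> \<in> Prob X" and f: "f \<in> C X"
  shows "f \<in> borel_measurable \<mu>"
proof (rule borel_measurableI)
  fix S :: "real set" assume "open S"
  then have "openin X {x \<in> topspace X. f x \<in> S}"
    using f unfolding C_def by (intro openin_continuous_map_preimage) auto
  then show "f -` S \<inter> space \<mu> \<in> sets \<mu>"
    using openin_sets_Prob[OF \<mu>] by (simp add: space_Prob[OF \<mu>] vimage_def Int_def conj_commute)
qed

lemma C_integrable:
  assumes "compact_space X" and \<mu>: "\<mu> \<in> Prob X" and f: "f \<in> C X"
  shows "integrable \<mu> f"
proof -
  interpret prob_space \<mu> using \<mu> by (rule prob_space_Prob)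
  obtain B where "\<And>x. x \<in> topspace X \<Longrightarrow> \<bar>f x\<bar> \<le> B" by (rule C_bounded[OF assms(1) f]) (rule that)
  then show ?thesis
    using C_measurable[OF \<mu> f] space_Prob[OF \<mu>] by (intro integrable_const_bound[of _ B]) auto
qed

lemma state_integral:
  assumes "compact_space X" and \<mu>: "\<mu> \<in> Prob X"
  shows "state X (\<lambda>f. \<integral>x. f x \<partial>\<mu>)"
proof -
  interpret prob_space \<mu> using \<mu> by (rule prob_space_Prob)
  have "prob (topspace X) = 1" using prob_space by (simp add: space_Prob[OF \<mu>])
  then show ?thesis
    unfolding state_def using C_integrable[OF assms] space_Prob[OF \<mu>]
    by (auto intro!: Bochner_Integration.integral_nonneg_AE AE_I2)
qed

lemma weak_closure_approximation:
  assumes \<mu>: "\<mu> \<in> weak_topology X closure_of M" and F: "finite F" "F \<subseteq> C X" and \<epsilon>: "\<epsilon> > 0"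
  obtains \<nu> where "\<nu> \<in> M" "\<And>f. f \<in> F \<Longrightarrow> \<bar>(\<integral>x. f x \<partial>\<nu>) - (\<integral>x. f x \<partial>\<mu>)\<bar> < \<epsilon>"
proof -
  let ?W = "weak_topology X"
  let ?U = "\<lambda>f. {\<nu> \<in> Prob X. (\<integral>x. f x \<partial>\<nu>) \<in> ball (\<integral>x. f x \<partial>\<mu>) \<epsilon>}"
  have \<mu>W: "\<mu> \<in> topspace ?W" using \<mu> by (simp add: in_closure_of)
  have "topspace ?W \<subseteq> Prob X" unfolding weak_topology_def topology_generated_by_topspace by auto
  with \<mu>W have \<mu>P: "\<mu> \<in> Prob X" by blast
  have op: "openin ?W (?U f)" if "f \<in> F" for f
    unfolding weak_topology_def by (rule topology_generated_by_Basis) (use that F in blast)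
  have "openin ?W ((\<Inter>f\<in>F. ?U f) \<inter> topspace ?W)"
    using F(1) op by (rule openin_INT)
  moreover have "\<mu> \<in> (\<Inter>f\<in>F. ?U f) \<inter> topspace ?W" using \<mu>W \<mu>P \<epsilon> by simp
  ultimately obtain \<nu> where "\<nu> \<in> M" "\<nu> \<in> (\<Inter>f\<in>F. ?U f) \<inter> topspace ?W"
    using \<mu> unfolding in_closure_of by blast
  then show thesis by (intro that[of \<nu>]) (auto simp: dist_real_def abs_minus_commute)
qed

lemma openin_coordinate:
  "\<delta> \<in> carrier G \<Longrightarrow> a \<in> A \<Longrightarrow> openin (config_top G A) {x \<in> topspace (config_top G A). x \<delta> = a}"
  unfolding config_top_def
  using openin_continuous_map_preimage[OF continuous_map_product_projection[of \<delta> "carrier G" "\<lambda>_. discrete_topology A"],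
      of "{a}"] by simp

lemma countable_cyl:
  assumes "countable (carrier G)" "finite A"
  shows "countable {cyl G A W x | W x. finite W \<and> W \<subseteq> carrier G \<and> x \<in> topspace (config_top G A)}"
proof (rule countable_subset)
  let ?I = "Sigma {W. finite W \<and> W \<subseteq> carrier G} (\<lambda>W. W \<rightarrow>\<^sub>E A)"
  show "countable ((\<lambda>(W, p). cyl G A W p) ` ?I)"
  proof (intro countable_image countable_SIGMA)
    show "countable {W. finite W \<and> W \<subseteq> carrier G}"
      using assms(1) by (rule countable_Collect_finite_subset)
    show "countable (W \<rightarrow>\<^sub>E A)" if "W \<in> {W. finite W \<and> W \<subseteq> carrier G}" for W
      using that assms(2) by (intro countable_finite finite_PiE) auto
  qed
  show "{cyl G A W x | W x. finite W \<and> W \<subseteq> carrier G \<and> x \<in> topspace (config_top G A)}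
      \<subseteq> (\<lambda>(W, p). cyl G A W p) ` ?I"
  proof
    fix U assume "U \<in> {cyl G A W x | W x. finite W \<and> W \<subseteq> carrier G \<and> x \<in> topspace (config_top G A)}"
    then obtain W x where W: "U = cyl G A W x" "finite W" "W \<subseteq> carrier G" "x \<in> topspace (config_top G A)"
      by blast
    have "U = cyl G A W (restrict x W)" unfolding W(1) cyl_def by auto
    moreover have "restrict x W \<in> W \<rightarrow>\<^sub>E A" using W(3,4) by (auto simp: topspace_config_top)
    ultimately show "U \<in> (\<lambda>(W, p). cyl G A W p) ` ?I" using W(2,3) by force
  qed
qed

text \<open>There are only countably many cylinders, so no uncountable union is needed. It is this
  that makes measurability testable on single coordinates in
  \<open>measurable_config_top\<close>.\<close>

lemma openin_config_top_countable_union: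
  assumes "countable (carrier G)" "finite A" "openin (config_top G A) U"
  obtains \<C> where "countable \<C>" "U = \<Union>\<C>"
    "\<C> \<subseteq> {cyl G A W x | W x. finite W \<and> W \<subseteq> carrier G \<and> x \<in> topspace (config_top G A)}"
proof
  let ?\<C> = "{cyl G A W x | W x. finite W \<and> W \<subseteq> carrier G \<and> x \<in> topspace (config_top G A)}"
  show "countable {D \<in> ?\<C>. D \<subseteq> U}"
    by (rule countable_subset[OF _ countable_cyl[OF assms(1,2)]]) blast
  show "{D \<in> ?\<C>. D \<subseteq> U} \<subseteq> ?\<C>" by blast
  show "U = \<Union>{D \<in> ?\<C>. D \<subseteq> U}"
  proof (intro equalityI subsetI)
    fix x assume x: "x \<in> U"
    obtain W where W: "finite W" "W \<subseteq> carrier G" "cyl G A W x \<subseteq> U"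
      by (rule openin_config_top_contains_cyl[OF assms(3) x]) (rule that)
    have "x \<in> topspace (config_top G A)" using x openin_subset[OF assms(3)] by blast
    moreover from this have "x \<in> cyl G A W x" by (simp add: cyl_def)
    ultimately show "x \<in> \<Union>{D \<in> ?\<C>. D \<subseteq> U}" using W by blast
  qed blast
qed

lemma measurable_config_top:
  assumes "countable (carrier G)" "finite A"
    and f: "\<And>m. m \<in> space M \<Longrightarrow> f m \<in> topspace (config_top G A)"
    and coord: "\<And>\<delta> a. \<delta> \<in> carrier G \<Longrightarrow> a \<in> A \<Longrightarrow> {m \<in> space M. f m \<delta> = a} \<in> sets M"
  shows "f \<in> measurable M (borel_on (config_top G A))"
  unfolding borel_on_def
proof (rule measurable_measure_of)
  fix U assume "U \<in> {U. openin (config_top G A) U}"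
  then obtain \<C> where \<C>: "countable \<C>" "U = \<Union>\<C>"
    "\<C> \<subseteq> {cyl G A W x | W x. finite W \<and> W \<subseteq> carrier G \<and> x \<in> topspace (config_top G A)}"
    using openin_config_top_countable_union[OF assms(1,2)] by blast
  have "f -` D \<inter> space M \<in> sets M" if D: "D \<in> \<C>" for D
  proof -
    obtain W x where W: "D = cyl G A W x" "finite W" "W \<subseteq> carrier G" "x \<in> topspace (config_top G A)"
      using \<C>(3) D by blast
    have "f -` D \<inter> space M = {m \<in> space M. \<forall>\<delta>\<in>W. f m \<delta> = x \<delta>}" using f W(1) by (auto simp: cyl_def)
    also have "\<dots> \<in> sets M"
      using W(2-4) coord by (intro sets.sets_Collect_finite_All) (auto simp: topspace_config_top)
    finally show ?thesis .
  qed
  then have "(\<Union>D\<in>\<C>. f -` D \<inter> space M) \<in> sets M" using \<C>(1) by (intro sets.countable_UN') auto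
  moreover have "f -` U \<inter> space M = (\<Union>D\<in>\<C>. f -` D \<inter> space M)" using \<C>(2) by auto
  ultimately show "f -` U \<inter> space M \<in> sets M" by simp
qed (use f in \<open>auto dest: openin_subset\<close>)

section \<open>The shift action, random labels and periodic measures\<close>

lemma (in group) shift_in_topspace:
  assumes "\<beta> \<in> carrier G" "x \<in> topspace (config_top G A)"
  shows "shift G \<beta> x \<in> topspace (config_top G A)"
proof -
  have "x (\<gamma> \<otimes> \<beta>) \<in> A" if "\<gamma> \<in> carrier G" for \<gamma>
    using assms(2) m_closed[OF that assms(1)] unfolding topspace_config_top by (rule PiE_mem)
  then show ?thesis unfolding topspace_config_top shift_def restrict_PiE_iff by blast
qed

lemma (in group) shift_shift:
  assumes "\<beta> \<in> carrier G" "\<gamma> \<in> carrier G"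
  shows "shift G (\<gamma> \<otimes> \<beta>) x = shift G \<gamma> (shift G \<beta> x)"
proof
  fix \<delta>
  show "shift G (\<gamma> \<otimes> \<beta>) x \<delta> = shift G \<gamma> (shift G \<beta> x) \<delta>"
    using assms m_assoc[of \<delta> \<gamma> \<beta>] by (cases "\<delta> \<in> carrier G") (simp_all add: shift_def)
qed

lemma (in group) shift_one:
  assumes "x \<in> topspace (config_top G A)"
  shows "shift G \<one> x = x"
proof
  fix \<gamma>
  show "shift G \<one> x \<gamma> = x \<gamma>"
    using PiE_arb[of x "carrier G" "\<lambda>_. A" \<gamma>] assms
    by (cases "\<gamma> \<in> carrier G") (simp_all add: shift_def topspace_config_top)
qed

lemma (in group) continuous_map_shift:
  assumes "\<beta> \<in> carrier G"
  shows "continuous_map (config_top G A) (config_top G A) (shift G \<beta>)"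
proof -
  have "continuous_map (config_top G A) (discrete_topology A) (\<lambda>x. shift G \<beta> x \<gamma>)" if "\<gamma> \<in> carrier G" for \<gamma>
    using assms that continuous_map_product_projection[of "\<gamma> \<otimes> \<beta>" "carrier G" "\<lambda>_. discrete_topology A"]
    by (simp add: shift_def config_top_def)
  then have "continuous_map (config_top G A) (product_topology (\<lambda>_. discrete_topology A) (carrier G)) (shift G \<beta>)"
    by (subst continuous_map_componentwise) (auto simp: shift_def)
  then show ?thesis by (simp add: config_top_def)
qed

text \<open>\<open>\<nu>\<close> is \<open>\<mu>\<close> with an independent uniform label below \<open>M\<close> attached to each site. As distinct
  sites rarely carry the same label, its periodic approximations are nearly free.\<close>

lemma (in group) labelled_measure:
  fixes A :: "'c set" and M :: nat
  assumes G: "countable (carrier G)" and A: "finite A" and M: "M > 0"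
    and \<mu>: "\<mu> \<in> shift_invariant_Prob G A"
  obtains B :: "nat set" and dec :: "nat \<Rightarrow> 'c" and lab :: "nat \<Rightarrow> nat" and \<nu> where
    "finite B" "\<And>b. b \<in> B \<Longrightarrow> dec b \<in> A" "\<nu> \<in> shift_invariant_Prob G B"
    "\<And>f. f \<in> C (config_top G A) \<Longrightarrow> (\<integral>z. f (\<lambda>\<gamma>\<in>carrier G. dec (z \<gamma>)) \<partial>\<nu>) = (\<integral>x. f x \<partial>\<mu>)"
    "\<And>\<gamma> \<gamma>'. \<gamma> \<in> carrier G \<Longrightarrow> \<gamma>' \<in> carrier G \<Longrightarrow> \<gamma> \<noteq> \<gamma>' \<Longrightarrow>
      measure \<nu> {z \<in> space \<nu>. lab (z \<gamma>) = lab (z \<gamma>')} = 1 / M"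
proof -
  obtain e :: "'c \<Rightarrow> nat" where e: "inj_on e A"
    using finite_imp_inj_to_nat_seg[OF A] by blast
  \<comment> \<open>\<open>property_PA\<close> speaks of alphabets of natural numbers, so spin and
    label are packed into one number.\<close>
  define code where "code = (\<lambda>(a, k). prod_encode (e a, k))"
  define dec where "dec n = the_inv_into A e (fst (prod_decode n))" for n
  define lab where "lab n = snd (prod_decode n)" for n
  define B where "B = code ` (A \<times> {..<M})"
  have dec: "dec (code (a, k)) = a" if "a \<in> A" for a k
    using that e by (simp add: dec_def code_def the_inv_into_f_f)
  have lab: "lab (code (a, k)) = k" for a k by (simp add: lab_def code_def)
  have B: "finite B" using A by (simp add: B_def)
  have dec_B: "dec b \<in> A" if "b \<in> B" for b using that dec by (auto simp: B_def)
  let ?T = "config_top G A" and ?TB = "config_top G B"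
  have \<mu>P: "\<mu> \<in> Prob ?T" and \<mu>_inv: "\<And>\<beta>. \<beta> \<in> carrier G \<Longrightarrow> distr \<mu> \<mu> (shift G \<beta>) = \<mu>"
    using \<mu> by (auto simp: shift_invariant_Prob_def)
  interpret \<mu>: prob_space \<mu> using \<mu>P by (rule prob_space_Prob)
  define U where "U = uniform_count_measure {..<M}"
  have U: "prob_space U" "space U = {..<M}" "sets U = Pow {..<M}"
    using M by (auto simp: U_def space_uniform_count_measure sets_uniform_count_measure
        intro!: prob_space_uniform_count_measure)
  define N where "N = (\<Pi>\<^sub>M \<gamma>\<in>carrier G. U)"
  interpret N: product_prob_space "\<lambda>_. U" "carrier G"
    using U(1) by (intro product_prob_spaceI)
  have N: "prob_space N" unfolding N_def using U(1) by (rule prob_space_PiM)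
  interpret N': prob_space N by (rule N)
  have space_N: "space N = carrier G \<rightarrow>\<^sub>E {..<M}" by (simp add: N_def space_PiM U)
  have coord_N: "{u \<in> space N. u \<gamma> = k} \<in> sets N" if "\<gamma> \<in> carrier G" for \<gamma> k
  proof -
    have "(\<lambda>u. u \<gamma>) -` ({k} \<inter> {..<M}) \<inter> space N \<in> sets N"
      unfolding N_def by (rule measurable_sets[OF measurable_component_singleton[OF that]]) (auto simp: U)
    also have "(\<lambda>u. u \<gamma>) -` ({k} \<inter> {..<M}) \<inter> space N = {u \<in> space N. u \<gamma> = k}"
      using that by (auto simp: space_N)
    finally show ?thesis .
  qed
  have coord_\<mu>: "{x \<in> space \<mu>. x \<gamma> = a} \<in> sets \<mu>" if "\<gamma> \<in> carrier G" "a \<in> A" for \<gamma> a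
    using openin_sets_Prob[OF \<mu>P openin_coordinate[OF that]] by (simp add: space_Prob[OF \<mu>P])
  interpret pair: pair_prob_space \<mu> N ..
  define enc where "enc = (\<lambda>(x, u). \<lambda>\<gamma>\<in>carrier G. code (x \<gamma>, u \<gamma>))"
  have xA: "x \<gamma> \<in> A" if "x \<in> space \<mu>" "\<gamma> \<in> carrier G" for x \<gamma>
    using that by (auto simp: space_Prob[OF \<mu>P] topspace_config_top)
  have enc_space: "enc m \<in> topspace ?TB" if m: "m \<in> space (\<mu> \<Otimes>\<^sub>M N)" for m
    using m xA by (auto simp: enc_def topspace_config_top B_def space_pair_measure space_N)
  have enc: "enc \<in> measurable (\<mu> \<Otimes>\<^sub>M N) (borel_on ?TB)"
  proof (rule measurable_config_top[OF G B enc_space])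
    fix \<gamma> b assume \<gamma>: "\<gamma> \<in> carrier G" and "b \<in> B"
    then obtain a k where b: "b = code (a, k)" "a \<in> A" "k < M" by (auto simp: B_def)
    have "{m \<in> space (\<mu> \<Otimes>\<^sub>M N). enc m \<gamma> = b} = {x \<in> space \<mu>. x \<gamma> = a} \<times> {u \<in> space N. u \<gamma> = k}"
    proof -
      have "code (x \<gamma>, u \<gamma>) = code (a, k) \<longleftrightarrow> x \<gamma> = a \<and> u \<gamma> = k" if "x \<in> space \<mu>" for x u
        using dec[OF b(2)] dec[OF xA[OF that \<gamma>]] lab by metis
      then show ?thesis using \<gamma> by (auto simp: enc_def b(1) space_pair_measure)
    qed
    also have "\<dots> \<in> sets (\<mu> \<Otimes>\<^sub>M N)" using coord_\<mu>[OF \<gamma> b(2)] coord_N[OF \<gamma>] by (rule pair_measureI)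
    finally show "{m \<in> space (\<mu> \<Otimes>\<^sub>M N). enc m \<gamma> = b} \<in> sets (\<mu> \<Otimes>\<^sub>M N)" .
  qed auto
  define \<nu> where "\<nu> = distr (\<mu> \<Otimes>\<^sub>M N) (borel_on ?TB) enc"
  have sets_\<nu>: "sets \<nu> = sets (borel_on ?TB)" by (simp add: \<nu>_def)
  have \<nu>P: "\<nu> \<in> Prob ?TB"
    using pair.prob_space_distr[OF enc] by (simp add: Prob_def \<nu>_def)

  have \<nu>_inv: "distr \<nu> \<nu> (shift G \<beta>) = \<nu>" if \<beta>: "\<beta> \<in> carrier G" for \<beta>
  proof -
    have shift_B: "shift G \<beta> \<in> measurable (borel_on ?TB) (borel_on ?TB)"
    proof (rule measurable_config_top[OF G B])
      show "shift G \<beta> z \<in> topspace ?TB" if "z \<in> space (borel_on ?TB)" for z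
        using shift_in_topspace[OF \<beta>] that by (simp add: space_borel_on)
      fix \<delta> b assume "\<delta> \<in> carrier G" "b \<in> B"
      then have "openin ?TB {z \<in> topspace ?TB. z (\<delta> \<otimes> \<beta>) = b}" using \<beta> by (intro openin_coordinate) auto
      then show "{z \<in> space (borel_on ?TB). shift G \<beta> z \<delta> = b} \<in> sets (borel_on ?TB)"
        using \<open>\<delta> \<in> carrier G\<close> by (simp add: shift_def space_borel_on sets_borel_on sigma_sets.Basic)
    qed
    have shift_\<mu>: "shift G \<beta> \<in> measurable \<mu> \<mu>"
    proof -
      have "shift G \<beta> \<in> measurable \<mu> (borel_on ?T)"
      proof (rule measurable_config_top[OF G A])
        show "shift G \<beta> x \<in> topspace ?T" if "x \<in> space \<mu>" for x
          using shift_in_topspace[OF \<beta>] that by (simp add: space_Prob[OF \<mu>P])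
        fix \<delta> a assume "\<delta> \<in> carrier G" "a \<in> A"
        then show "{x \<in> space \<mu>. shift G \<beta> x \<delta> = a} \<in> sets \<mu>"
          using coord_\<mu>[of "\<delta> \<otimes> \<beta>" a] \<beta> by (simp add: shift_def)
      qed
      then show ?thesis using measurable_cong_sets[OF refl sets_Prob[OF \<mu>P], of \<mu>] by simp
    qed
    have shift_N: "shift G \<beta> \<in> measurable N N"
      unfolding N_def shift_def using \<beta>
      by (intro measurable_restrict measurable_component_singleton) auto
    \<comment> \<open>Right translation permutes the coordinates of an independent, identically
      distributed product.\<close>
    have N_inv: "distr N N (shift G \<beta>) = N"
      unfolding N_def shift_def using \<beta> U(1)
      by (intro distr_PiM_reindex[where f = "\<lambda>\<gamma>. \<gamma> \<otimes> \<beta>"]) (auto simp: inj_on_def)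
    have pair_inv: "distr (\<mu> \<Otimes>\<^sub>M N) (\<mu> \<Otimes>\<^sub>M N) (\<lambda>(x, u). (shift G \<beta> x, shift G \<beta> u)) = \<mu> \<Otimes>\<^sub>M N"
      using pair_measure_distr[OF shift_\<mu> shift_N] N'.sigma_finite_measure_axioms
      by (simp add: N_inv \<mu>_inv[OF \<beta>])
    have pair_meas: "(\<lambda>(x, u). (shift G \<beta> x, shift G \<beta> u)) \<in> measurable (\<mu> \<Otimes>\<^sub>M N) (\<mu> \<Otimes>\<^sub>M N)"
      using shift_\<mu> shift_N by measurable
    have "distr \<nu> \<nu> (shift G \<beta>) = distr \<nu> (borel_on ?TB) (shift G \<beta>)"
      by (rule distr_cong) (simp_all add: sets_\<nu>)
    also have "\<dots> = distr (\<mu> \<Otimes>\<^sub>M N) (borel_on ?TB) (shift G \<beta> \<circ> enc)"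
      unfolding \<nu>_def by (rule distr_distr[OF shift_B enc])
    \<comment> \<open>The encoding acts site by site and therefore commutes with the shift.\<close>
    also have "shift G \<beta> \<circ> enc = enc \<circ> (\<lambda>(x, u). (shift G \<beta> x, shift G \<beta> u))"
      using \<beta> by (auto simp: fun_eq_iff enc_def shift_def)
    also have "distr (\<mu> \<Otimes>\<^sub>M N) (borel_on ?TB) \<dots> = distr (distr (\<mu> \<Otimes>\<^sub>M N) (\<mu> \<Otimes>\<^sub>M N) (\<lambda>(x, u). (shift G \<beta> x, shift G \<beta> u))) (borel_on ?TB) enc"
      by (rule distr_distr[OF enc pair_meas, symmetric])
    also have "\<dots> = \<nu>" unfolding pair_inv \<nu>_def ..
    finally show ?thesis .
  qed
  have int_dec: "(\<integral>z. f (\<lambda>\<gamma>\<in>carrier G. dec (z \<gamma>)) \<partial>\<nu>) = (\<integral>x. f x \<partial>\<mu>)" if f: "f \<in> C ?T" for f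
  proof -
    let ?dec = "\<lambda>z. \<lambda>\<gamma>\<in>carrier G. dec (z \<gamma>)"
    have dec_meas: "?dec \<in> measurable \<nu> (borel_on ?T)"
    proof (rule measurable_config_top[OF G A])
      show "?dec z \<in> topspace ?T" if "z \<in> space \<nu>" for z
        using that dec_B by (auto simp: space_Prob[OF \<nu>P] topspace_config_top)
      fix \<delta> a assume \<delta>: "\<delta> \<in> carrier G" and "a \<in> A"
      have "{z \<in> space \<nu>. ?dec z \<delta> = a} = (\<Union>b\<in>{b\<in>B. dec b = a}. {z \<in> topspace ?TB. z \<delta> = b})"
        using \<delta> by (auto simp: space_Prob[OF \<nu>P] topspace_config_top)
      also have "\<dots> \<in> sets \<nu>"
        using B openin_sets_Prob[OF \<nu>P openin_coordinate[OF \<delta>]] by (intro sets.finite_UN) auto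
      finally show "{z \<in> space \<nu>. ?dec z \<delta> = a} \<in> sets \<nu>" .
    qed
    have "f \<in> borel_measurable (borel_on ?T)"
      using C_measurable[OF \<mu>P f] unfolding measurable_cong_sets[OF sets_Prob[OF \<mu>P] refl] .
    then have "(\<lambda>z. f (?dec z)) \<in> borel_measurable \<nu>" by (rule measurable_compose[OF dec_meas])
    then have fdec: "(\<lambda>z. f (?dec z)) \<in> borel_measurable (borel_on ?TB)"
      unfolding measurable_cong_sets[OF sets_\<nu> refl] .
    have "(\<integral>z. f (?dec z) \<partial>\<nu>) = (\<integral>m. f (?dec (enc m)) \<partial>(\<mu> \<Otimes>\<^sub>M N))"
      unfolding \<nu>_def by (rule integral_distr[OF enc fdec])
    also have "\<dots> = (\<integral>m. f (fst m) \<partial>(\<mu> \<Otimes>\<^sub>M N))"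
    proof (intro Bochner_Integration.integral_cong refl arg_cong[where f = f])
      fix m assume "m \<in> space (\<mu> \<Otimes>\<^sub>M N)"
      then obtain x u where m: "m = (x, u)" "x \<in> space \<mu>" by (auto simp: space_pair_measure)
      then have "x \<gamma> = undefined" if "\<gamma> \<notin> carrier G" for \<gamma>
        using that by (auto simp: space_Prob[OF \<mu>P] topspace_config_top PiE_def extensional_def)
      then show "?dec (enc m) = fst m" using m xA dec by (auto simp: enc_def fun_eq_iff)
    qed
    also have "\<dots> = (\<integral>x. f x \<partial>distr (\<mu> \<Otimes>\<^sub>M N) \<mu> fst)"
      by (rule integral_distr[OF measurable_fst C_measurable[OF \<mu>P f], symmetric])
    also have "\<dots> = (\<integral>x. f x \<partial>\<mu>)" by (simp add: N'.distr_pair_fst)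
    finally show ?thesis .
  qed
  have coll: "measure \<nu> {z \<in> space \<nu>. lab (z \<gamma>) = lab (z \<gamma>')} = 1 / M"
    if \<gamma>: "\<gamma> \<in> carrier G" and \<gamma>': "\<gamma>' \<in> carrier G" and ne: "\<gamma> \<noteq> \<gamma>'" for \<gamma> \<gamma>'
  proof -
    have \<nu>_sets: "{z \<in> space \<nu>. lab (z \<gamma>) = lab (z \<gamma>')} \<in> sets \<nu>"
    proof -
      have "{z \<in> space \<nu>. lab (z \<gamma>) = lab (z \<gamma>')}
          = (\<Union>(b, b')\<in>{(b, b'). b \<in> B \<and> b' \<in> B \<and> lab b = lab b'}.
              {z \<in> topspace ?TB. z \<gamma> = b} \<inter> {z \<in> topspace ?TB. z \<gamma>' = b'})"
        using \<gamma> \<gamma>' by (auto simp: space_Prob[OF \<nu>P] topspace_config_top)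
      also have "\<dots> \<in> sets \<nu>"
      proof (rule sets.finite_UN)
        show "finite {(b, b'). b \<in> B \<and> b' \<in> B \<and> lab b = lab b'}"
          by (rule finite_subset[of _ "B \<times> B"]) (use B in auto)
      qed (use \<gamma> \<gamma>' openin_sets_Prob[OF \<nu>P openin_coordinate] in auto)
      finally show ?thesis .
    qed
    have "measure \<nu> {z \<in> space \<nu>. lab (z \<gamma>) = lab (z \<gamma>')}
        = measure (\<mu> \<Otimes>\<^sub>M N) (enc -` {z \<in> space \<nu>. lab (z \<gamma>) = lab (z \<gamma>')} \<inter> space (\<mu> \<Otimes>\<^sub>M N))"
      using \<nu>_sets unfolding sets_\<nu> by (subst (1) \<nu>_def) (rule measure_distr[OF enc])
    also have "enc -` {z \<in> space \<nu>. lab (z \<gamma>) = lab (z \<gamma>')} \<inter> space (\<mu> \<Otimes>\<^sub>M N)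
        = space \<mu> \<times> {u \<in> space N. u \<gamma> = u \<gamma>'}"
      using enc_space \<gamma> \<gamma>' lab
      by (auto simp: space_Prob[OF \<nu>P] enc_def space_pair_measure)
    also have "{u \<in> space N. u \<gamma> = u \<gamma>'} = (\<Union>k\<in>{..<M}. {u \<in> space N. u \<gamma> = k} \<inter> {u \<in> space N. u \<gamma>' = k})"
      using \<gamma> \<gamma>' by (auto simp: space_N)
    also have "measure (\<mu> \<Otimes>\<^sub>M N) (space \<mu> \<times> \<dots>) = measure N \<dots>"
    proof -
      have "(\<Union>k\<in>{..<M}. {u \<in> space N. u \<gamma> = k} \<inter> {u \<in> space N. u \<gamma>' = k}) \<in> sets N"
        using coord_N[OF \<gamma>] coord_N[OF \<gamma>'] by (intro sets.finite_UN sets.Int) auto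
      then show ?thesis
        unfolding measure_def by (simp add: N'.emeasure_pair_measure_Times \<mu>.emeasure_space_1)
    qed
    also have "measure N (\<Union>k\<in>{..<M}. {u \<in> space N. u \<gamma> = k} \<inter> {u \<in> space N. u \<gamma>' = k})
        = (\<Sum>k<M. measure N ({u \<in> space N. u \<gamma> = k} \<inter> {u \<in> space N. u \<gamma>' = k}))"
      using coord_N[OF \<gamma>] coord_N[OF \<gamma>']
      by (intro N'.finite_measure_finite_Union) (auto simp: disjoint_family_on_def)
    \<comment> \<open>Labels at distinct sites are independent and uniform, so both equal
      \<open>k\<close> with probability \<open>1 / M\<close> squared.\<close>
    also have "\<dots> = (\<Sum>k<M. 1 / M * (1 / M))"
    proof (intro sum.cong refl)
      fix k assume "k \<in> {..<M}"
      then have k: "k < M" by simp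
      have "{u \<in> space N. u \<gamma> = k} \<inter> {u \<in> space N. u \<gamma>' = k}
          = prod_emb (carrier G) (\<lambda>_. U) {\<gamma>, \<gamma>'} (\<Pi>\<^sub>E i\<in>{\<gamma>, \<gamma>'}. {k})"
      proof -
        have mem: "restrict u {\<gamma>, \<gamma>'} \<in> (\<Pi>\<^sub>E i\<in>{\<gamma>, \<gamma>'}. {k}) \<longleftrightarrow> u \<gamma> = k \<and> u \<gamma>' = k" for u
          unfolding restrict_PiE_iff by simp
        show ?thesis
          unfolding prod_emb_def vimage_def mem space_N U(2) by blast
      qed
      moreover have "measure N (prod_emb (carrier G) (\<lambda>_. U) {\<gamma>, \<gamma>'} (\<Pi>\<^sub>E i\<in>{\<gamma>, \<gamma>'}. {k}))
          = (\<Prod>i\<in>{\<gamma>, \<gamma>'}. measure U {k})"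
        unfolding N_def using \<gamma> \<gamma>' k by (intro N.measure_PiM_emb) (auto simp: U)
      moreover have "measure U {k} = 1 / M"
        using k by (simp add: measure_def U_def emeasure_uniform_count_measure)
      ultimately show "measure N ({u \<in> space N. u \<gamma> = k} \<inter> {u \<in> space N. u \<gamma>' = k}) = 1 / M * (1 / M)"
        using ne by simp
    qed
    also have "\<dots> = 1 / M" using M by simp
    finally show ?thesis .
  qed
  show thesis
  proof (rule that[OF B dec_B _ int_dec coll])
    show "\<nu> \<in> shift_invariant_Prob G B" using \<nu>P \<nu>_inv by (simp add: shift_invariant_Prob_def)
  qed
qed

text \<open>The complement of the support is covered by null cylinders, of which there are countably
  many, so the measure is carried by its finite support and \<open>w\<close> lists its atoms.
  Support and atoms are shift-invariant because each shift is continuous and has a shift as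
  inverse.\<close>

lemma (in group) periodic_measure_weights:
  assumes G: "countable (carrier G)" and B: "finite B" and p: "p \<in> periodic_measures G B"
  obtains V w where "finite V" "V \<subseteq> topspace (config_top G B)"
    "\<And>\<beta> z. \<beta> \<in> carrier G \<Longrightarrow> z \<in> V \<Longrightarrow> shift G \<beta> z \<in> V"
    "\<And>\<beta> z. \<beta> \<in> carrier G \<Longrightarrow> z \<in> V \<Longrightarrow> w (shift G \<beta> z) = w z"
    "\<And>z. w z \<ge> 0" "sum w V = 1"
    "\<And>f. f \<in> C (config_top G B) \<Longrightarrow> (\<integral>z. f z \<partial>p) = (\<Sum>z\<in>V. w z * f z)"
proof -
  let ?T = "config_top G B"
  let ?V = "measure_support ?T p"
  have pP: "p \<in> Prob ?T" and inv: "\<And>\<beta>. \<beta> \<in> carrier G \<Longrightarrow> distr p p (shift G \<beta>) = p" and fin: "finite ?V"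
    using p by (auto simp: periodic_measures_def shift_invariant_Prob_def)
  interpret prob_space p using pP by (rule prob_space_Prob)
  have V_sub: "?V \<subseteq> topspace ?T" by (auto simp: measure_support_def)
  have haus: "Hausdorff_space ?T"
    by (simp add: config_top_def Hausdorff_space_product_topology)
  have sing: "{z} \<in> sets p" if "z \<in> topspace ?T" for z
  proof -
    have "closedin ?T {z}" using haus that by (simp add: closedin_Hausdorff_sing_eq)
    then have "openin ?T (topspace ?T - {z})" by (rule openin_diff[OF openin_topspace])
    then have "topspace ?T - {z} \<in> sets p" by (rule openin_sets_Prob[OF pP])
    then have "space p - (topspace ?T - {z}) \<in> sets p" by (rule sets.compl_sets)
    moreover have "space p - (topspace ?T - {z}) = {z}" using that space_Prob[OF pP] by auto
    ultimately show ?thesis by simp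
  qed
  have V_sets: "?V \<in> sets p"
  proof (rule sets.countable)
    show "{z} \<in> sets p" if "z \<in> ?V" for z using sing V_sub that by blast
    show "countable ?V" using fin by (rule countable_finite)
  qed
  have null: "AE z in p. z \<in> ?V"
  proof -
    let ?\<C> = "{cyl G B W x | W x. finite W \<and> W \<subseteq> carrier G \<and> x \<in> topspace ?T}"
    let ?\<N> = "{D \<in> ?\<C>. emeasure p D = 0}"
    have op: "openin ?T D" if "D \<in> ?\<C>" for D using that openin_cyl by blast
    have "(\<Union>D\<in>?\<N>. D) \<in> null_sets p"
    proof (rule null_sets_UN')
      show "countable ?\<N>" by (rule countable_subset[OF _ countable_cyl[OF G B]]) blast
      show "D \<in> null_sets p" if "D \<in> ?\<N>" for D
        using that op openin_sets_Prob[OF pP] by (intro null_setsI) auto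
    qed
    moreover have "{z \<in> space p. z \<notin> ?V} \<subseteq> (\<Union>D\<in>?\<N>. D)"
    proof
      fix z assume "z \<in> {z \<in> space p. z \<notin> ?V}"
      then have z: "z \<in> topspace ?T" "z \<notin> ?V" by (auto simp: space_Prob[OF pP])
      then obtain U where U: "openin ?T U" "z \<in> U" "emeasure p U = 0"
        by (auto simp: measure_support_def)
      obtain W where W: "finite W" "W \<subseteq> carrier G" "cyl G B W z \<subseteq> U"
        by (rule openin_config_top_contains_cyl[OF U(1,2)]) (rule that)
      have "emeasure p (cyl G B W z) \<le> emeasure p U"
        using W(3) openin_sets_Prob[OF pP U(1)] by (rule emeasure_mono)
      then have "cyl G B W z \<in> ?\<N>" using W(1,2) z(1) U(3) by auto
      moreover have "z \<in> cyl G B W z" using z(1) by (simp add: cyl_def)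
      ultimately show "z \<in> (\<Union>D\<in>?\<N>. D)" by blast
    qed
    ultimately show ?thesis by (intro AE_I') auto
  qed
  define w where "w z = measure p {z}" for z
  have shift_sets: "shift G \<beta> \<in> measurable p p" if \<beta>: "\<beta> \<in> carrier G" for \<beta>
  proof -
    have "shift G \<beta> \<in> measurable p (borel_on ?T)"
      unfolding borel_on_def
    proof (rule measurable_measure_of)
      fix U assume "U \<in> {U. openin ?T U}"
      then have "openin ?T {z \<in> topspace ?T. shift G \<beta> z \<in> U}"
        using continuous_map_shift[OF \<beta>] by (intro openin_continuous_map_preimage) auto
      then have "{z \<in> topspace ?T. shift G \<beta> z \<in> U} \<in> sets p" by (rule openin_sets_Prob[OF pP])
      moreover have "shift G \<beta> -` U \<inter> space p = {z \<in> topspace ?T. shift G \<beta> z \<in> U}"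
        using space_Prob[OF pP] by auto
      ultimately show "shift G \<beta> -` U \<inter> space p \<in> sets p" by simp
    qed (use shift_in_topspace[OF \<beta>] space_Prob[OF pP] in \<open>auto dest: openin_subset\<close>)
    then show ?thesis using measurable_cong_sets[OF refl sets_Prob[OF pP], of p] by simp
  qed
  have p_shift: "emeasure p {z \<in> topspace ?T. shift G \<beta> z \<in> U} = emeasure p U"
    if \<beta>: "\<beta> \<in> carrier G" and U: "U \<in> sets p" for \<beta> U
  proof -
    have "emeasure p U = emeasure (distr p p (shift G \<beta>)) U" by (simp add: inv[OF \<beta>])
    also have "\<dots> = emeasure p (shift G \<beta> -` U \<inter> space p)" by (rule emeasure_distr[OF shift_sets[OF \<beta>] U])
    also have "shift G \<beta> -` U \<inter> space p = {z \<in> topspace ?T. shift G \<beta> z \<in> U}"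
      using space_Prob[OF pP] by auto
    finally show ?thesis by simp
  qed
  show thesis
  proof (rule that[of ?V w])
    show "shift G \<beta> z \<in> ?V" if \<beta>: "\<beta> \<in> carrier G" and z: "z \<in> ?V" for \<beta> z
      unfolding measure_support_def
    proof (intro CollectI conjI allI impI)
      show "shift G \<beta> z \<in> topspace ?T" using shift_in_topspace[OF \<beta>] z V_sub by blast
      fix U assume U: "openin ?T U \<and> shift G \<beta> z \<in> U"
      then have "openin ?T {z \<in> topspace ?T. shift G \<beta> z \<in> U}"
        using continuous_map_shift[OF \<beta>] by (intro openin_continuous_map_preimage) auto
      then have "emeasure p {z \<in> topspace ?T. shift G \<beta> z \<in> U} > 0"
        using z U by (auto simp: measure_support_def)
      then show "emeasure p U > 0" using p_shift[OF \<beta> openin_sets_Prob[OF pP]] U by simp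
    qed
    show "w (shift G \<beta> z) = w z" if \<beta>: "\<beta> \<in> carrier G" and z: "z \<in> ?V" for \<beta> z
    proof -
      have zT: "z \<in> topspace ?T" using z V_sub by blast
      \<comment> \<open>The shift is injective, being undone by
        \<open>shift G (inv \<beta>)\<close>.\<close>
      have "{y \<in> topspace ?T. shift G \<beta> y \<in> {shift G \<beta> z}} = {z}"
      proof -
        have "y = z" if y: "y \<in> topspace ?T" "shift G \<beta> y = shift G \<beta> z" for y
        proof -
          have "y = shift G (inv \<beta>) (shift G \<beta> y)"
            using shift_shift[OF \<beta> inv_closed[OF \<beta>], of y] shift_one[OF y(1)] \<beta> by simp
          also have "\<dots> = z" unfolding y(2)
            using shift_shift[OF \<beta> inv_closed[OF \<beta>], of z] shift_one[OF zT] \<beta> by simp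
          finally show ?thesis .
        qed
        then show ?thesis using zT by auto
      qed
      then show ?thesis
        unfolding w_def measure_def
        using p_shift[OF \<beta> sing[OF shift_in_topspace[OF \<beta> zT]]] by simp
    qed
    show "w z \<ge> 0" for z by (simp add: w_def)
    have prob_V: "measure p ?V = 1" using prob_eq_1[OF V_sets] null by simp
    show "sum w ?V = 1"
      unfolding w_def prob_V[symmetric]
      using finite_measure_eq_sum_singleton[OF fin] V_sub sing by (metis subsetD)
    show "(\<integral>z. f z \<partial>p) = (\<Sum>z\<in>?V. w z * f z)" if f: "f \<in> C ?T" for f
    proof -
      have "(\<integral>z. f z \<partial>p) = (\<integral>z. (\<Sum>y\<in>?V. f y * indicator {y} z) \<partial>p)"
      proof (rule integral_cong_AE)
        show "AE z in p. f z = (\<Sum>y\<in>?V. f y * indicator {y} z)"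
          using null
        proof eventually_elim
          case (elim z)
          then show ?case using fin by (simp add: indicator_def sum.delta' if_distrib cong: if_cong)
        qed
        show "(\<lambda>z. \<Sum>y\<in>?V. f y * indicator {y} z) \<in> borel_measurable p"
          using sing V_sub by (intro borel_measurable_sum borel_measurable_times borel_measurable_indicator) auto
      qed (rule C_measurable[OF pP f])
      also have "\<dots> = (\<Sum>y\<in>?V. f y * measure p {y})"
        using sing V_sub by (subst Bochner_Integration.integral_sum) (auto intro!: integrable_mult_right integrable_real_indicator sum.cong simp: emeasure_eq_measure)
      finally show ?thesis by (simp add: w_def mult.commute)
    qed
  next
    show "finite ?V" by (rule fin)
    show "?V \<subseteq> topspace ?T" by (rule V_sub)
  qed
qed

section \<open>Periodic approximation of the resolvent\<close>

lemma state_sum: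
  assumes L: "state X L" and I: "finite I" and g: "\<And>i. i \<in> I \<Longrightarrow> g i \<in> C X"
  shows "(\<lambda>x. \<Sum>i\<in>I. a i * g i x) \<in> C X \<and> L (\<lambda>x. \<Sum>i\<in>I. a i * g i x) = (\<Sum>i\<in>I. a i * L (g i))"
  using I g
proof (induction I rule: finite_induct)
  case empty
  then show ?case using state_const[OF L, of 0] by simp
next
  case (insert i I)
  then have IH: "(\<lambda>x. \<Sum>i\<in>I. a i * g i x) \<in> C X"
    "L (\<lambda>x. \<Sum>i\<in>I. a i * g i x) = (\<Sum>i\<in>I. a i * L (g i))" and gi: "g i \<in> C X" by auto
  show ?case
    using C_lincomb[OF gi IH(1), of "a i" 1] state_lincomb[OF L gi IH(1), of "a i" 1] IH(2) insert.hyps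
    by simp
qed

lemma state_convex:
  assumes V: "finite V" and w: "\<And>y. y \<in> V \<Longrightarrow> w y \<ge> 0" "sum w V = 1"
    and L: "\<And>y. y \<in> V \<Longrightarrow> state X (L y)"
  shows "state X (\<lambda>f. \<Sum>y\<in>V. w y * L y f)"
  unfolding state_def
proof (intro conjI ballI allI impI)
  fix f g and a b :: real assume f: "f \<in> C X" and g: "g \<in> C X"
  have "(\<Sum>y\<in>V. w y * L y (\<lambda>x. a * f x + b * g x)) = (\<Sum>y\<in>V. a * (w y * L y f) + b * (w y * L y g))"
  proof (intro sum.cong refl)
    fix y assume "y \<in> V"
    from state_lincomb[OF L[OF this] f g, of a b]
    show "w y * L y (\<lambda>x. a * f x + b * g x) = a * (w y * L y f) + b * (w y * L y g)"
      by (simp add: algebra_simps)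
  qed
  then show "(\<Sum>y\<in>V. w y * L y (\<lambda>x. a * f x + b * g x)) = a * (\<Sum>y\<in>V. w y * L y f) + b * (\<Sum>y\<in>V. w y * L y g)"
    by (simp add: sum.distrib sum_distrib_left)
next
  have "(\<Sum>y\<in>V. w y * L y (\<lambda>_. 1)) = sum w V"
    by (intro sum.cong refl) (simp add: state_const[OF L])
  then show "(\<Sum>y\<in>V. w y * L y (\<lambda>_. 1)) = 1" using w(2) by simp
next
  fix f assume "f \<in> C X" "\<forall>x\<in>topspace X. f x \<ge> 0"
  then have "L y f \<ge> 0" if "y \<in> V" for y using L[OF that] unfolding state_def by blast
  then show "(\<Sum>y\<in>V. w y * L y f) \<ge> 0" using w(1) by (intro sum_nonneg mult_nonneg_nonneg)
qed

text \<open>The entropy bound concerns uniform averages, but a periodic measure need not be uniform on its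
  support. It is uniform on the level sets of its weights, which are \<open>\<Gamma>\<close>-sets.\<close>

lemma level_set_average:
  fixes w :: "'z \<Rightarrow> real"
  assumes "finite V"
  shows "(\<Sum>y\<in>V. w y * ((\<Sum>z\<in>{z\<in>V. w z = w y}. F z) / card {z\<in>V. w z = w y})) = (\<Sum>z\<in>V. w z * F z)"
proof -
  let ?c = "\<lambda>y. real (card {z\<in>V. w z = w y})"
  have "(\<Sum>y\<in>V. w y * ((\<Sum>z\<in>{z\<in>V. w z = w y}. F z) / ?c y))
      = (\<Sum>y\<in>V. \<Sum>z\<in>V. if w z = w y then w y * F z / ?c y else 0)"
    using assms
    by (intro sum.cong refl) (simp add: sum.inter_filter sum_distrib_left sum_divide_distrib flip: sum.inter_filter)
  also have "\<dots> = (\<Sum>z\<in>V. \<Sum>y\<in>V. if w y = w z then w z * F z / ?c z else 0)"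
    by (subst sum.swap) (intro sum.cong refl, auto)
  also have "\<dots> = (\<Sum>z\<in>V. \<Sum>y\<in>{y\<in>V. w y = w z}. w z * F z / ?c z)"
    by (simp only: sum.inter_filter[OF assms])
  also have "\<dots> = (\<Sum>z\<in>V. w z * F z)"
  proof (intro sum.cong refl)
    fix z assume "z \<in> V"
    then have "?c z > 0" using assms by (auto simp: card_gt_0_iff)
    then show "(\<Sum>y\<in>{y\<in>V. w y = w z}. w z * F z / ?c z) = w z * F z" by simp
  qed
  finally show ?thesis .
qed

locale PA_system = spin_system G A s r J h
  for G :: "('g, 'm) monoid_scheme" (structure) and A :: "'a set" and s r J h +
  fixes \<mu>
  assumes J_sym: "\<And>a b. a \<in> A \<Longrightarrow> b \<in> A \<Longrightarrow> J a b = J b a"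
    and countable_G: "countable (carrier G)"
    and PA: "property_PA G"
    and \<mu>: "\<mu> \<in> shift_invariant_Prob G A"
begin

lemma \<mu>_Prob: "\<mu> \<in> Prob T"
  using \<mu> by (simp add: shift_invariant_Prob_def)

lemma state_\<mu>: "state T (\<lambda>f. \<integral>x. f x \<partial>\<mu>)"
  by (rule state_integral[OF compact_config_top[OF finite_A] \<mu>_Prob])

text \<open>Weak approximation controls only integrals of continuous functions. This one is local,
  dominates the indicator of a bad point, and has small mean under the labelled measure.\<close>

definition collisions :: "(nat \<Rightarrow> nat) \<Rightarrow> 'g set \<Rightarrow> ('g \<Rightarrow> nat) \<Rightarrow> real" where
  "collisions lab W z = (\<Sum>(\<gamma>, \<gamma>')\<in>{(\<gamma>, \<gamma>') \<in> W \<times> W. \<gamma> \<noteq> \<gamma>'}. if lab (z \<gamma>) = lab (z \<gamma>') then 1 else 0)"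

lemma collisions_nonneg: "collisions lab W z \<ge> 0"
  unfolding collisions_def by (intro sum_nonneg) (simp add: case_prod_unfold)

lemma one_le_collisions:
  assumes "finite W" "\<gamma> \<in> W" "\<gamma>' \<in> W" "\<gamma> \<noteq> \<gamma>'" "lab (z \<gamma>) = lab (z \<gamma>')"
  shows "1 \<le> collisions lab W z"
proof -
  let ?g = "\<lambda>(\<gamma>, \<gamma>'). if lab (z \<gamma>) = lab (z \<gamma>') then 1 else 0 :: real"
  have "?g (\<gamma>, \<gamma>') \<le> collisions lab W z"
    unfolding collisions_def
  proof (rule member_le_sum)
    show "(\<gamma>, \<gamma>') \<in> {(\<gamma>, \<gamma>') \<in> W \<times> W. \<gamma> \<noteq> \<gamma>'}" using assms by simp
    show "finite {(\<gamma>, \<gamma>') \<in> W \<times> W. \<gamma> \<noteq> \<gamma>'}"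
      by (rule finite_subset[of _ "W \<times> W"]) (use assms(1) in auto)
  qed (simp add: case_prod_unfold)
  then show ?thesis using assms(5) by simp
qed

text \<open>The points of \<open>V\<close> are configurations themselves, moved by the shift.
  Reading the spin at the identity defines \<open>x0\<close> on \<open>V\<close>, and the lift of
  \<open>x0\<close> at \<open>z\<close> is then the decoded \<open>z\<close>. If the orbit map of
  \<open>z\<close> identifies two sites of the window, \<open>z\<close> has equal symbols, hence
  equal labels, there.\<close>

lemma level_set_state:
  fixes \<kappa> \<epsilon> :: real and B :: "nat set"
  assumes \<kappa>: "\<kappa> > 0" and \<epsilon>: "0 < \<epsilon>" "\<epsilon> \<le> 1" and W: "finite W" "W \<subseteq> carrier G"
    and V: "finite V" "V \<noteq> {}" "V \<subseteq> topspace (config_top G B)"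
    and shift_V: "\<And>\<beta> z. \<beta> \<in> carrier G \<Longrightarrow> z \<in> V \<Longrightarrow> shift G \<beta> z \<in> V"
    and dec: "\<And>b. b \<in> B \<Longrightarrow> dec b \<in> A"
  defines "W' \<equiv> W \<union> (\<Union>\<gamma>\<in>W. nbhd \<gamma>)"
  shows "\<exists>L. state T L \<and> (\<forall>f K. local_on G A W f \<longrightarrow> (\<forall>x\<in>X. \<bar>f x\<bar> \<le> K) \<longrightarrow>
      \<bar>L f - \<kappa> * L (\<L> f) - (\<Sum>z\<in>V. f (\<lambda>\<gamma>\<in>carrier G. dec (z \<gamma>))) / card V\<bar>
        \<le> K * (2 * \<epsilon> + (2 + 2 * \<kappa> * card W) * ((\<Sum>z\<in>V. collisions lab W' z) / card V)) \<and>
      (\<forall>\<gamma>\<in>W. \<bar>L f - L (R \<gamma> f)\<bar>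
        \<le> K * (sqrt (2 * dissipation_bound / \<kappa>) + 2 * ((\<Sum>z\<in>V. collisions lab W' z) / card V))))"
proof -
  interpret fa: finite_action G A s r J h V "shift G"
  proof
    show "shift G \<one> z = z" if "z \<in> V" for z using shift_one that V(3) by blast
    show "shift G (\<gamma> \<otimes> \<delta>) z = shift G \<gamma> (shift G \<delta> z)"
      if "\<gamma> \<in> carrier G" "\<delta> \<in> carrier G" "z \<in> V" for \<gamma> \<delta> z using shift_shift that by blast
  qed (use J_sym V shift_V in auto)
  have W': "finite W'" "W' \<subseteq> carrier G" using W finite_nbhd nbhd_closed unfolding W'_def by blast+
  define x0 where "x0 = (\<lambda>z\<in>V. dec (z \<one>))"
  have zB: "z \<gamma> \<in> B" if "z \<in> V" "\<gamma> \<in> carrier G" for z \<gamma>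
    using V(3) that unfolding topspace_config_top by (blast intro: PiE_mem)
  have x0: "x0 \<in> fa.confs"
    unfolding fa.confs_def x0_def restrict_PiE_iff using dec zB by blast
  have lift: "fa.lift z x0 = (\<lambda>\<gamma>\<in>carrier G. dec (z \<gamma>))" if z: "z \<in> V" for z
    unfolding fa.lift_def
  proof (rule restrict_ext)
    fix \<gamma> assume \<gamma>: "\<gamma> \<in> carrier G"
    then show "x0 (shift G \<gamma> z) = dec (z \<gamma>)"
      using shift_V[OF \<gamma> z] by (simp add: x0_def) (simp add: shift_def)
  qed
  define b where "b = (\<Sum>z\<in>V. collisions lab W' z) / card V"
  have bad: "fa.bad_fraction W \<le> b"
  proof -
    have "1 \<le> collisions lab W' z" if z: "z \<in> V" and bad: "\<not> fa.good W z" for z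
    proof -
      obtain \<gamma> \<gamma>' where g: "\<gamma> \<in> W'" "\<gamma>' \<in> W'" "\<gamma> \<noteq> \<gamma>'" "shift G \<gamma> z = shift G \<gamma>' z"
        using bad unfolding fa.good_def inj_on_def W'_def by blast
      then have "shift G \<gamma> z \<one> = shift G \<gamma>' z \<one>" by simp
      moreover have "\<gamma> \<in> carrier G" "\<gamma>' \<in> carrier G" using g W'(2) by auto
      ultimately have "z \<gamma> = z \<gamma>'" by (simp add: shift_def)
      then show ?thesis by (intro one_le_collisions[OF W'(1) g(1-3)]) simp
    qed
    then have "(\<Sum>z\<in>V. if fa.good W z then 0 else 1) \<le> (\<Sum>z\<in>V. collisions lab W' z)"
      using collisions_nonneg by (intro sum_mono) auto
    moreover have "(\<Sum>z\<in>V. if fa.good W z then 0 else 1) = real (card {z \<in> V. \<not> fa.good W z})"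
      using V(1) by (simp add: sum.If_cases Int_def)
    ultimately show ?thesis unfolding fa.bad_fraction_def b_def by (simp add: divide_right_mono)
  qed
  obtain L where L: "state T L"
    "\<And>W f K. finite W \<Longrightarrow> W \<subseteq> carrier G \<Longrightarrow> local_on G A W f \<Longrightarrow> (\<And>x. x \<in> X \<Longrightarrow> \<bar>f x\<bar> \<le> K) \<Longrightarrow>
      \<bar>L f - \<kappa> * L (\<L> f) - (\<Sum>z\<in>V. f (fa.lift z x0)) / card V\<bar>
      \<le> K * (2 * \<epsilon> + (2 + 2 * \<kappa> * card W) * fa.bad_fraction W)"
    "\<And>W f K \<gamma>. finite W \<Longrightarrow> W \<subseteq> carrier G \<Longrightarrow> local_on G A W f \<Longrightarrow> (\<And>x. x \<in> X \<Longrightarrow> \<bar>f x\<bar> \<le> K) \<Longrightarrow> \<gamma> \<in> W \<Longrightarrow>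
      \<bar>L f - L (R \<gamma> f)\<bar> \<le> K * (sqrt (2 * dissipation_bound / \<kappa>) + 2 * fa.bad_fraction W)"
    using fa.resolvent_state[OF \<kappa> \<epsilon> x0] by metis
  show ?thesis
    unfolding b_def[symmetric]
  proof (intro exI[of _ L] conjI allI impI ballI L(1))
    fix f K assume f: "local_on G A W f" and K: "\<forall>x\<in>X. \<bar>f x\<bar> \<le> K"
    have K': "\<And>x. x \<in> X \<Longrightarrow> \<bar>f x\<bar> \<le> K" using K by blast
    obtain x where "x \<in> X" using X_nonempty by blast
    then have K0: "K \<ge> 0" using K' by fastforce
    have sum_lift: "(\<Sum>z\<in>V. f (fa.lift z x0)) = (\<Sum>z\<in>V. f (\<lambda>\<gamma>\<in>carrier G. dec (z \<gamma>)))"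
      by (intro sum.cong refl) (simp only: lift)
    have "K * (2 * \<epsilon> + (2 + 2 * \<kappa> * card W) * fa.bad_fraction W) \<le> K * (2 * \<epsilon> + (2 + 2 * \<kappa> * card W) * b)"
      using K0 \<kappa> bad by (intro mult_left_mono add_left_mono) auto
    with L(2)[OF W f K'] show "\<bar>L f - \<kappa> * L (\<L> f) - (\<Sum>z\<in>V. f (\<lambda>\<gamma>\<in>carrier G. dec (z \<gamma>))) / card V\<bar>
        \<le> K * (2 * \<epsilon> + (2 + 2 * \<kappa> * card W) * b)"
      unfolding sum_lift by linarith
    fix \<gamma> assume \<gamma>: "\<gamma> \<in> W"
    have "K * (sqrt (2 * dissipation_bound / \<kappa>) + 2 * fa.bad_fraction W)
        \<le> K * (sqrt (2 * dissipation_bound / \<kappa>) + 2 * b)"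
      using K0 bad by (intro mult_left_mono add_left_mono) auto
    with L(3)[OF W f K' \<gamma>] show "\<bar>L f - L (R \<gamma> f)\<bar> \<le> K * (sqrt (2 * dissipation_bound / \<kappa>) + 2 * b)"
      by linarith
  qed
qed

text \<open>The states of the level sets are mixed with the weights of a periodic measure. Since one
  \<open>L\<close> has to serve every function local on \<open>W\<close>, that measure is chosen to
  be accurate on the finitely many patterns on \<open>W\<close>, and on the collision count.\<close>

lemma approximate_resolvent:
  fixes \<kappa> \<epsilon> :: real
  assumes \<kappa>: "\<kappa> > 0" and \<epsilon>: "0 < \<epsilon>" "\<epsilon> \<le> 1" and W: "finite W" "W \<subseteq> carrier G"
  shows "\<exists>L. state T L \<and> (\<forall>f K. local_on G A W f \<longrightarrow> (\<forall>x\<in>X. \<bar>f x\<bar> \<le> K) \<longrightarrow>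
      \<bar>L f - \<kappa> * L (\<L> f) - (\<integral>x. f x \<partial>\<mu>)\<bar> \<le> K * \<epsilon> \<and>
      (\<forall>\<gamma>\<in>W. \<bar>L f - L (R \<gamma> f)\<bar> \<le> K * (sqrt (2 * dissipation_bound / \<kappa>) + \<epsilon>)))"
proof -
  define W' where "W' = W \<union> (\<Union>\<gamma>\<in>W. nbhd \<gamma>)"
  have W': "finite W'" "W' \<subseteq> carrier G" using W finite_nbhd nbhd_closed unfolding W'_def by blast+
  let ?pairs = "{(\<gamma>, \<gamma>') \<in> W' \<times> W'. \<gamma> \<noteq> \<gamma>'}"
  have fin_pairs: "finite ?pairs" by (rule finite_subset[of _ "W' \<times> W'"]) (use W'(1) in auto)
  define c where "c = 2 + 2 * \<kappa> * card W"
  have c: "c \<ge> 2" using \<kappa> by (simp add: c_def)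
  let ?pats = "W \<rightarrow>\<^sub>E A"
  have fin_pats: "finite ?pats" using W(1) finite_A by (intro finite_PiE) auto
  define n where "n = real (card ?pairs)"
  define m where "m = real (card ?pats)"
  \<comment> \<open>The error budget has three shares of \<open>\<epsilon> / 4\<close>: the uniform
    admixture, taken at \<open>\<epsilon> / 8\<close>; the label collisions; and the weak
    approximation, which enters as \<open>c * \<epsilon>'\<close> through collisions and
    \<open>m * \<epsilon>'\<close> through patterns.\<close>
  define \<epsilon>' where "\<epsilon>' = \<epsilon> / (4 * (c + m + 1))"
  have m0: "m \<ge> 0" by (simp add: m_def)
  have \<epsilon>': "\<epsilon>' > 0" "(c + m) * \<epsilon>' \<le> \<epsilon> / 4"
    using \<epsilon> c m0 by (auto simp: \<epsilon>'_def field_simps)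
  \<comment> \<open>Enough labels for the \<open>n\<close> ordered pairs of sites to cost at most
    \<open>\<epsilon> / 4\<close> after multiplication by \<open>c\<close>; the summand 1 keeps
    \<open>M\<close> positive when \<open>n\<close> is 0.\<close>
  define M where "M = nat \<lceil>4 * c * n / \<epsilon>\<rceil> + 1"
  have M0: "M > 0" by (simp add: M_def)
  have M: "c * (n / M) \<le> \<epsilon> / 4"
  proof -
    have "4 * c * n / \<epsilon> \<le> M" unfolding M_def by linarith
    then show ?thesis using \<epsilon> M0 by (simp add: field_simps)
  qed
  obtain B :: "nat set" and dec lab \<nu> where B: "finite B" and dec: "\<And>b. b \<in> B \<Longrightarrow> dec b \<in> A"
    and \<nu>: "\<nu> \<in> shift_invariant_Prob G B"
    and int_dec: "\<And>f. f \<in> C T \<Longrightarrow> (\<integral>z. f (\<lambda>\<gamma>\<in>carrier G. dec (z \<gamma>)) \<partial>\<nu>) = (\<integral>x. f x \<partial>\<mu>)"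
    and coll: "\<And>\<gamma> \<gamma>'. \<gamma> \<in> carrier G \<Longrightarrow> \<gamma>' \<in> carrier G \<Longrightarrow> \<gamma> \<noteq> \<gamma>' \<Longrightarrow>
      measure \<nu> {z \<in> space \<nu>. (lab :: nat \<Rightarrow> nat) (z \<gamma>) = lab (z \<gamma>')} = 1 / M"
    by (rule labelled_measure[OF countable_G finite_A M0 \<mu>]) (rule that)
  let ?TB = "config_top G B"
  let ?dec = "\<lambda>z. \<lambda>\<gamma>\<in>carrier G. dec (z \<gamma>)"
  have \<nu>P: "\<nu> \<in> Prob ?TB" using \<nu> by (simp add: shift_invariant_Prob_def)
  have state_\<nu>: "state ?TB (\<lambda>f. \<integral>z. f z \<partial>\<nu>)"
    by (rule state_integral[OF compact_config_top[OF B] \<nu>P])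
  have dec_X: "?dec z \<in> X" if "z \<in> topspace ?TB" for z
  proof -
    have "dec (z \<gamma>) \<in> A" if "\<gamma> \<in> carrier G" for \<gamma>
      using \<open>z \<in> topspace ?TB\<close> that dec unfolding topspace_config_top by (blast dest: PiE_mem)
    then show ?thesis unfolding topspace_config_top restrict_PiE_iff by blast
  qed
  define pat :: "('g \<Rightarrow> 'a) \<Rightarrow> ('g \<Rightarrow> nat) \<Rightarrow> real" where
    "pat \<pi> z = (if \<forall>\<delta>\<in>W. dec (z \<delta>) = \<pi> \<delta> then 1 else 0)" for \<pi> z
  have pat_C: "pat \<pi> \<in> C ?TB" for \<pi>
    by (rule local_on_imp_C[OF W], rule local_onI) (simp add: pat_def)
  have pair_C: "(\<lambda>z. if lab (z \<gamma>) = lab (z \<gamma>') then 1 else 0 :: real) \<in> C ?TB"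
    if "\<gamma> \<in> carrier G" "\<gamma>' \<in> carrier G" for \<gamma> \<gamma>'
    by (rule local_on_imp_C[of "{\<gamma>, \<gamma>'}"], use that in simp_all, rule local_onI) simp
  have coll_C: "collisions lab W' \<in> C ?TB" and coll_\<nu>: "(\<integral>z. collisions lab W' z \<partial>\<nu>) = n / M"
  proof -
    let ?g = "\<lambda>(\<gamma>, \<gamma>') z. if lab (z \<gamma>) = lab (z \<gamma>') then 1 else 0 :: real"
    have g: "?g q \<in> C ?TB" if "q \<in> ?pairs" for q using that pair_C W'(2) by auto
    have eq: "collisions lab W' = (\<lambda>z. \<Sum>q\<in>?pairs. 1 * ?g q z)"
      by (rule ext) (simp add: collisions_def case_prod_unfold)
    note lin = state_sum[OF state_\<nu> fin_pairs g, where a = "\<lambda>_. 1"]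
    show "collisions lab W' \<in> C ?TB" unfolding eq by (rule lin[THEN conjunct1])
    have "(\<integral>z. collisions lab W' z \<partial>\<nu>) = (\<Sum>q\<in>?pairs. 1 * (\<integral>z. ?g q z \<partial>\<nu>))"
      unfolding eq by (rule lin[THEN conjunct2])
    also have "\<dots> = (\<Sum>q\<in>?pairs. 1 / M)"
    proof (intro sum.cong refl)
      fix q assume "q \<in> ?pairs"
      then obtain \<gamma> \<gamma>' where q: "q = (\<gamma>, \<gamma>')" "\<gamma> \<in> carrier G" "\<gamma>' \<in> carrier G" "\<gamma> \<noteq> \<gamma>'"
        using W'(2) by auto
      have "(\<integral>z. ?g q z \<partial>\<nu>) = (\<integral>z. indicator {z \<in> space \<nu>. lab (z \<gamma>) = lab (z \<gamma>')} z \<partial>\<nu>)"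
        by (intro Bochner_Integration.integral_cong refl) (simp add: q(1) indicator_def)
      also have "\<dots> = measure \<nu> {z \<in> space \<nu>. lab (z \<gamma>) = lab (z \<gamma>')}"
        unfolding Bochner_Integration.integral_indicator
        by (rule arg_cong[where f = "measure \<nu>"]) blast
      finally show "1 * (\<integral>z. ?g q z \<partial>\<nu>) = 1 / M" using coll[OF q(2-4)] by simp
    qed
    finally show "(\<integral>z. collisions lab W' z \<partial>\<nu>) = n / M" by (simp add: n_def)
  qed
  have "\<nu> \<in> weak_topology ?TB closure_of periodic_measures G B"
    using PA \<nu> B unfolding property_PA_def by blast
  moreover have "finite (insert (collisions lab W') (pat ` ?pats))" using fin_pats by simp
  moreover have "insert (collisions lab W') (pat ` ?pats) \<subseteq> C ?TB" using coll_C pat_C by blast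
  ultimately obtain p where p: "p \<in> periodic_measures G B"
    "\<And>g. g \<in> insert (collisions lab W') (pat ` ?pats) \<Longrightarrow> \<bar>(\<integral>z. g z \<partial>p) - (\<integral>z. g z \<partial>\<nu>)\<bar> < \<epsilon>'"
    by (rule weak_closure_approximation[OF _ _ _ \<epsilon>'(1)]) (rule that)
  obtain V w where V: "finite V" "V \<subseteq> topspace ?TB"
    and shift_V: "\<And>\<beta> z. \<beta> \<in> carrier G \<Longrightarrow> z \<in> V \<Longrightarrow> shift G \<beta> z \<in> V"
    and shift_w: "\<And>\<beta> z. \<beta> \<in> carrier G \<Longrightarrow> z \<in> V \<Longrightarrow> w (shift G \<beta> z) = w z"
    and w: "\<And>z. w z \<ge> 0" "sum w V = 1"
    and int_p: "\<And>f. f \<in> C ?TB \<Longrightarrow> (\<integral>z. f z \<partial>p) = (\<Sum>z\<in>V. w z * f z)"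
    by (rule periodic_measure_weights[OF countable_G B p(1)]) (rule that)
  define level where "level y = {z \<in> V. w z = w y}" for y
  define \<beta> where "\<beta> y = (\<Sum>z\<in>level y. collisions lab W' z) / card (level y)" for y
  define Q where "Q y L \<longleftrightarrow> state T L \<and> (\<forall>f K. local_on G A W f \<longrightarrow> (\<forall>x\<in>X. \<bar>f x\<bar> \<le> K) \<longrightarrow>
      \<bar>L f - \<kappa> * L (\<L> f) - (\<Sum>z\<in>level y. f (?dec z)) / card (level y)\<bar>
        \<le> K * (2 * (\<epsilon> / 8) + c * \<beta> y) \<and>
      (\<forall>\<gamma>\<in>W. \<bar>L f - L (R \<gamma> f)\<bar> \<le> K * (sqrt (2 * dissipation_bound / \<kappa>) + 2 * \<beta> y)))" for y L
  have "\<exists>L. Q y L" if y: "y \<in> V" for y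
    unfolding Q_def \<beta>_def c_def W'_def
  proof (rule level_set_state[OF \<kappa> _ _ W])
    show "level y \<noteq> {}" using y by (auto simp: level_def)
    show "shift G \<gamma> z \<in> level y" if "\<gamma> \<in> carrier G" "z \<in> level y" for \<gamma> z
      using that shift_V shift_w by (simp add: level_def)
    show "level y \<subseteq> topspace ?TB" using V(2) by (auto simp: level_def)
  qed (use V \<epsilon> dec in \<open>auto simp: level_def\<close>)
  then obtain \<Lambda> where "\<And>y. y \<in> V \<Longrightarrow> Q y (\<Lambda> y)" by metis
  then have \<Lambda>: "\<And>y. y \<in> V \<Longrightarrow> state T (\<Lambda> y)"
    "\<And>y f K. y \<in> V \<Longrightarrow> local_on G A W f \<Longrightarrow> \<forall>x\<in>X. \<bar>f x\<bar> \<le> K \<Longrightarrow>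
      \<bar>\<Lambda> y f - \<kappa> * \<Lambda> y (\<L> f) - (\<Sum>z\<in>level y. f (?dec z)) / card (level y)\<bar>
        \<le> K * (2 * (\<epsilon> / 8) + c * \<beta> y)"
    "\<And>y f K \<gamma>. y \<in> V \<Longrightarrow> local_on G A W f \<Longrightarrow> \<forall>x\<in>X. \<bar>f x\<bar> \<le> K \<Longrightarrow> \<gamma> \<in> W \<Longrightarrow>
      \<bar>\<Lambda> y f - \<Lambda> y (R \<gamma> f)\<bar> \<le> K * (sqrt (2 * dissipation_bound / \<kappa>) + 2 * \<beta> y)"
    unfolding Q_def by blast+
  define L where "L f = (\<Sum>y\<in>V. w y * \<Lambda> y f)" for f
  have L: "state T L" unfolding L_def using V(1) w \<Lambda>(1) by (intro state_convex) auto
  have avg: "(\<Sum>y\<in>V. w y * ((\<Sum>z\<in>level y. F z) / card (level y))) = (\<Sum>z\<in>V. w z * F z)" for F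
    unfolding level_def by (rule level_set_average[OF V(1)])
  define b where "b = (\<Sum>y\<in>V. w y * \<beta> y)"
  have b: "b \<le> n / M + \<epsilon>'"
  proof -
    have "b = (\<integral>z. collisions lab W' z \<partial>p)" unfolding b_def \<beta>_def avg int_p[OF coll_C] ..
    then show ?thesis using p(2)[of "collisions lab W'"] coll_\<nu> by simp
  qed
  have sum_w: "(\<Sum>y\<in>V. w y * (u + v * \<beta> y)) = u + v * b" for u v
  proof -
    have "(\<Sum>y\<in>V. w y * (u + v * \<beta> y)) = (\<Sum>y\<in>V. w y) * u + v * b"
      unfolding b_def sum_distrib_left sum_distrib_right sum.distrib[symmetric]
      by (intro sum.cong refl) (simp add: algebra_simps)
    then show ?thesis using w(2) by simp
  qed
  have sum_w_bound: "\<bar>\<Sum>y\<in>V. w y * D y\<bar> \<le> K * (u + v * b)"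
    if "\<And>y. y \<in> V \<Longrightarrow> \<bar>D y\<bar> \<le> K * (u + v * \<beta> y)" for D K u v
  proof -
    have "\<bar>\<Sum>y\<in>V. w y * D y\<bar> \<le> (\<Sum>y\<in>V. w y * (K * (u + v * \<beta> y)))"
      using that w(1) by (intro order_trans[OF sum_abs] sum_mono) (simp add: abs_mult mult_left_mono)
    also have "\<dots> = K * (\<Sum>y\<in>V. w y * (u + v * \<beta> y))" by (simp add: sum_distrib_left mult_ac)
    finally show ?thesis unfolding sum_w .
  qed
  have cb: "c * b \<le> \<epsilon> / 4 + c * \<epsilon>'"
  proof -
    have "c * b \<le> c * (n / M + \<epsilon>')" using b c by (intro mult_left_mono) auto
    then show ?thesis using M unfolding distrib_left by linarith
  qed
  have b0: "b \<ge> 0" unfolding b_def \<beta>_def using w(1) collisions_nonneg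
    by (intro sum_nonneg mult_nonneg_nonneg divide_nonneg_nonneg) auto
  have c\<epsilon>': "c * \<epsilon>' + m * \<epsilon>' \<le> \<epsilon> / 4" using \<epsilon>'(2) by (simp add: distrib_right)
  have m\<epsilon>'0: "m * \<epsilon>' \<ge> 0" using m0 \<epsilon>'(1) by simp
  \<comment> \<open>As \<open>c \<ge> 2\<close>, the resampling estimate inherits the bound made for
    \<open>c * b\<close>.\<close>
  have "2 * b \<le> c * b" using c b0 by (intro mult_right_mono) auto
  then have b2: "2 * b \<le> \<epsilon>" using cb c\<epsilon>' m\<epsilon>'0 \<epsilon> by linarith
  show ?thesis
  proof (intro exI[of _ L] conjI allI impI ballI L)
    fix f K assume f: "local_on G A W f" and K: "\<forall>x\<in>X. \<bar>f x\<bar> \<le> K"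
    obtain x1 where x1: "x1 \<in> X" using X_nonempty by blast
    then have K0: "K \<ge> 0" using K by fastforce
    \<comment> \<open>Completes a pattern on \<open>W\<close> to a configuration, so that
      \<open>f\<close> becomes a combination of pattern indicators with coefficients bounded by
      \<open>K\<close>.\<close>
    define ext where "ext \<pi> = (\<lambda>\<gamma>. if \<gamma> \<in> W then \<pi> \<gamma> else x1 \<gamma>)" for \<pi>
    have ext_X: "ext \<pi> \<in> X" if "\<pi> \<in> ?pats" for \<pi>
      using that x1 W(2) unfolding ext_def topspace_config_top by (auto simp: PiE_iff extensional_def)
    have f_pat: "f (?dec z) = (\<Sum>\<pi>\<in>?pats. f (ext \<pi>) * pat \<pi> z)" if z: "z \<in> topspace ?TB" for z
    proof -
      define \<pi>0 where "\<pi>0 = restrict (?dec z) W"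
      have mem: "\<pi>0 \<in> ?pats"
      proof -
        have "?dec z \<delta> \<in> A" if "\<delta> \<in> W" for \<delta>
          using PiE_mem[OF dec_X[OF z, unfolded topspace_config_top], of \<delta>] W(2) that by blast
        then show ?thesis unfolding \<pi>0_def restrict_PiE_iff by blast
      qed
      have "f (ext \<pi>) * pat \<pi> z = (if \<pi> = \<pi>0 then f (?dec z) else 0)" if "\<pi> \<in> ?pats" for \<pi>
      proof (cases "\<pi> = \<pi>0")
        case True
        have "f (ext \<pi>0) = f (?dec z)"
          using ext_X[OF mem] dec_X[OF z] by (intro local_onD[OF f]) (auto simp: ext_def \<pi>0_def)
        moreover have "pat \<pi>0 z = 1" using W(2) by (auto simp: pat_def \<pi>0_def)
        ultimately show ?thesis using True by simp
      next
        case False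
        have "\<not> (\<forall>\<delta>\<in>W. dec (z \<delta>) = \<pi> \<delta>)"
        proof
          assume *: "\<forall>\<delta>\<in>W. dec (z \<delta>) = \<pi> \<delta>"
          have "\<pi> = \<pi>0"
          proof (rule PiE_ext[OF that mem])
            fix \<delta> assume "\<delta> \<in> W"
            then show "\<pi> \<delta> = \<pi>0 \<delta>" using * W(2) by (auto simp: \<pi>0_def)
          qed
          with False show False by blast
        qed
        then have "pat \<pi> z = 0" by (simp add: pat_def)
        then show ?thesis using False by simp
      qed
      then have "(\<Sum>\<pi>\<in>?pats. f (ext \<pi>) * pat \<pi> z) = (\<Sum>\<pi>\<in>?pats. if \<pi> = \<pi>0 then f (?dec z) else 0)"
        by (rule sum.cong[OF refl])
      then show ?thesis using mem fin_pats by simp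
    qed
    have pats: "(\<integral>z. (\<Sum>\<pi>\<in>?pats. f (ext \<pi>) * pat \<pi> z) \<partial>\<nu>) = (\<Sum>\<pi>\<in>?pats. f (ext \<pi>) * (\<integral>z. pat \<pi> z \<partial>\<nu>))"
      by (rule state_sum[where g = pat, OF state_\<nu> fin_pats pat_C, THEN conjunct2])
    have int_f: "(\<integral>x. f x \<partial>\<mu>) = (\<Sum>\<pi>\<in>?pats. f (ext \<pi>) * (\<integral>z. pat \<pi> z \<partial>\<nu>))"
    proof -
      have "(\<integral>x. f x \<partial>\<mu>) = (\<integral>z. f (?dec z) \<partial>\<nu>)" using int_dec[OF local_on_imp_C[OF W f]] by simp
      also have "\<dots> = (\<integral>z. (\<Sum>\<pi>\<in>?pats. f (ext \<pi>) * pat \<pi> z) \<partial>\<nu>)"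
        using f_pat by (intro Bochner_Integration.integral_cong refl) (simp add: space_Prob[OF \<nu>P])
      finally show ?thesis unfolding pats .
    qed
    have sum_f: "(\<Sum>z\<in>V. w z * f (?dec z)) = (\<Sum>\<pi>\<in>?pats. f (ext \<pi>) * (\<integral>z. pat \<pi> z \<partial>p))"
    proof -
      have "(\<Sum>z\<in>V. w z * f (?dec z)) = (\<Sum>z\<in>V. \<Sum>\<pi>\<in>?pats. f (ext \<pi>) * (w z * pat \<pi> z))"
      proof (intro sum.cong refl)
        fix z assume "z \<in> V"
        then have "f (?dec z) = (\<Sum>\<pi>\<in>?pats. f (ext \<pi>) * pat \<pi> z)" using f_pat V(2) by blast
        then show "w z * f (?dec z) = (\<Sum>\<pi>\<in>?pats. f (ext \<pi>) * (w z * pat \<pi> z))"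
          by (simp only: sum_distrib_left mult.left_commute)
      qed
      also have "\<dots> = (\<Sum>\<pi>\<in>?pats. f (ext \<pi>) * (\<Sum>z\<in>V. w z * pat \<pi> z))"
        by (subst sum.swap) (simp only: sum_distrib_left)
      finally show ?thesis unfolding int_p[OF pat_C] .
    qed
    have close: "\<bar>(\<Sum>z\<in>V. w z * f (?dec z)) - (\<integral>x. f x \<partial>\<mu>)\<bar> \<le> K * (m * \<epsilon>')"
    proof -
      have "(\<Sum>z\<in>V. w z * f (?dec z)) - (\<integral>x. f x \<partial>\<mu>)
          = (\<Sum>\<pi>\<in>?pats. f (ext \<pi>) * ((\<integral>z. pat \<pi> z \<partial>p) - (\<integral>z. pat \<pi> z \<partial>\<nu>)))"
        unfolding sum_f int_f right_diff_distrib sum_subtractf ..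
      moreover have "\<bar>\<Sum>\<pi>\<in>?pats. f (ext \<pi>) * ((\<integral>z. pat \<pi> z \<partial>p) - (\<integral>z. pat \<pi> z \<partial>\<nu>))\<bar> \<le> (\<Sum>\<pi>\<in>?pats. K * \<epsilon>')"
      proof (intro order_trans[OF sum_abs] sum_mono)
        fix \<pi> assume \<pi>: "\<pi> \<in> ?pats"
        have "\<bar>f (ext \<pi>)\<bar> \<le> K" using K ext_X[OF \<pi>] by blast
        moreover have "\<bar>(\<integral>z. pat \<pi> z \<partial>p) - (\<integral>z. pat \<pi> z \<partial>\<nu>)\<bar> \<le> \<epsilon>'"
          using p(2)[of "pat \<pi>"] \<pi> by (simp add: less_imp_le)
        ultimately show "\<bar>f (ext \<pi>) * ((\<integral>z. pat \<pi> z \<partial>p) - (\<integral>z. pat \<pi> z \<partial>\<nu>))\<bar> \<le> K * \<epsilon>'"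
          unfolding abs_mult using K0 by (intro mult_mono) auto
      qed
      ultimately show ?thesis by (simp add: m_def mult.left_commute)
    qed
    have "L f - \<kappa> * L (\<L> f) - (\<Sum>z\<in>V. w z * f (?dec z))
        = (\<Sum>y\<in>V. w y * (\<Lambda> y f - \<kappa> * \<Lambda> y (\<L> f) - (\<Sum>z\<in>level y. f (?dec z)) / card (level y)))"
      unfolding L_def avg[of "\<lambda>z. f (?dec z)", symmetric] sum_distrib_left sum_subtractf[symmetric]
      by (intro sum.cong refl) (simp only: right_diff_distrib mult.left_commute)
    then have "\<bar>L f - \<kappa> * L (\<L> f) - (\<Sum>z\<in>V. w z * f (?dec z))\<bar> \<le> K * (2 * (\<epsilon> / 8) + c * b)"
      using sum_w_bound[OF \<Lambda>(2)[OF _ f K]] by simp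
    then have "\<bar>L f - \<kappa> * L (\<L> f) - (\<integral>x. f x \<partial>\<mu>)\<bar> \<le> K * (2 * (\<epsilon> / 8) + c * b) + K * (m * \<epsilon>')"
      using close by linarith
    also have "\<dots> = K * (2 * (\<epsilon> / 8) + c * b + m * \<epsilon>')" by (simp only: distrib_left)
    also have "\<dots> \<le> K * \<epsilon>" using K0 cb c\<epsilon>' \<epsilon> by (intro mult_left_mono) auto
    finally show "\<bar>L f - \<kappa> * L (\<L> f) - (\<integral>x. f x \<partial>\<mu>)\<bar> \<le> K * \<epsilon>" .

    fix \<gamma> assume \<gamma>: "\<gamma> \<in> W"
    have "L f - L (R \<gamma> f) = (\<Sum>y\<in>V. w y * (\<Lambda> y f - \<Lambda> y (R \<gamma> f)))"
      unfolding L_def sum_subtractf[symmetric] right_diff_distrib ..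
    then have "\<bar>L f - L (R \<gamma> f)\<bar> \<le> K * (sqrt (2 * dissipation_bound / \<kappa>) + 2 * b)"
      using sum_w_bound[OF \<Lambda>(3)[OF _ f K \<gamma>]] by simp
    also have "\<dots> \<le> K * (sqrt (2 * dissipation_bound / \<kappa>) + \<epsilon>)"
      using K0 b2 by (intro mult_left_mono) auto
    finally show "\<bar>L f - L (R \<gamma> f)\<bar> \<le> K * (sqrt (2 * dissipation_bound / \<kappa>) + \<epsilon>)" .
  qed
qed

end

section \<open>Gibbs measures and resampling\<close>

context spin_system begin

lemma space_off_site: "space (off_site G A \<gamma>) = X"
  unfolding off_site_def by (rule space_measure_of) auto

lemma sets_off_site:
  "sets (off_site G A \<gamma>) = sigma_sets X {{x \<in> X. x \<delta> \<in> B} | \<delta> B. \<delta> \<in> carrier G - {\<gamma>} \<and> B \<subseteq> A}"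
  unfolding off_site_def by (rule sets_measure_of) auto

lemma subalgebra_off_site:
  assumes "\<mu> \<in> Prob T"
  shows "subalgebra \<mu> (off_site G A \<gamma>)"
  unfolding subalgebra_def
proof
  show "space (off_site G A \<gamma>) = space \<mu>" by (simp add: space_off_site space_Prob[OF assms])
  have "{{x \<in> X. x \<delta> \<in> B} | \<delta> B. \<delta> \<in> carrier G - {\<gamma>} \<and> B \<subseteq> A} \<subseteq> sets \<mu>"
  proof
    fix D assume "D \<in> {{x \<in> X. x \<delta> \<in> B} | \<delta> B. \<delta> \<in> carrier G - {\<gamma>} \<and> B \<subseteq> A}"
    then obtain \<delta> B where D: "D = {x \<in> X. x \<delta> \<in> B}" "\<delta> \<in> carrier G" "B \<subseteq> A" by blast
    have "D = (\<Union>a\<in>B. {x \<in> X. x \<delta> = a})" unfolding D(1) by blast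
    also have "\<dots> \<in> sets \<mu>"
    proof (rule sets.finite_UN)
      show "finite B" using D(3) finite_A finite_subset by blast
      show "{x \<in> X. x \<delta> = a} \<in> sets \<mu>" if "a \<in> B" for a
        using D(2,3) that by (intro openin_sets_Prob[OF assms] openin_coordinate) auto
    qed
    finally show "D \<in> sets \<mu>" .
  qed
  then show "sets (off_site G A \<gamma>) \<subseteq> sets \<mu>"
    unfolding sets_off_site space_Prob[OF assms, symmetric] by (rule sets.sigma_sets_subset)
qed

lemma local_off_site_measurable:
  assumes f: "local_on G A W f" and W: "finite W" "W \<subseteq> carrier G - {\<gamma>}"
  shows "f \<in> borel_measurable (off_site G A \<gamma>)"
proof (rule borel_measurableI)
  fix S :: "real set"
  let ?F = "off_site G A \<gamma>"
  obtain x1 where x1: "x1 \<in> X" using X_nonempty by blast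
  define ext where "ext \<pi> = (\<lambda>\<gamma>. if \<gamma> \<in> W then \<pi> \<gamma> else x1 \<gamma>)" for \<pi>
  let ?P = "{\<pi> \<in> W \<rightarrow>\<^sub>E A. f (ext \<pi>) \<in> S}"
  have "{x \<in> X. \<forall>\<delta>\<in>W. x \<delta> = \<pi> \<delta>} \<in> sets ?F" if "\<pi> \<in> ?P" for \<pi>
  proof -
    have "{x \<in> space ?F. x \<delta> = \<pi> \<delta>} \<in> sets ?F" if "\<delta> \<in> W" for \<delta>
    proof -
      have "\<pi> \<delta> \<in> A" using \<open>\<pi> \<in> ?P\<close> that by (blast dest: PiE_mem)
      then have "{x \<in> X. x \<delta> \<in> {\<pi> \<delta>}} \<in> sets ?F"
        unfolding sets_off_site using W(2) that by (intro sigma_sets.Basic) blast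
      then show ?thesis by (simp add: space_off_site)
    qed
    then have "{x \<in> space ?F. \<forall>\<delta>\<in>W. x \<delta> = \<pi> \<delta>} \<in> sets ?F"
      using W(1) by (intro sets.sets_Collect_finite_All)
    then show ?thesis by (simp add: space_off_site)
  qed
  moreover have "finite ?P"
    by (rule finite_subset[of _ "W \<rightarrow>\<^sub>E A"]) (use W(1) finite_A in \<open>auto intro: finite_PiE\<close>)
  ultimately have "(\<Union>\<pi>\<in>?P. {x \<in> X. \<forall>\<delta>\<in>W. x \<delta> = \<pi> \<delta>}) \<in> sets ?F" by (intro sets.finite_UN)
  moreover have "f -` S \<inter> space ?F = (\<Union>\<pi>\<in>?P. {x \<in> X. \<forall>\<delta>\<in>W. x \<delta> = \<pi> \<delta>})"
  proof -
    have ext: "f (ext \<pi>) = f x" if x: "x \<in> X" and "\<pi> \<in> W \<rightarrow>\<^sub>E A" "\<forall>\<delta>\<in>W. x \<delta> = \<pi> \<delta>" for x \<pi>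
    proof (rule local_onD[OF f _ x])
      show "ext \<pi> \<in> X"
        using that x1 W(2) unfolding ext_def topspace_config_top by (auto simp: PiE_iff extensional_def)
    qed (use that in \<open>simp add: ext_def\<close>)
    show ?thesis
    proof (intro equalityI subsetI)
      fix x assume "x \<in> f -` S \<inter> space ?F"
      then have x: "x \<in> X" "f x \<in> S" by (auto simp: space_off_site)
      have mem: "restrict x W \<in> W \<rightarrow>\<^sub>E A"
        using x(1) W(2) unfolding topspace_config_top restrict_PiE_iff by (blast dest: PiE_mem)
      have "f (ext (restrict x W)) = f x" by (rule ext[OF x(1) mem]) simp
      then have "restrict x W \<in> ?P" using mem x(2) by simp
      moreover have "x \<in> {y \<in> X. \<forall>\<delta>\<in>W. y \<delta> = restrict x W \<delta>}" using x(1) by simp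
      ultimately show "x \<in> (\<Union>\<pi>\<in>?P. {x \<in> X. \<forall>\<delta>\<in>W. x \<delta> = \<pi> \<delta>})" by blast
    next
      fix x assume "x \<in> (\<Union>\<pi>\<in>?P. {x \<in> X. \<forall>\<delta>\<in>W. x \<delta> = \<pi> \<delta>})"
      then obtain \<pi> where \<pi>: "\<pi> \<in> W \<rightarrow>\<^sub>E A" "f (ext \<pi>) \<in> S" "x \<in> X" "\<forall>\<delta>\<in>W. x \<delta> = \<pi> \<delta>" by blast
      then show "x \<in> f -` S \<inter> space ?F" using ext[OF \<pi>(3,1,4)] by (simp add: space_off_site)
    qed
  qed
  ultimately show "f -` S \<inter> space ?F \<in> sets ?F" by simp
qed

lemma local_on_rate: "local_on G A (nbhd \<gamma> - {\<gamma>}) (\<lambda>x. \<rho> \<gamma> x a)"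
  by (rule local_onI) (rule rate_cong)

lemma rate_off_site_measurable:
  "\<gamma> \<in> carrier G \<Longrightarrow> (\<lambda>x. \<rho> \<gamma> x a) \<in> borel_measurable (off_site G A \<gamma>)"
  using nbhd_closed finite_nbhd by (intro local_off_site_measurable[OF local_on_rate]) auto

lemma rate_C: "\<gamma> \<in> carrier G \<Longrightarrow> (\<lambda>x. \<rho> \<gamma> x a) \<in> C T"
  using nbhd_closed finite_nbhd by (intro local_on_imp_C[OF _ _ local_on_rate]) auto

text \<open>The single-coordinate events that define \<open>off_site\<close> are not closed under
  intersection. The local events off \<open>\<gamma>\<close> are, and they generate the same
  sigma-algebra, as Dynkin's argument requires.\<close>

lemma off_site_generator:
  assumes \<gamma>: "\<gamma> \<in> carrier G"
  defines "\<G> \<equiv> {D. D \<subseteq> X \<and> (\<exists>W. finite W \<and> W \<subseteq> carrier G - {\<gamma>} \<and> local_on G A W (indicator D))}"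
  shows "sets (off_site G A \<gamma>) = sigma_sets X \<G>" "Int_stable \<G>" "\<G> \<subseteq> Pow X" "X \<in> \<G>"
proof -
  show "\<G> \<subseteq> Pow X" by (auto simp: \<G>_def)
  show "X \<in> \<G>" unfolding \<G>_def by (auto intro!: exI[of _ "{}"] local_onI)
  show "Int_stable \<G>"
    unfolding Int_stable_def
  proof (intro ballI)
    fix D E assume "D \<in> \<G>" "E \<in> \<G>"
    then obtain W W' where W: "D \<subseteq> X" "finite W" "W \<subseteq> carrier G - {\<gamma>}" "local_on G A W (indicator D)"
      and W': "E \<subseteq> X" "finite W'" "W' \<subseteq> carrier G - {\<gamma>}" "local_on G A W' (indicator E)"
      unfolding \<G>_def by blast
    have "local_on G A (W \<union> W') (indicator (D \<inter> E))"
    proof (rule local_onI)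
      fix x y assume xy: "x \<in> X" "y \<in> X" "\<And>\<delta>. \<delta> \<in> W \<union> W' \<Longrightarrow> x \<delta> = y \<delta>"
      have "(indicator D x :: real) = indicator D y" using xy by (intro local_onD[OF W(4)]) auto
      moreover have "(indicator E x :: real) = indicator E y" using xy by (intro local_onD[OF W'(4)]) auto
      ultimately show "(indicator (D \<inter> E) x :: real) = indicator (D \<inter> E) y"
        by (simp add: indicator_inter_arith)
    qed
    moreover have "D \<inter> E \<subseteq> X" "finite (W \<union> W')" "W \<union> W' \<subseteq> carrier G - {\<gamma>}"
      using W(1-3) W'(1-3) by auto
    ultimately show "D \<inter> E \<in> \<G>" unfolding \<G>_def by blast
  qed
  show "sets (off_site G A \<gamma>) = sigma_sets X \<G>"
  proof (rule antisym)
    show "sets (off_site G A \<gamma>) \<subseteq> sigma_sets X \<G>"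
      unfolding sets_off_site
    proof (rule sigma_sets_mono, rule subsetI)
      fix D assume "D \<in> {{x \<in> X. x \<delta> \<in> B} | \<delta> B. \<delta> \<in> carrier G - {\<gamma>} \<and> B \<subseteq> A}"
      then obtain \<delta> B where D: "D = {x \<in> X. x \<delta> \<in> B}" "\<delta> \<in> carrier G - {\<gamma>}" by blast
      have "local_on G A {\<delta>} (indicator D)"
        unfolding D(1) by (rule local_onI) (simp add: indicator_def)
      then have "D \<in> \<G>" using D unfolding \<G>_def by blast
      then show "D \<in> sigma_sets X \<G>" by (rule sigma_sets.Basic)
    qed
    have "\<G> \<subseteq> sets (off_site G A \<gamma>)"
    proof
      fix D assume "D \<in> \<G>"
      then obtain W where W: "D \<subseteq> X" "finite W" "W \<subseteq> carrier G - {\<gamma>}" "local_on G A W (indicator D)"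
        unfolding \<G>_def by blast
      have "(indicator D :: _ \<Rightarrow> real) \<in> borel_measurable (off_site G A \<gamma>)"
        by (rule local_off_site_measurable[OF W(4,2,3)])
      then have "D \<inter> space (off_site G A \<gamma>) \<in> sets (off_site G A \<gamma>)"
        by (simp add: borel_measurable_indicator_iff)
      then show "D \<in> sets (off_site G A \<gamma>)" using W(1) by (simp add: space_off_site Int_absorb2)
    qed
    then show "sigma_sets X \<G> \<subseteq> sets (off_site G A \<gamma>)"
      unfolding space_off_site[of \<gamma>, symmetric] by (rule sets.sigma_sets_subset)
  qed
qed

text \<open>Let \<open>D\<close> be a local event off \<open>\<gamma>\<close>. Resampling the
  product of the indicators of \<open>D\<close> and \<open>E\<close> yields the indicator of
  \<open>D\<close> times the rate, so invariance is the defining identity of the conditional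
  probability on \<open>D\<close>. These \<open>D\<close> form a generating pi-system, and the
  identity passes to complements and disjoint unions.\<close>

lemma resample_invariant_imp_gibbs:
  assumes \<mu>: "\<mu> \<in> Prob T"
    and inv: "\<And>\<gamma> W f. \<gamma> \<in> carrier G \<Longrightarrow> finite W \<Longrightarrow> W \<subseteq> carrier G \<Longrightarrow> local_on G A W f \<Longrightarrow>
      (\<integral>x. R \<gamma> f x \<partial>\<mu>) = (\<integral>x. f x \<partial>\<mu>)"
  shows "gibbs G A s r J h \<mu>"
  unfolding gibbs_def cond_prob_version_def
proof (intro conjI ballI \<mu>)
  fix \<gamma> a assume \<gamma>: "\<gamma> \<in> carrier G" and a: "a \<in> A"
  let ?F = "off_site G A \<gamma>" and ?c = "\<lambda>x. \<rho> \<gamma> x a"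
  define E where "E = {x \<in> X. x \<gamma> = a}"
  interpret prob_space \<mu> using \<mu> by (rule prob_space_Prob)
  interpret finite_measure_subalgebra \<mu> ?F
    by standard (rule subalgebra_off_site[OF \<mu>])
  have E: "E \<in> sets \<mu>" unfolding E_def by (rule openin_sets_Prob[OF \<mu> openin_coordinate[OF \<gamma> a]])
  have int_E: "integrable \<mu> (indicator E :: _ \<Rightarrow> real)"
    using E by (simp add: integrable_real_indicator emeasure_eq_measure)
  have int_c: "integrable \<mu> ?c" by (rule C_integrable[OF compact_config_top[OF finite_A] \<mu> rate_C[OF \<gamma>]])
  show "?c \<in> borel_measurable ?F" by (rule rate_off_site_measurable[OF \<gamma>])
  show "AE x in \<mu>. real_cond_exp \<mu> ?F (indicator {x \<in> X. x \<gamma> = a}) x = ?c x"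
    unfolding E_def[symmetric]
  proof (rule real_cond_exp_charact[OF _ int_E int_c rate_off_site_measurable[OF \<gamma>]])
    fix D assume D: "D \<in> sets ?F"
    let ?G = "{D. D \<subseteq> X \<and> (\<exists>W. finite W \<and> W \<subseteq> carrier G - {\<gamma>} \<and> local_on G A W (indicator D))}"
    note gen = off_site_generator[OF \<gamma>]
    let ?eq = "\<lambda>D. (LINT x:D|\<mu>. (indicator E x :: real)) = (LINT x:D|\<mu>. ?c x)"
    have sub: "D \<in> sets \<mu>" if "D \<in> sigma_sets X ?G" for D
      using that subalgebra_off_site[OF \<mu>, of \<gamma>] gen(1) unfolding subalgebra_def by blast
    have set_int: "set_integrable \<mu> D g" if "D \<in> sets \<mu>" "integrable \<mu> g" for D and g :: "_ \<Rightarrow> real"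
      unfolding set_integrable_def using that by (rule integrable_mult_indicator)
    have local_eq: "?eq D" if D: "D \<in> ?G" for D
    proof -
      obtain W where W: "D \<subseteq> X" "finite W" "W \<subseteq> carrier G - {\<gamma>}" "local_on G A W (indicator D)"
        using D by blast
      let ?g = "\<lambda>x. indicator D x * indicator E x :: real"
      have g: "local_on G A (insert \<gamma> W) ?g"
      proof (rule local_onI)
        fix x y assume xy: "x \<in> X" "y \<in> X" "\<And>\<delta>. \<delta> \<in> insert \<gamma> W \<Longrightarrow> x \<delta> = y \<delta>"
        have "(indicator D x :: real) = indicator D y" using xy by (intro local_onD[OF W(4)]) auto
        moreover have "(indicator E x :: real) = indicator E y" using xy by (simp add: E_def indicator_def)
        ultimately show "?g x = ?g y" by simp
      qed
      have "(\<integral>x. ?g x \<partial>\<mu>) = (\<integral>x. R \<gamma> ?g x \<partial>\<mu>)"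
        using W \<gamma> by (intro inv[OF \<gamma> _ _ g, symmetric]) auto
      also have "\<dots> = (\<integral>x. indicator D x * ?c x \<partial>\<mu>)"
      proof (intro Bochner_Integration.integral_cong refl)
        fix x assume "x \<in> space \<mu>"
        then have x: "x \<in> X" by (simp add: space_Prob[OF \<mu>])
        have "\<rho> \<gamma> x b * ?g (x(\<gamma> := b)) = (if b = a then indicator D x * ?c x else 0)" if b: "b \<in> A" for b
        proof -
          have "(indicator D (x(\<gamma> := b)) :: real) = indicator D x"
            using x b \<gamma> W(3) by (intro local_onD[OF W(4)] fun_upd_in_X) auto
          moreover have "(indicator E (x(\<gamma> := b)) :: real) = (if b = a then 1 else 0)"
            using fun_upd_in_X[OF x \<gamma> b] by (simp add: E_def indicator_def)
          ultimately show ?thesis by simp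
        qed
        then have "R \<gamma> ?g x = (\<Sum>b\<in>A. if b = a then indicator D x * ?c x else 0)"
          unfolding resample_def by (rule sum.cong[OF refl])
        then show "R \<gamma> ?g x = indicator D x * ?c x" using a finite_A by simp
      qed
      finally show ?thesis unfolding set_lebesgue_integral_def by simp
    qed
    show "?eq D"
      using gen(2,3) D[unfolded gen(1)]
    proof (induction rule: sigma_sets_induct_disjoint)
      case (basic D)
      then show ?case by (rule local_eq)
    next
      case empty
      show ?case by (simp add: set_lebesgue_integral_def)
    next
      case (compl D)
      have D: "D \<in> sets \<mu>" using sub[OF compl(1)] .
      have X: "X \<in> sets \<mu>" using sub[OF sigma_sets.Basic[OF gen(4)]] .
      have DX: "D \<subseteq> X" using sets.sets_into_space[OF D] space_Prob[OF \<mu>] by simp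
      have "(LINT x:X|\<mu>. g x) = (LINT x:D|\<mu>. g x) + (LINT x:X - D|\<mu>. g x)" if "integrable \<mu> g" for g :: "_ \<Rightarrow> real"
      proof -
        have "D \<union> (X - D) = X" using DX by blast
        then show ?thesis
          using set_integral_Un[OF _ set_int[OF D that] set_int[OF sets.Diff[OF X D] that]] by simp
      qed
      from this[OF int_E] this[OF int_c] show ?case using compl(2) local_eq[OF gen(4)] by simp
    next
      case (union D)
      have D: "D i \<in> sets \<mu>" for i using sub union(2) by blast
      have UD: "(\<Union>i. D i) \<in> sets \<mu>" using D by blast
      have *: "D i \<inter> D j = {}" if "i \<noteq> j" for i j using union(1) that by (simp add: disjoint_family_on_def)
      have "(LINT x:(\<Union>i. D i)|\<mu>. g x) = (\<Sum>i. LINT x:D i|\<mu>. g x)" if "integrable \<mu> g" for g :: "_ \<Rightarrow> real"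
        using D * set_int[OF UD that] by (intro lebesgue_integral_countable_add) auto
      from this[OF int_E] this[OF int_c] show ?case using union(3) by simp
    qed
  qed
qed

text \<open>Once the spin at \<open>\<gamma>\<close> is set to \<open>a\<close>, \<open>f\<close>
  depends only on the other coordinates, so under the integral the rate may be exchanged for the
  indicator of \<open>E a\<close>. Summation over \<open>a\<close> restores
  \<open>f\<close>.\<close>

lemma gibbs_imp_resample_invariant:
  assumes gibbs: "gibbs G A s r J h \<mu>" and \<gamma>: "\<gamma> \<in> carrier G"
    and W: "finite W" "W \<subseteq> carrier G" and f: "local_on G A W f"
  shows "(\<integral>x. R \<gamma> f x \<partial>\<mu>) = (\<integral>x. f x \<partial>\<mu>)"
proof -
  have \<mu>: "\<mu> \<in> Prob T" using gibbs by (simp add: gibbs_def)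
  let ?F = "off_site G A \<gamma>"
  interpret prob_space \<mu> using \<mu> by (rule prob_space_Prob)
  interpret finite_measure_subalgebra \<mu> ?F
    by standard (rule subalgebra_off_site[OF \<mu>])
  define E where "E a = {x \<in> X. x \<gamma> = a}" for a
  define f' where "f' a x = f (x(\<gamma> := a))" for a x
  have comp: "compact_space T" by (rule compact_config_top[OF finite_A])
  have f'_local: "local_on G A (W - {\<gamma>}) (f' a)" if "a \<in> A" for a
  proof (rule local_onI)
    fix x y assume "x \<in> X" "y \<in> X" "\<And>\<delta>. \<delta> \<in> W - {\<gamma>} \<Longrightarrow> x \<delta> = y \<delta>"
    then show "f' a x = f' a y"
      unfolding f'_def using that \<gamma> by (intro local_onD[OF f] fun_upd_in_X) auto
  qed
  have f'_F: "f' a \<in> borel_measurable ?F" if "a \<in> A" for a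
    using W by (intro local_off_site_measurable[OF f'_local[OF that]]) auto
  have f'_C: "f' a \<in> C T" if "a \<in> A" for a
    using W by (intro local_on_imp_C[OF _ _ f'_local[OF that]]) auto
  have E_sets: "E a \<in> sets \<mu>" if "a \<in> A" for a
    unfolding E_def by (rule openin_sets_Prob[OF \<mu> openin_coordinate[OF \<gamma> that]])
  have int_E: "integrable \<mu> (\<lambda>x. f' a x * indicator (E a) x)" if "a \<in> A" for a
    using E_sets[OF that] C_integrable[OF comp \<mu> f'_C[OF that]] by (rule integrable_real_mult_indicator)
  have site: "(\<integral>x. \<rho> \<gamma> x a * f' a x \<partial>\<mu>) = (\<integral>x. f' a x * indicator (E a) x \<partial>\<mu>)"
    and int_site: "integrable \<mu> (\<lambda>x. \<rho> \<gamma> x a * f' a x)" if a: "a \<in> A" for a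
  proof -
    have AE: "AE x in \<mu>. real_cond_exp \<mu> ?F (indicator (E a)) x = \<rho> \<gamma> x a"
      using gibbs \<gamma> a unfolding gibbs_def cond_prob_version_def E_def by blast
    have "(\<integral>x. f' a x * indicator (E a) x \<partial>\<mu>) = (\<integral>x. f' a x * real_cond_exp \<mu> ?F (indicator (E a)) x \<partial>\<mu>)"
      using real_cond_exp_intg(2)[OF int_E[OF a] f'_F[OF a]] E_sets[OF a] by simp
    also have "\<dots> = (\<integral>x. \<rho> \<gamma> x a * f' a x \<partial>\<mu>)"
    proof (rule integral_cong_AE)
      have f'_meas: "f' a \<in> borel_measurable \<mu>" by (rule C_measurable[OF \<mu> f'_C[OF a]])
      show "(\<lambda>x. f' a x * real_cond_exp \<mu> ?F (indicator (E a)) x) \<in> borel_measurable \<mu>"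
        using f'_meas borel_measurable_cond_exp2 by (rule borel_measurable_times)
      show "(\<lambda>x. \<rho> \<gamma> x a * f' a x) \<in> borel_measurable \<mu>"
        using C_measurable[OF \<mu> rate_C[OF \<gamma>]] f'_meas by (rule borel_measurable_times)
      show "AE x in \<mu>. f' a x * real_cond_exp \<mu> ?F (indicator (E a)) x = \<rho> \<gamma> x a * f' a x"
        using AE by eventually_elim simp
    qed
    finally show "(\<integral>x. \<rho> \<gamma> x a * f' a x \<partial>\<mu>) = (\<integral>x. f' a x * indicator (E a) x \<partial>\<mu>)" ..
    have "local_on G A (W \<union> nbhd \<gamma>) (\<lambda>x. \<rho> \<gamma> x a * f' a x)"
    proof (rule local_onI)
      fix x y assume xy: "x \<in> X" "y \<in> X" "\<And>\<delta>. \<delta> \<in> W \<union> nbhd \<gamma> \<Longrightarrow> x \<delta> = y \<delta>"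
      have "\<rho> \<gamma> x a = \<rho> \<gamma> y a" using xy by (intro rate_cong) auto
      moreover have "f' a x = f' a y" using xy by (intro local_onD[OF f'_local[OF a]]) auto
      ultimately show "\<rho> \<gamma> x a * f' a x = \<rho> \<gamma> y a * f' a y" by simp
    qed
    then have "(\<lambda>x. \<rho> \<gamma> x a * f' a x) \<in> C T"
      using W finite_nbhd nbhd_closed[OF \<gamma>] by (intro local_on_imp_C) auto
    then show "integrable \<mu> (\<lambda>x. \<rho> \<gamma> x a * f' a x)" by (rule C_integrable[OF comp \<mu>])
  qed
  have "(\<integral>x. R \<gamma> f x \<partial>\<mu>) = (\<Sum>a\<in>A. \<integral>x. \<rho> \<gamma> x a * f' a x \<partial>\<mu>)"
    unfolding resample_def f'_def[symmetric] using int_site by (rule Bochner_Integration.integral_sum)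
  also have "\<dots> = (\<Sum>a\<in>A. \<integral>x. f' a x * indicator (E a) x \<partial>\<mu>)"
    by (intro sum.cong refl site)
  also have "\<dots> = (\<integral>x. (\<Sum>a\<in>A. f' a x * indicator (E a) x) \<partial>\<mu>)"
    using int_E by (rule Bochner_Integration.integral_sum[symmetric])
  also have "\<dots> = (\<integral>x. f x \<partial>\<mu>)"
  proof (intro Bochner_Integration.integral_cong refl)
    fix x assume "x \<in> space \<mu>"
    then have x: "x \<in> X" by (simp add: space_Prob[OF \<mu>])
    have xA: "x \<gamma> \<in> A" using x \<gamma> unfolding topspace_config_top by (rule PiE_mem)
    have "f' a x * indicator (E a) x = (if a = x \<gamma> then f x else 0)" for a
      using x by (auto simp: E_def f'_def indicator_def)
    then show "(\<Sum>a\<in>A. f' a x * indicator (E a) x) = f x" using xA finite_A by simp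
  qed
  finally show ?thesis .
qed

lemma resample_invariant_imp_generator_null:
  assumes \<mu>: "\<mu> \<in> Prob T" and W: "finite W" "W \<subseteq> carrier G" and f: "local_on G A W f"
    and inv: "\<And>\<gamma>. \<gamma> \<in> W \<Longrightarrow> (\<integral>x. R \<gamma> f x \<partial>\<mu>) = (\<integral>x. f x \<partial>\<mu>)"
  shows "(\<integral>x. \<L> f x \<partial>\<mu>) = 0"
proof -
  note integrable = C_integrable[OF compact_config_top[OF finite_A] \<mu>]
  have int_f: "integrable \<mu> f" by (rule integrable[OF local_on_imp_C[OF W f]])
  have int_R: "integrable \<mu> (R \<gamma> f)" if "\<gamma> \<in> W" for \<gamma>
    using that W finite_nbhd nbhd_closed
    by (intro integrable local_on_imp_C[OF _ _ local_on_resample[OF f]]) auto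
  have "(\<integral>x. \<L> f x \<partial>\<mu>) = (\<integral>x. (\<Sum>\<gamma>\<in>W. R \<gamma> f x - f x) \<partial>\<mu>)"
    using generator_local[OF f W] by (intro Bochner_Integration.integral_cong refl) (simp add: space_Prob[OF \<mu>])
  also have "\<dots> = (\<Sum>\<gamma>\<in>W. (\<integral>x. R \<gamma> f x - f x \<partial>\<mu>))"
    using int_R int_f by (intro Bochner_Integration.integral_sum Bochner_Integration.integrable_diff)
  also have "\<dots> = (\<Sum>\<gamma>\<in>W. 0)"
    using int_R int_f inv by (intro sum.cong refl) (simp add: Bochner_Integration.integral_diff)
  finally show ?thesis by simp
qed

end

section \<open>Glauber-invariant measures are Gibbs\<close>

locale PA_glauber = PA_system G A s r J h \<mu> + glauber G A s r J h S
  for G :: "('g, 'm) monoid_scheme" (structure) and A :: "'a set" and s r J h \<mu> S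
begin

text \<open>At fixed \<open>\<kappa>\<close>, the assumption says that
  \<open>f - \<kappa> * \<L> f\<close> and \<open>f\<close> have the same integral under
  \<open>\<mu>\<close>. The approximating states satisfy this relation with \<open>\<mu>\<close>
  asymptotically, so they converge to \<open>\<mu>\<close> and their resampling error passes to the
  limit; only then does \<open>\<kappa>\<close> grow.\<close>

lemma generator_null_imp_resample_invariant:
  assumes null: "\<And>W f. finite W \<Longrightarrow> W \<subseteq> carrier G \<Longrightarrow> local_on G A W f \<Longrightarrow> (\<integral>x. \<L> f x \<partial>\<mu>) = 0"
    and \<gamma>: "\<gamma> \<in> carrier G" and W: "finite W" "W \<subseteq> carrier G" and f: "local_on G A W f"
  shows "(\<integral>x. R \<gamma> f x \<partial>\<mu>) = (\<integral>x. f x \<partial>\<mu>)"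
proof -
  let ?I = "\<lambda>f. \<integral>x. f x \<partial>\<mu>"
  have fC: "f \<in> C T" by (rule local_on_imp_C[OF W f])
  have RC: "R \<gamma> f \<in> C T"
    using W finite_nbhd nbhd_closed[OF \<gamma>] by (intro local_on_imp_C[OF _ _ local_on_resample[OF f \<gamma>]]) auto
  have bound: "\<exists>K\<ge>0. \<forall>x\<in>X. \<bar>f x\<bar> \<le> K" if "f \<in> C T" for f
    by (rule C_bounded[OF compact_config_top[OF finite_A] that]) blast
  obtain K where K: "K \<ge> 0" "\<forall>x\<in>X. \<bar>f x\<bar> \<le> K" using bound[OF fC] by blast
  \<comment> \<open>Finite windows exhausting \<Gamma>, so that a single sequence of states
    eventually deals with every local function.\<close>
  define Wn where "Wn n = {\<delta> \<in> carrier G. to_nat_on (carrier G) \<delta> \<le> n}" for n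
  have Wn: "finite (Wn n)" "Wn n \<subseteq> carrier G" for n
  proof -
    have "inj_on (to_nat_on (carrier G)) (Wn n)"
      using inj_on_subset[OF inj_on_to_nat_on[OF countable_G]] by (auto simp: Wn_def)
    moreover have "to_nat_on (carrier G) ` Wn n \<subseteq> {..n}" by (auto simp: Wn_def)
    ultimately show "finite (Wn n)" by (rule inj_on_finite) simp
  qed (auto simp: Wn_def)
  have ev: "\<forall>\<^sub>F n in sequentially. W \<subseteq> Wn n" if W: "finite W" "W \<subseteq> carrier G" for W
  proof -
    have "\<forall>n\<ge>Max (to_nat_on (carrier G) ` W). W \<subseteq> Wn n"
    proof (intro allI impI subsetI)
      fix n \<delta> assume n: "Max (to_nat_on (carrier G) ` W) \<le> n" and \<delta>: "\<delta> \<in> W"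
      have "to_nat_on (carrier G) \<delta> \<le> Max (to_nat_on (carrier G) ` W)" using W(1) \<delta> by (intro Max_ge) auto
      then show "\<delta> \<in> Wn n" using n \<delta> W(2) by (auto simp: Wn_def)
    qed
    then show ?thesis unfolding eventually_sequentially by blast
  qed
  have main: "\<bar>?I f - ?I (R \<gamma> f)\<bar> \<le> K * sqrt (2 * dissipation_bound / \<kappa>)" if \<kappa>: "\<kappa> > 0" for \<kappa>
  proof -
    define Q where "Q n L \<longleftrightarrow> state T L \<and> (\<forall>f K. local_on G A (Wn n) f \<longrightarrow> (\<forall>x\<in>X. \<bar>f x\<bar> \<le> K) \<longrightarrow>
      \<bar>L f - \<kappa> * L (\<L> f) - ?I f\<bar> \<le> K * (1 / real (Suc n)) \<and>
      (\<forall>\<gamma>\<in>Wn n. \<bar>L f - L (R \<gamma> f)\<bar> \<le> K * (sqrt (2 * dissipation_bound / \<kappa>) + 1 / real (Suc n))))" for n L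
    have "\<exists>L. Q n L" for n
      unfolding Q_def by (rule approximate_resolvent[OF \<kappa> _ _ Wn]) simp_all
    then obtain L where "\<And>n. Q n (L n)" by metis
    then have L: "\<And>n. state T (L n)"
      "\<And>n f K. local_on G A (Wn n) f \<Longrightarrow> \<forall>x\<in>X. \<bar>f x\<bar> \<le> K \<Longrightarrow>
        \<bar>L n f - \<kappa> * L n (\<L> f) - ?I f\<bar> \<le> K * (1 / real (Suc n))"
      "\<And>n f K \<gamma>. local_on G A (Wn n) f \<Longrightarrow> \<forall>x\<in>X. \<bar>f x\<bar> \<le> K \<Longrightarrow> \<gamma> \<in> Wn n \<Longrightarrow>
        \<bar>L n f - L n (R \<gamma> f)\<bar> \<le> K * (sqrt (2 * dissipation_bound / \<kappa>) + 1 / real (Suc n))"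
      unfolding Q_def by blast+
    have inv_Suc: "(\<lambda>n. K * (1 / real (Suc n))) \<longlonglongrightarrow> 0" for K
      using tendsto_mult_right_zero[OF LIMSEQ_Suc[OF lim_const_over_n[of 1]]] by simp
    have lim: "(\<lambda>n. L n g) \<longlonglongrightarrow> ?I g" if g: "g \<in> C T" for g
    proof (rule state_tendsto_if_local_resolvent_tendsto[OF \<kappa> L(1) state_\<mu> _ g])
      fix W f assume W: "finite W" "W \<subseteq> carrier G" and f: "local_on G A W f"
      note fC = local_on_imp_C[OF W f] and gC = local_generator_C[OF f W]
      obtain K where K: "\<forall>x\<in>X. \<bar>f x\<bar> \<le> K" using bound[OF fC] by blast
      have split: "M (\<lambda>x. f x - \<kappa> * \<L> f x) = M f - \<kappa> * M (\<L> f)" if M: "state T M" for M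
        using state_diff[OF M fC C_cmult[OF gC, of \<kappa>]] state_cmult[OF M gC] by simp
      have I_eq: "?I (\<lambda>x. f x - \<kappa> * \<L> f x) = ?I f" using split[OF state_\<mu>] null[OF W f] by simp
      have "\<forall>\<^sub>F n in sequentially. norm (L n (\<lambda>x. f x - \<kappa> * \<L> f x) - ?I f) \<le> K * (1 / real (Suc n))"
        using ev[OF W]
      proof eventually_elim
        case (elim n)
        show ?case using L(2)[OF local_on_mono[OF f elim] K] split[OF L(1)] by simp
      qed
      then have "(\<lambda>n. L n (\<lambda>x. f x - \<kappa> * \<L> f x) - ?I f) \<longlonglongrightarrow> 0"
        using inv_Suc by (rule Lim_null_comparison)
      then show "(\<lambda>n. L n (\<lambda>x. f x - \<kappa> * \<L> f x)) \<longlonglongrightarrow> ?I (\<lambda>x. f x - \<kappa> * \<L> f x)"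
        unfolding I_eq by (rule LIM_zero_cancel)
    qed
    have "(\<lambda>n. \<bar>L n f - L n (R \<gamma> f)\<bar>) \<longlonglongrightarrow> \<bar>?I f - ?I (R \<gamma> f)\<bar>"
      by (intro tendsto_intros lim fC RC)
    moreover have "(\<lambda>n. K * sqrt (2 * dissipation_bound / \<kappa>) + K * (1 / real (Suc n)))
        \<longlonglongrightarrow> K * sqrt (2 * dissipation_bound / \<kappa>) + 0"
      by (intro tendsto_add tendsto_const inv_Suc)
    moreover have "\<forall>\<^sub>F n in sequentially.
        \<bar>L n f - L n (R \<gamma> f)\<bar> \<le> K * sqrt (2 * dissipation_bound / \<kappa>) + K * (1 / real (Suc n))"
    proof -
      have "\<forall>\<^sub>F n in sequentially. insert \<gamma> W \<subseteq> Wn n" using W \<gamma> by (intro ev) auto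
      then show ?thesis
      proof eventually_elim
        case (elim n)
        then have "W \<subseteq> Wn n" "\<gamma> \<in> Wn n" by auto
        then show ?case
          using L(3)[OF local_on_mono[OF f] K(2)] unfolding distrib_left by blast
      qed
    qed
    ultimately have "\<bar>?I f - ?I (R \<gamma> f)\<bar> \<le> K * sqrt (2 * dissipation_bound / \<kappa>) + 0"
      by (intro tendsto_le[OF trivial_limit_sequentially])
    then show ?thesis by simp
  qed
  \<comment> \<open>The bound \<open>main\<close> is used along
    \<open>\<kappa> = Suc m\<close>.\<close>
  have "(\<lambda>m. 2 * dissipation_bound / real (Suc m)) \<longlonglongrightarrow> 0"
    by (rule LIMSEQ_Suc[OF lim_const_over_n])
  then have "(\<lambda>m. K * sqrt (2 * dissipation_bound / real (Suc m))) \<longlonglongrightarrow> K * sqrt 0"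
    by (intro tendsto_mult tendsto_const tendsto_real_sqrt)
  then have "\<bar>?I f - ?I (R \<gamma> f)\<bar> \<le> K * sqrt 0"
    by (rule LIMSEQ_le_const) (use main in auto)
  then show ?thesis by simp
qed

lemma gibbs_iff_invariant: "gibbs G A s r J h \<mu> \<longleftrightarrow> semigroup_invariant T S \<mu>"
proof
  assume gibbs: "gibbs G A s r J h \<mu>"
  have "(\<integral>x. \<L> f x \<partial>\<mu>) = 0" if W: "finite W" "W \<subseteq> carrier G" and f: "local_on G A W f" for W f
    using gibbs_imp_resample_invariant[OF gibbs _ W f] W(2)
    by (intro resample_invariant_imp_generator_null[OF \<mu>_Prob W f]) blast
  then have null: "(\<integral>x. g x \<partial>\<mu>) = 0" if "(f, g) \<in> generator_graph T S" for f g
    by (rule state_null_on_local_generator[OF state_\<mu> _ that])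
  show "semigroup_invariant T S \<mu>"
    unfolding semigroup_invariant_def evolves_to_def
    using \<mu>_Prob generator_null_imp_invariant[OF state_\<mu> null] by simp
next
  assume inv: "semigroup_invariant T S \<mu>"
  have "(\<integral>x. S t f x \<partial>\<mu>) = (\<integral>x. f x \<partial>\<mu>)" if "t \<ge> 0" "f \<in> C T" for t f
    using inv that unfolding semigroup_invariant_def evolves_to_def by simp
  then have "(\<integral>x. g x \<partial>\<mu>) = 0" if "(f, g) \<in> generator_graph T S" for f g
    using invariant_state_generator[OF state_\<mu> _ that] generatorD(1)[OF that] by blast
  then have null: "(\<integral>x. \<L> f x \<partial>\<mu>) = 0" if "finite W" "W \<subseteq> carrier G" "local_on G A W f" for W f
    using local_in_generator[OF that(3,1,2)] by blast
  show "gibbs G A s r J h \<mu>"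
    by (rule resample_invariant_imp_gibbs[OF \<mu>_Prob generator_null_imp_resample_invariant[OF null]])
qed

end

theorem corollary1p1:
  fixes G :: "('g, 'm) monoid_scheme"
    and s :: "nat \<Rightarrow> 'g" and r :: nat
    and A :: "'a set"
    and J :: "'a \<Rightarrow> 'a \<Rightarrow> real" and h :: "'a \<Rightarrow> real"
    and S :: "real \<Rightarrow> (('g \<Rightarrow> 'a) \<Rightarrow> real) \<Rightarrow> (('g \<Rightarrow> 'a) \<Rightarrow> real)"
    and \<mu> :: "('g \<Rightarrow> 'a) measure"
  assumes "group G" and "countable (carrier G)"
    and "r \<ge> 1" and "s ` {1..r} \<subseteq> carrier G" and "generate G (s ` {1..r}) = carrier G"
    and "finite A" and "A \<noteq> {}"
    and "\<forall>a\<in>A. \<forall>b\<in>A. J a b = J b a"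
    and "glauber_semigroup G A s r J h S"
    and "property_PA G"
    and "\<mu> \<in> shift_invariant_Prob G A"
  shows "gibbs G A s r J h \<mu> \<longleftrightarrow> semigroup_invariant (config_top G A) S \<mu>"
proof -
  interpret G: group G by fact
  interpret PA_glauber G A s r J h \<mu> S
  proof
    show "s i \<in> carrier G" if "i \<in> {1..r}" for i using assms(4) that by blast
    show "J a b = J b a" if "a \<in> A" "b \<in> A" for a b using assms(8) that by blast
  qed fact+
  show ?thesis by (rule gibbs_iff_invariant)
qed

end
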